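(* Let $R$ be a catenary Noetherian commutative ring of finite dimension $r$. Then the adelic $(r+1)$-cube $R_{ad}$ of commutative rings is a homotopy pullback in the derived category $\mathsf D(R)$; that is, the natural map $$R=R_{ad}(\emptyset)\longrightarrow \operatorname{holim}_{\emptyset\ne\mathbf d\subseteq\{0,\dots,r\}}R_{ad}(\mathbf d)$$ is an equivalence.
   Context: Order the primes of $R$ by $\mathfrak q\le\mathfrak p$ iff $\mathfrak q\supseteq\mathfrak p$ as ideals. Catenary means: for every prime $\mathfrak p$ there is a bound on the length $s$ of chains $\mathfrak p=\mathfrak p_0>\mathfrak p_1>\cdots>\mathfrak p_s$, and all maximal such chains starting at $\mathfrak p$ have the same length, denoted $\dim\mathfrak p$ (this is the Krull dimension of $R/\mathfrak p$; maximal ideals have dimension $0$). The dimension of $R$ is $r=\max_{\mathfrak p}\dim\mathfrak p$. Write $L_{\mathfrak p}N=N_{\mathfrak p}$ for localization and $R^\wedge_{\mathfrak p}=\lim_nR/\mathfrak p^n$ for the $\mathfrak p$-adic completion of $R$. The completions form a coefficient system: for $\mathfrak q\le\mathfrak p$ there is a natural map $R^\wedge_{\mathfrak p}\to R^\wedge_{\mathfrak q}$. The cube $R_{ad}$ is the functor from the poset of subsets $\mathbf d=(d_0>d_1>\cdots>d_s)$ of $\{0,1,\dots,r\}$ to commutative rings with $R_{ad}(\emptyset)=R$ and, for $\mathbf d\neq\emptyset$, $$R_{ad}(\mathbf d)=\prod_{\dim\mathfrak p_0=d_0}L_{\mathfrak p_0}\prod_{\substack{\mathfrak p_1<\mathfrak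 p_0\\ \dim\mathfrak p_1=d_1}}L_{\mathfrak p_1}\cdots\prod_{\substack{\mathfrak p_s<\mathfrak p_{s-1}\\ \dim\mathfrak p_s=d_s}}L_{\mathfrak p_s}R^\wedge_{\mathfrak p_s}.$$ The map for inserting one extra dimension $e$ in a subset is induced as follows. If $e$ is inserted at position $i$ and is not the smallest element of the new subset, then at the $i$th spot one takes, for each prime $\mathfrak p_i$ of dimension $e$ (with $\mathfrak p_i<\mathfrak p_{i-1}$ if $i>0$), the projection of the product over primes $\mathfrak p_{i+1}$ below $\mathfrak p_{i-1}$ (or over all $\mathfrak p_{i+1}$ if $i=0$) onto the product over those $\mathfrak p_{i+1}<\mathfrak p_i$, followed by the localization map into $L_{\mathfrak p_i}$ of it, and then applies the outer products and localizations. If $e$ is inserted as the new smallest element, one uses the map $R^\wedge_{\mathfrak p_s}\to\prod_{\mathfrak p_{s+1}<\mathfrak p_s,\ \dim\mathfrak p_{s+1}=e}L_{\mathfrak p_{s+1}}R^\wedge_{\mathfrak p_{s+1}}$ given by the coefficient system and localization, and applies $L_{\mathfrak p_s}$ and the outer products and localizations. The maps out of $R_{ad}(\emptyset)=R$ are the natural ring maps $R\to\prod_{\dim\mathfrak p=d}L_{\mathfrak p}R^\wedge_{\mathfrak p}$. *)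

theory Defs
  imports "HOL-Algebra.Algebra"
begin

section \<open>Cochain complexes of modules and homotopy limits\<close>

definition module_hom ::
  "('r, 's) ring_scheme \<Rightarrow> ('r, 'x, 'm) module_scheme \<Rightarrow> ('r, 'y, 'n) module_scheme \<Rightarrow> ('x \<Rightarrow> 'y) set"
  where "module_hom R M N =
    {f \<in> carrier M \<rightarrow> carrier N.
      (\<forall>x\<in>carrier M. \<forall>y\<in>carrier M. f (x \<oplus>\<^bsub>M\<^esub> y) = f x \<oplus>\<^bsub>N\<^esub> f y) \<and>
      (\<forall>a\<in>carrier R. \<forall>x\<in>carrier M. f (a \<odot>\<^bsub>M\<^esub> x) = a \<odot>\<^bsub>N\<^esub> f x)}"

text \<open>Complexes are graded by the natural numbers; every other degree is understood to be zero.\<close>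

record ('r, 'x) cochain =
  Term :: "nat \<Rightarrow> ('r, 'x) module"
  Diff :: "nat \<Rightarrow> 'x \<Rightarrow> 'x"

definition cochain_complex :: "('r, 's) ring_scheme \<Rightarrow> ('r, 'x) cochain \<Rightarrow> bool"
  where "cochain_complex R K \<longleftrightarrow>
    (\<forall>n. module R (Term K n)) \<and>
    (\<forall>n. Diff K n \<in> module_hom R (Term K n) (Term K (Suc n))) \<and>
    (\<forall>n. \<forall>x\<in>carrier (Term K n). Diff K (Suc n) (Diff K n x) = \<zero>\<^bsub>Term K (Suc (Suc n))\<^esub>)"

definition cocycles :: "('r, 'x) cochain \<Rightarrow> nat \<Rightarrow> 'x set"
  where "cocycles K n = {x \<in> carrier (Term K n). Diff K n x = \<zero>\<^bsub>Term K (Suc n)\<^esub>}"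

fun coboundaries :: "('r, 'x) cochain \<Rightarrow> nat \<Rightarrow> 'x set"
  where
    "coboundaries K 0 = {\<zero>\<^bsub>Term K 0\<^esub>}"
  | "coboundaries K (Suc n) = Diff K n ` carrier (Term K n)"

definition cohomology :: "('r, 'x) cochain \<Rightarrow> nat \<Rightarrow> 'x set set"
  where "cohomology K n = (\<lambda>z. coboundaries K n +>\<^bsub>Term K n\<^esub> z) ` cocycles K n"

definition cochain_map ::
  "('r, 's) ring_scheme \<Rightarrow> ('r, 'x) cochain \<Rightarrow> ('r, 'y) cochain \<Rightarrow> (nat \<Rightarrow> 'x \<Rightarrow> 'y) \<Rightarrow> bool"
  where "cochain_map R K L f \<longleftrightarrow>
    (\<forall>n. f n \<in> module_hom R (Term K n) (Term L n)) \<and>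
    (\<forall>n. \<forall>x\<in>carrier (Term K n). f (Suc n) (Diff K n x) = Diff L n (f n x))"

text \<open>In \<^term>\<open>cohomology_map\<close>, adding the coboundaries to the image of a cohomology class
  yields the coset that the induced map assigns to this class.\<close>

definition cohomology_map ::
  "('r, 'y) cochain \<Rightarrow> (nat \<Rightarrow> 'x \<Rightarrow> 'y) \<Rightarrow> nat \<Rightarrow> 'x set \<Rightarrow> 'y set"
  where "cohomology_map L f n C = coboundaries L n <+>\<^bsub>Term L n\<^esub> (f n ` C)"

text \<open>A map of complexes becomes an isomorphism in the derived category iff it is a
  quasi-isomorphism, i.e. bijective on cohomology in every degree.\<close>

definition quasi_iso ::
  "('r, 's) ring_scheme \<Rightarrow> ('r, 'x) cochain \<Rightarrow> ('r, 'y) cochain \<Rightarrow> (nat \<Rightarrow> 'x \<Rightarrow> 'y) \<Rightarrow> bool"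
  where "quasi_iso R K L f \<longleftrightarrow>
    cochain_complex R K \<and> cochain_complex R L \<and> cochain_map R K L f \<and>
    (\<forall>n. bij_betw (cohomology_map L f n) (cohomology K n) (cohomology L n))"

definition in_degree_zero :: "('r, 'x) module \<Rightarrow> ('r, 'x) cochain"
  where "in_degree_zero M =
    \<lparr>Term = (\<lambda>n. if n = 0 then M else M\<lparr>carrier := {\<zero>\<^bsub>M\<^esub>}, one := \<zero>\<^bsub>M\<^esub>\<rparr>),
     Diff = (\<lambda>n x. \<zero>\<^bsub>M\<^esub>)\<rparr>"

definition product_algebra :: "'i set \<Rightarrow> ('i \<Rightarrow> ('r, 'x) module) \<Rightarrow> ('r, 'i \<Rightarrow> 'x) module"
  where "product_algebra I M =
    \<lparr>carrier = (\<Pi>\<^sub>E i\<in>I. carrier (M i)),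
     monoid.mult = (\<lambda>x y. \<lambda>i\<in>I. x i \<otimes>\<^bsub>M i\<^esub> y i),
     one = (\<lambda>i\<in>I. \<one>\<^bsub>M i\<^esub>),
     ring.zero = (\<lambda>i\<in>I. \<zero>\<^bsub>M i\<^esub>),
     add = (\<lambda>x y. \<lambda>i\<in>I. x i \<oplus>\<^bsub>M i\<^esub> y i),
     smult = (\<lambda>a x. \<lambda>i\<in>I. a \<odot>\<^bsub>M i\<^esub> x i)\<rparr>"

text \<open>Functors from the poset \<open>J\<close> to \<open>R\<close>-modules.\<close>

definition module_diagram ::
  "('r, 's) ring_scheme \<Rightarrow> 'j::order set \<Rightarrow> ('j \<Rightarrow> ('r, 'x) module) \<Rightarrow> ('j \<Rightarrow> 'j \<Rightarrow> 'x \<Rightarrow> 'x) \<Rightarrow> bool"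
  where "module_diagram R J F \<phi> \<longleftrightarrow>
    (\<forall>j\<in>J. module R (F j)) \<and>
    (\<forall>i\<in>J. \<forall>j\<in>J. i \<le> j \<longrightarrow> \<phi> i j \<in> module_hom R (F i) (F j)) \<and>
    (\<forall>j\<in>J. \<forall>x\<in>carrier (F j). \<phi> j j x = x) \<and>
    (\<forall>i\<in>J. \<forall>j\<in>J. \<forall>k\<in>J. i \<le> j \<longrightarrow> j \<le> k \<longrightarrow> (\<forall>x\<in>carrier (F i). \<phi> j k (\<phi> i j x) = \<phi> i k x))"

text \<open>The homotopy limit of a diagram of modules, each placed in degree zero, is the
  totalization of its cosimplicial replacement (Bousfield--Kan), that is, the normalized
  cochain complex with \<open>\<Prod> F(j\<^sub>n)\<close> over the nondegenerate \<open>n\<close>-simplices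
  \<open>j\<^sub>0 < \<dots> < j\<^sub>n\<close> of the nerve in degree \<open>n\<close>. Normalization is legitimate because
  in the nerve of a poset the faces of a nondegenerate simplex are nondegenerate.\<close>

definition strict_chains :: "'j::order set \<Rightarrow> nat \<Rightarrow> 'j list set"
  where "strict_chains J n = {c. length c = Suc n \<and> set c \<subseteq> J \<and> sorted_wrt (<) c}"

definition omit :: "nat \<Rightarrow> 'j list \<Rightarrow> 'j list"
  where "omit i c = take i c @ drop (Suc i) c"

definition signed :: "('x, 'm) ring_scheme \<Rightarrow> nat \<Rightarrow> 'x \<Rightarrow> 'x"
  where "signed M i x = (if even i then x else \<ominus>\<^bsub>M\<^esub> x)"

text \<open>Every face but the last keeps the final vertex \<open>j\<^sub>n\<^sub>+\<^sub>1\<close>; omitting that vertex requires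
  the transition map \<open>F(j\<^sub>n) \<rightarrow> F(j\<^sub>n\<^sub>+\<^sub>1)\<close>.\<close>

definition holim ::
  "'j::order set \<Rightarrow> ('j \<Rightarrow> ('r, 'x) module) \<Rightarrow> ('j \<Rightarrow> 'j \<Rightarrow> 'x \<Rightarrow> 'x) \<Rightarrow> ('r, 'j list \<Rightarrow> 'x) cochain"
  where "holim J F \<phi> =
    \<lparr>Term = (\<lambda>n. product_algebra (strict_chains J n) (\<lambda>c. F (last c))),
     Diff = (\<lambda>n x. \<lambda>c\<in>strict_chains J (Suc n).
       finsum (F (last c))
         (\<lambda>i. signed (F (last c)) i
           (if i \<le> n then x (omit i c) else \<phi> (c ! n) (last c) (x (butlast c))))
         {..Suc n})\<rparr>"

definition to_holim ::
  "'j::order \<Rightarrow> 'j set \<Rightarrow> ('j \<Rightarrow> ('r, 'x) module) \<Rightarrow> ('j \<Rightarrow> 'j \<Rightarrow> 'x \<Rightarrow> 'x) \<Rightarrow> nat \<Rightarrow> 'x \<Rightarrow> 'j list \<Rightarrow> 'x"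
  where "to_holim j J F \<phi> n x =
    (if n = 0 then \<lambda>c\<in>strict_chains J 0. \<phi> j (last c) x else \<zero>\<^bsub>Term (holim J F \<phi>) n\<^esub>)"

definition homotopy_pullback ::
  "('r, 's) ring_scheme \<Rightarrow> 'i set \<Rightarrow> ('i set \<Rightarrow> ('r, 'x) module) \<Rightarrow>
    ('i set \<Rightarrow> 'i set \<Rightarrow> 'x \<Rightarrow> 'x) \<Rightarrow> bool"
  where "homotopy_pullback R E F \<phi> \<longleftrightarrow>
    module_diagram R (Pow E) F \<phi> \<and>
    quasi_iso R (in_degree_zero (F {})) (holim (Pow E - {{}}) F \<phi>)
      (to_holim {} (Pow E - {{}}) F \<phi>)"


section \<open>Chains of primes, catenary rings and dimension\<close>

text \<open>A list \<open>[p\<^sub>0, \<dots>, p\<^sub>s]\<close>, increasing as ideals, is a chain of length \<open>s\<close>.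
  In the order used for primes below, \<open>q < p\<close> means that \<open>q\<close> strictly contains \<open>p\<close>.\<close>

definition prime_chains :: "('a, 'b) ring_scheme \<Rightarrow> 'a set \<Rightarrow> 'a set list set"
  where "prime_chains R p =
    {c. c \<noteq> [] \<and> hd c = p \<and> (\<forall>q\<in>set c. primeideal q R) \<and> sorted_wrt (\<subset>) c}"

definition maximal_prime_chains :: "('a, 'b) ring_scheme \<Rightarrow> 'a set \<Rightarrow> 'a set list set"
  where "maximal_prime_chains R p =
    {c \<in> prime_chains R p. \<forall>c'\<in>prime_chains R p. \<not> set c \<subset> set c'}"

definition catenary :: "('a, 'b) ring_scheme \<Rightarrow> bool"
  where "catenary R \<longleftrightarrow>
    (\<forall>p. primeideal p R \<longrightarrow>
      (\<exists>b. \<forall>c\<in>prime_chains R p. length c \<le> b) \<and>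
      (\<forall>c\<in>maximal_prime_chains R p. \<forall>c'\<in>maximal_prime_chains R p. length c = length c'))"

definition prime_dim :: "('a, 'b) ring_scheme \<Rightarrow> 'a set \<Rightarrow> nat"
  where "prime_dim R p = (THE s. \<exists>c\<in>maximal_prime_chains R p. length c = Suc s)"

definition has_dimension :: "('a, 'b) ring_scheme \<Rightarrow> nat \<Rightarrow> bool"
  where "has_dimension R r \<longleftrightarrow>
    (\<exists>p. primeideal p R \<and> prime_dim R p = r) \<and>
    (\<forall>p. primeideal p R \<longrightarrow> prime_dim R p \<le> r)"


section \<open>Localization and completion\<close>

definition localization_rel ::
  "('a, 'b) ring_scheme \<Rightarrow> 'a set \<Rightarrow> ('a, 'x) module \<Rightarrow> (('x \<times> 'a) \<times> ('x \<times> 'a)) set"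
  where "localization_rel R p M =
    {((m, s), (n, t)). m \<in> carrier M \<and> n \<in> carrier M \<and>
      s \<in> carrier R - p \<and> t \<in> carrier R - p \<and>
      (\<exists>u\<in>carrier R - p. u \<odot>\<^bsub>M\<^esub> (t \<odot>\<^bsub>M\<^esub> m) = u \<odot>\<^bsub>M\<^esub> (s \<odot>\<^bsub>M\<^esub> n))}"

definition fraction ::
  "('a, 'b) ring_scheme \<Rightarrow> 'a set \<Rightarrow> ('a, 'x) module \<Rightarrow> 'x \<Rightarrow> 'a \<Rightarrow> ('x \<times> 'a) set"
  where "fraction R p M m s = localization_rel R p M `` {(m, s)}"

definition localization ::
  "('a, 'b) ring_scheme \<Rightarrow> 'a set \<Rightarrow> ('a, 'x) module \<Rightarrow> ('a, ('x \<times> 'a) set) module"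
  where "localization R p M =
    \<lparr>carrier = (carrier M \<times> (carrier R - p)) // localization_rel R p M,
     monoid.mult = (\<lambda>x y. \<Union>(m, s)\<in>x. \<Union>(n, t)\<in>y. fraction R p M (m \<otimes>\<^bsub>M\<^esub> n) (s \<otimes>\<^bsub>R\<^esub> t)),
     one = fraction R p M \<one>\<^bsub>M\<^esub> \<one>\<^bsub>R\<^esub>,
     ring.zero = fraction R p M \<zero>\<^bsub>M\<^esub> \<one>\<^bsub>R\<^esub>,
     add = (\<lambda>x y. \<Union>(m, s)\<in>x. \<Union>(n, t)\<in>y.
       fraction R p M (t \<odot>\<^bsub>M\<^esub> m \<oplus>\<^bsub>M\<^esub> s \<odot>\<^bsub>M\<^esub> n) (s \<otimes>\<^bsub>R\<^esub> t)),
     smult = (\<lambda>a x. \<Union>(m, s)\<in>x. fraction R p M (a \<odot>\<^bsub>M\<^esub> m) s)\<rparr>"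

abbreviation ideal_power :: "('a, 'b) ring_scheme \<Rightarrow> 'a set \<Rightarrow> nat \<Rightarrow> 'a set"
  where "ideal_power R I n \<equiv> I [^]\<^bsub>ideals_set R\<^esub> n"

text \<open>The limit of the rings \<open>R / I\<^sup>n\<close>; for ideals \<open>J \<subseteq> I\<close> the projection
  \<open>R / J \<rightarrow> R / I\<close> sends a coset \<open>C\<close> to \<open>I + C\<close>.\<close>

definition adic_completion :: "('a, 'b) ring_scheme \<Rightarrow> 'a set \<Rightarrow> ('a, nat \<Rightarrow> 'a set) module"
  where "adic_completion R I =
    \<lparr>carrier = {x. (\<forall>n. x n \<in> carrier (R Quot ideal_power R I n)) \<and>
       (\<forall>n. ideal_power R I n <+>\<^bsub>R\<^esub> x (Suc n) = x n)},
     monoid.mult = (\<lambda>x y n. x n \<otimes>\<^bsub>R Quot ideal_power R I n\<^esub> y n),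
     one = (\<lambda>n. \<one>\<^bsub>R Quot ideal_power R I n\<^esub>),
     ring.zero = (\<lambda>n. \<zero>\<^bsub>R Quot ideal_power R I n\<^esub>),
     add = (\<lambda>x y n. x n \<oplus>\<^bsub>R Quot ideal_power R I n\<^esub> y n),
     smult = (\<lambda>a x n. (ideal_power R I n +>\<^bsub>R\<^esub> a) \<otimes>\<^bsub>R Quot ideal_power R I n\<^esub> x n)\<rparr>"

definition self_algebra :: "('a, 'b) ring_scheme \<Rightarrow> ('a, 'a) module"
  where "self_algebra R =
    \<lparr>carrier = carrier R, monoid.mult = monoid.mult R, one = \<one>\<^bsub>R\<^esub>,
     ring.zero = \<zero>\<^bsub>R\<^esub>, add = add R, smult = monoid.mult R\<rparr>"


section \<open>The adelic cube\<close>

text \<open>The number of nested products and localizations in \<open>R\<^sub>a\<^sub>d(d)\<close> varies with \<open>d\<close>, so the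
  elements of all these rings are encoded in one type. A datatype cannot recurse through sets,
  hence an element of a localization is represented by a chosen pair \<open>(m, s)\<close> in the
  equivalence class rather than by the class itself. All ring structures are transported along
  the injective encodings by \<^term>\<open>image_ring\<close>.\<close>

datatype 'a adele =
    Scalar (scalar: 'a)
  | Completed (completed: "nat \<Rightarrow> 'a set")
  | Family (family: "'a set \<Rightarrow> 'a adele")
  | Fraction (numerator: "'a adele") (denominator: 'a)

definition encode_fraction :: "('a adele \<times> 'a) set \<Rightarrow> 'a adele"
  where "encode_fraction C = (case (SOME z. z \<in> C) of (m, s) \<Rightarrow> Fraction m s)"

definition image_algebra :: "('x \<Rightarrow> 'y) \<Rightarrow> ('r, 'x) module \<Rightarrow> ('r, 'y) module"
  where "image_algebra h M = ring.extend (image_ring h M)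
    \<lparr>smult = (\<lambda>a y. h (a \<odot>\<^bsub>M\<^esub> inv_into (carrier M) h y))\<rparr>"

definition localize ::
  "('a, 'b) ring_scheme \<Rightarrow> 'a set \<Rightarrow> ('a, 'a adele) module \<Rightarrow> ('a, 'a adele) module"
  where "localize R p M = image_algebra encode_fraction (localization R p M)"

definition to_localize ::
  "('a, 'b) ring_scheme \<Rightarrow> 'a set \<Rightarrow> ('a, 'a adele) module \<Rightarrow> 'a adele \<Rightarrow> 'a adele"
  where "to_localize R p M m = encode_fraction (fraction R p M m \<one>\<^bsub>R\<^esub>)"

definition localize_map ::
  "('a, 'b) ring_scheme \<Rightarrow> 'a set \<Rightarrow> ('a, 'a adele) module \<Rightarrow> ('a adele \<Rightarrow> 'a adele) \<Rightarrow>
    'a adele \<Rightarrow> 'a adele"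
  where "localize_map R p N f x =
    encode_fraction (fraction R p N (f (numerator x)) (denominator x))"

text \<open>The nested products are built recursively over the strictly decreasing list of
  dimensions that remain. The argument \<open>u\<close> is the innermost prime chosen so far, or \<open>None\<close>
  at the outset, when the next prime is unrestricted. With this convention \<open>None\<close> behaves
  like an additional prime above all others whose completion is \<open>R\<close> itself, which makes
  \<open>R\<^sub>a\<^sub>d(\<emptyset>) = R\<close> the case of the empty list.\<close>

definition primes_below :: "('a, 'b) ring_scheme \<Rightarrow> 'a set option \<Rightarrow> nat \<Rightarrow> 'a set set"
  where "primes_below R u d =
    {q. primeideal q R \<and> prime_dim R q = d \<and> (case u of None \<Rightarrow> True | Some p \<Rightarrow> p \<subset> q)}"

fun nested :: "('a, 'b) ring_scheme \<Rightarrow> 'a set option \<Rightarrow> nat list \<Rightarrow> ('a, 'a adele) module"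
  where
    "nested R None [] = image_algebra Scalar (self_algebra R)"
  | "nested R (Some p) [] = image_algebra Completed (adic_completion R p)"
  | "nested R u (d # ds) = image_algebra Family
      (product_algebra (primes_below R u d) (\<lambda>p. localize R p (nested R (Some p) ds)))"

fun coefficient_map :: "('a, 'b) ring_scheme \<Rightarrow> 'a set option \<Rightarrow> 'a set \<Rightarrow> 'a adele \<Rightarrow> 'a adele"
  where
    "coefficient_map R None q x = Completed (\<lambda>n. ideal_power R q n +>\<^bsub>R\<^esub> scalar x)"
  | "coefficient_map R (Some p) q x = Completed (\<lambda>n. ideal_power R q n <+>\<^bsub>R\<^esub> completed x n)"

fun insert_desc :: "nat \<Rightarrow> nat list \<Rightarrow> nat list"
  where
    "insert_desc e [] = [e]"
  | "insert_desc e (d # ds) = (if e > d then e # d # ds else d # insert_desc e ds)"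

text \<open>The map \<open>nested R u ds \<rightarrow> nested R u (insert_desc e ds)\<close> inserting a dimension \<open>e\<close> that
  does not occur in \<open>ds\<close>.\<close>

fun insertion_map ::
  "('a, 'b) ring_scheme \<Rightarrow> 'a set option \<Rightarrow> nat list \<Rightarrow> nat \<Rightarrow> 'a adele \<Rightarrow> 'a adele"
  where
    "insertion_map R u [] e x = Family (\<lambda>q\<in>primes_below R u e.
      to_localize R q (nested R (Some q) []) (coefficient_map R u q x))"
  | "insertion_map R u (d # ds) e x =
      (if e > d
       then Family (\<lambda>p\<in>primes_below R u e.
         to_localize R p (nested R (Some p) (d # ds))
           (Family (restrict (family x) (primes_below R (Some p) d))))
       else Family (\<lambda>q\<in>primes_below R u d.
         localize_map R q (nested R (Some q) (insert_desc e ds))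
           (insertion_map R (Some q) ds e) (family x q)))"

fun insertions_map :: "('a, 'b) ring_scheme \<Rightarrow> nat list \<Rightarrow> nat list \<Rightarrow> 'a adele \<Rightarrow> 'a adele"
  where
    "insertions_map R ds [] x = x"
  | "insertions_map R ds (e # es) x =
      insertions_map R (insert_desc e ds) es (insertion_map R None ds e x)"

definition descending :: "nat set \<Rightarrow> nat list"
  where "descending D = rev (sorted_list_of_set D)"

definition adelic_cube :: "('a, 'b) ring_scheme \<Rightarrow> nat set \<Rightarrow> ('a, 'a adele) module"
  where "adelic_cube R D = nested R None (descending D)"

definition adelic_cube_map ::
  "('a, 'b) ring_scheme \<Rightarrow> nat set \<Rightarrow> nat set \<Rightarrow> 'a adele \<Rightarrow> 'a adele"
  where "adelic_cube_map R D D' =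
    insertions_map R (descending D) (sorted_list_of_set (D' - D))"

end

theory Submission
  imports Defs
begin

text \<open>
  Everything is done with elements: a statement about the complex tensored with \<open>R / I\<close> is read as a
  statement about the complex itself modulo multiples by \<open>I\<close>. The rings of the cube are flat over \<open>R\<close>
  in the form \<open>(I M : r) = (I : r) M\<close>; for the completions this is the Artin--Rees lemma. Hence
  acyclicity of the augmented complex modulo \<open>I\<close> follows from acyclicity modulo \<open>(I : r)\<close> and
  \<open>I + (r)\<close>, and Noetherian induction on \<open>I\<close> leaves the case of a prime \<open>p\<close>, where elements outside
  \<open>p\<close> act bijectively on cohomology, so that one may also localize at \<open>p\<close>. Modulo \<open>p\<close> and localized
  at \<open>p\<close>, inserting the dimension of \<open>p\<close> is bijective at every vertex of the cube: factors at primes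
  not containing \<open>p\<close> vanish, and \<open>R / p\<close> is already \<open>p\<close>-complete. A cube that is constant in one
  direction has an acyclic complex.
\<close>

text \<open>Localization does not commute with infinite products, so the cube reduced at a prime
  cannot be computed factor by factor without care. Two finiteness facts make the element language
  work. Ideals are finitely generated, so multiples by I can be computed coordinatewise in an
  infinite product. The cube has finitely many chains of vertices, so finitely many denominators can
  be cleared by one element outside p. The colon form of flatness says precisely that 0 -> R/(I : r)
  -> R/I -> R/(I + (r)) -> 0 stays exact after tensoring, and this is the exact sequence on which
  the induction runs. The direction in which the cube becomes constant depends on p, so there is no
  global contraction. It is the dimension of p: by catenarity the dimension drops strictly along
  strict inclusions, which leaves p as the one prime of that dimension containing p. Before
  localization the comparison maps need not be invertible, so the contracting homotopy solves its
  equations up to a factor outside p and modulo p.\<close>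

no_notation Sum_Type.Plus (infixr \<open><+>\<close> 65)

section \<open>Module homomorphisms and multiples of a module by an ideal\<close>

lemma (in abelian_group) finsum_in_subgroup:
  assumes "additive_subgroup H G" and "\<And>i. i \<in> A \<Longrightarrow> f i \<in> H"
  shows "finsum G f A \<in> H"
proof -
  interpret H: additive_subgroup H G by fact
  show ?thesis
    using assms(2)
  proof (induct A rule: infinite_finite_induct)
    case (insert a A)
    then have "f \<in> A \<rightarrow> carrier G" "f a \<in> carrier G"
      using H.a_subset by auto
    then have "finsum G f (insert a A) = f a \<oplus> finsum G f A"
      using insert(1,2) by (simp add: finsum_insert)
    then show ?case
      using insert by simp
  qed (simp_all add: finsum_infinite)
qed

lemma (in module) submodule_additive_subgroup:
  "submodule H R M \<Longrightarrow> additive_subgroup H M"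
  by (simp add: additive_subgroup_def submodule.axioms(1))

lemma (in module) submodule_facts:
  assumes "submodule H R M"
  shows "H \<subseteq> carrier M" "\<zero>\<^bsub>M\<^esub> \<in> H"
    and "\<And>x y. x \<in> H \<Longrightarrow> y \<in> H \<Longrightarrow> x \<oplus>\<^bsub>M\<^esub> y \<in> H"
    and "\<And>x. x \<in> H \<Longrightarrow> \<ominus>\<^bsub>M\<^esub> x \<in> H"
    and "\<And>x y. x \<in> H \<Longrightarrow> y \<in> H \<Longrightarrow> x \<ominus>\<^bsub>M\<^esub> y \<in> H"
    and "\<And>a x. a \<in> carrier R \<Longrightarrow> x \<in> H \<Longrightarrow> a \<odot>\<^bsub>M\<^esub> x \<in> H"
    and "\<And>f A. (\<And>i. i \<in> A \<Longrightarrow> f i \<in> H) \<Longrightarrow> finsum M f A \<in> H"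
proof -
  interpret H: additive_subgroup H M
    using assms by (rule submodule_additive_subgroup)
  note E = submoduleE[OF assms]
  show "H \<subseteq> carrier M" "\<zero>\<^bsub>M\<^esub> \<in> H" using E(1) by simp_all
  show "\<And>x y. x \<in> H \<Longrightarrow> y \<in> H \<Longrightarrow> x \<oplus>\<^bsub>M\<^esub> y \<in> H" by simp
  show "\<And>x. x \<in> H \<Longrightarrow> \<ominus>\<^bsub>M\<^esub> x \<in> H" by (rule E(3))
  show "\<And>x y. x \<in> H \<Longrightarrow> y \<in> H \<Longrightarrow> x \<ominus>\<^bsub>M\<^esub> y \<in> H"
    unfolding a_minus_def by (intro E(5) E(3))
  show "\<And>a x. a \<in> carrier R \<Longrightarrow> x \<in> H \<Longrightarrow> a \<odot>\<^bsub>M\<^esub> x \<in> H" by (rule E(4))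
  show "\<And>f A. (\<And>i. i \<in> A \<Longrightarrow> f i \<in> H) \<Longrightarrow> finsum M f A \<in> H"
    by (rule finsum_in_subgroup[OF H.is_additive_subgroup])
qed

lemma module_hom_closed: "f \<in> module_hom R M N \<Longrightarrow> x \<in> carrier M \<Longrightarrow> f x \<in> carrier N"
  and module_hom_add: "f \<in> module_hom R M N \<Longrightarrow> x \<in> carrier M \<Longrightarrow> y \<in> carrier M \<Longrightarrow>
    f (x \<oplus>\<^bsub>M\<^esub> y) = f x \<oplus>\<^bsub>N\<^esub> f y"
  and module_hom_smult: "f \<in> module_hom R M N \<Longrightarrow> a \<in> carrier R \<Longrightarrow> x \<in> carrier M \<Longrightarrow>
    f (a \<odot>\<^bsub>M\<^esub> x) = a \<odot>\<^bsub>N\<^esub> f x"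
  by (auto simp: module_hom_def)

lemma module_homI:
  assumes "\<And>x. x \<in> carrier M \<Longrightarrow> f x \<in> carrier N"
    and "\<And>x y. x \<in> carrier M \<Longrightarrow> y \<in> carrier M \<Longrightarrow> f (x \<oplus>\<^bsub>M\<^esub> y) = f x \<oplus>\<^bsub>N\<^esub> f y"
    and "\<And>a x. a \<in> carrier R \<Longrightarrow> x \<in> carrier M \<Longrightarrow> f (a \<odot>\<^bsub>M\<^esub> x) = a \<odot>\<^bsub>N\<^esub> f x"
  shows "f \<in> module_hom R M N"
  using assms by (auto simp: module_hom_def)

lemma module_hom_zero:
  assumes "module R M" "module R N" "f \<in> module_hom R M N"
  shows "f \<zero>\<^bsub>M\<^esub> = \<zero>\<^bsub>N\<^esub>"
proof -
  interpret M: module R M by fact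
  interpret N: module R N by fact
  have "f \<zero>\<^bsub>M\<^esub> = f (\<zero>\<^bsub>R\<^esub> \<odot>\<^bsub>M\<^esub> \<zero>\<^bsub>M\<^esub>)"
    by simp
  also have "\<dots> = \<zero>\<^bsub>N\<^esub>"
    using module_hom_smult[OF assms(3), of "\<zero>\<^bsub>R\<^esub>" "\<zero>\<^bsub>M\<^esub>"] module_hom_closed[OF assms(3)] by simp
  finally show ?thesis .
qed

lemma module_hom_neg:
  assumes "module R M" "module R N" "f \<in> module_hom R M N" "x \<in> carrier M"
  shows "f (\<ominus>\<^bsub>M\<^esub> x) = \<ominus>\<^bsub>N\<^esub> f x"
proof -
  interpret M: module R M by fact
  interpret N: module R N by fact
  have "f (\<ominus>\<^bsub>M\<^esub> x) \<oplus>\<^bsub>N\<^esub> f x = f (\<ominus>\<^bsub>M\<^esub> x \<oplus>\<^bsub>M\<^esub> x)"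
    using assms by (simp add: module_hom_add)
  also have "\<dots> = \<zero>\<^bsub>N\<^esub>"
    using assms by (simp add: M.M.l_neg module_hom_zero)
  finally show ?thesis
    using assms by (simp add: N.M.minus_equality module_hom_closed)
qed

lemma module_hom_minus:
  assumes "module R M" "module R N" "f \<in> module_hom R M N" "x \<in> carrier M" "y \<in> carrier M"
  shows "f (x \<ominus>\<^bsub>M\<^esub> y) = f x \<ominus>\<^bsub>N\<^esub> f y"
proof -
  interpret M: module R M by fact
  show ?thesis
    using assms by (simp add: a_minus_def module_hom_add module_hom_neg)
qed

lemma module_hom_finsum:
  assumes "module R M" "module R N" "f \<in> module_hom R M N" "\<And>i. i \<in> A \<Longrightarrow> g i \<in> carrier M"
  shows "f (finsum M g A) = finsum N (\<lambda>i. f (g i)) A"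
proof -
  interpret M: module R M by fact
  interpret N: module R N by fact
  show ?thesis
    using assms(4)
  proof (induct A rule: infinite_finite_induct)
    case (insert a A)
    then have "finsum M g (insert a A) = g a \<oplus>\<^bsub>M\<^esub> finsum M g A"
      by (intro M.M.finsum_insert) auto
    moreover have "finsum N (\<lambda>i. f (g i)) (insert a A) = f (g a) \<oplus>\<^bsub>N\<^esub> finsum N (\<lambda>i. f (g i)) A"
      using insert assms(3) by (intro N.M.finsum_insert) (auto simp: module_hom_closed)
    moreover have "finsum M g A \<in> carrier M"
      using insert by (intro M.M.finsum_closed) auto
    ultimately show ?case
      using insert assms(3) by (simp add: module_hom_add)
  qed (use module_hom_zero[OF assms(1-3)] in \<open>simp_all add: M.M.finsum_infinite N.M.finsum_infinite\<close>)
qed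

lemma module_hom_comp:
  assumes "f \<in> module_hom R L M" "g \<in> module_hom R M N"
  shows "(\<lambda>x. g (f x)) \<in> module_hom R L N"
  using assms by (auto simp: module_hom_def Pi_iff)

text \<open>The submodule I M. Membership in it replaces vanishing in M / I M, so quotient modules
  need not be formed. Adding one multiple at a time gives an induction rule whose step involves a
  single product.\<close>

inductive_set ideal_span ::
  "('r, 's) ring_scheme \<Rightarrow> 'r set \<Rightarrow> ('r, 'x, 'm) module_scheme \<Rightarrow> 'x set"
  for R and I and M where
    zero: "\<zero>\<^bsub>M\<^esub> \<in> ideal_span R I M"
  | add_smult: "a \<in> I \<Longrightarrow> m \<in> carrier M \<Longrightarrow> x \<in> ideal_span R I M \<Longrightarrow>
      (a \<odot>\<^bsub>M\<^esub> m) \<oplus>\<^bsub>M\<^esub> x \<in> ideal_span R I M"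

context module
begin

lemma ideal_span_closed:
  assumes "I \<subseteq> carrier R" "x \<in> ideal_span R I M"
  shows "x \<in> carrier M"
  using assms(2,1) by (induct rule: ideal_span.induct) auto

lemma smult_in_ideal_span:
  assumes "I \<subseteq> carrier R" "a \<in> I" "m \<in> carrier M"
  shows "a \<odot>\<^bsub>M\<^esub> m \<in> ideal_span R I M"
  using ideal_span.add_smult[OF assms(2,3) ideal_span.zero] assms by (simp add: subset_iff)

lemma ideal_span_add:
  assumes "I \<subseteq> carrier R" "x \<in> ideal_span R I M" "y \<in> ideal_span R I M"
  shows "x \<oplus>\<^bsub>M\<^esub> y \<in> ideal_span R I M"
  using assms(2)
proof (induct rule: ideal_span.induct)
  case zero
  then show ?case using assms ideal_span_closed by simp
next
  case (add_smult a m x)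
  then have "(a \<odot>\<^bsub>M\<^esub> m \<oplus>\<^bsub>M\<^esub> x) \<oplus>\<^bsub>M\<^esub> y = a \<odot>\<^bsub>M\<^esub> m \<oplus>\<^bsub>M\<^esub> (x \<oplus>\<^bsub>M\<^esub> y)"
    using assms ideal_span_closed by (intro M.a_assoc) auto
  then show ?case
    using add_smult by (simp add: ideal_span.add_smult)
qed

lemma ideal_span_submodule:
  assumes "ideal I R"
  shows "submodule (ideal_span R I M) R M"
proof -
  interpret I: ideal I R by fact
  note sub = I.a_subset
  have smult: "a \<odot>\<^bsub>M\<^esub> x \<in> ideal_span R I M" if "a \<in> carrier R" "x \<in> ideal_span R I M" for a x
    using that(2)
  proof (induct rule: ideal_span.induct)
    case zero
    then show ?case using that by (simp add: ideal_span.zero)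
  next
    case (add_smult b m x)
    then have "a \<odot>\<^bsub>M\<^esub> (b \<odot>\<^bsub>M\<^esub> m \<oplus>\<^bsub>M\<^esub> x) = ((a \<otimes> b) \<odot>\<^bsub>M\<^esub> m) \<oplus>\<^bsub>M\<^esub> a \<odot>\<^bsub>M\<^esub> x"
      using that sub ideal_span_closed[OF sub, of x] by (simp add: smult_r_distr smult_assoc1 subset_iff)
    then show ?case
      using add_smult that by (simp add: ideal_span.add_smult I.I_l_closed)
  qed
  have neg: "\<ominus>\<^bsub>M\<^esub> x \<in> ideal_span R I M" if "x \<in> ideal_span R I M" for x
  proof -
    have "\<ominus>\<^bsub>M\<^esub> x = (\<ominus> \<one>) \<odot>\<^bsub>M\<^esub> x"
      using that sub ideal_span_closed by (simp add: smult_l_minus)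
    then show ?thesis using smult[OF _ that, of "\<ominus> \<one>"] by simp
  qed
  show ?thesis
    using sub by (intro submoduleI)
      (auto simp: ideal_span_closed ideal_span_add ideal_span.zero neg smult)
qed

lemmas ideal_span_facts = submodule_facts[OF ideal_span_submodule]

lemma ideal_span_mono: "I \<subseteq> J \<Longrightarrow> ideal_span R I M \<subseteq> ideal_span R J M"
proof
  fix x assume "I \<subseteq> J" "x \<in> ideal_span R I M"
  from this(2,1) show "x \<in> ideal_span R J M"
    by (induct rule: ideal_span.induct) (auto intro: ideal_span.intros)
qed

lemma ideal_span_zero_ideal: "x \<in> ideal_span R {\<zero>} M \<Longrightarrow> x = \<zero>\<^bsub>M\<^esub>"
  by (induct rule: ideal_span.induct) auto

lemma ideal_span_subset_submodule:
  assumes "submodule H R M" "\<And>a m. a \<in> I \<Longrightarrow> m \<in> carrier M \<Longrightarrow> a \<odot>\<^bsub>M\<^esub> m \<in> H"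
  shows "ideal_span R I M \<subseteq> H"
proof
  fix x assume "x \<in> ideal_span R I M"
  then show "x \<in> H"
    by (induct rule: ideal_span.induct) (auto intro: submodule_facts[OF assms(1)] assms(2))
qed

text \<open>A finite generating set serves as one index set for all elements of I M: the sums over
  \<open>A\<close> form a submodule \<open>S\<close>, so multiplication by generators is all that
  has to be checked. This uniformity is what survives the passage to infinite products and to
  limits.\<close>

lemma ideal_span_Idl:
  assumes A: "finite A" "A \<subseteq> carrier R" and x: "x \<in> ideal_span R (Idl A) M"
  obtains g where "g \<in> A \<rightarrow> carrier M" "x = (\<Oplus>\<^bsub>M\<^esub>a\<in>A. a \<odot>\<^bsub>M\<^esub> g a)"
proof -
  define S where "S = {x. \<exists>g\<in>A \<rightarrow> carrier M. x = (\<Oplus>\<^bsub>M\<^esub>a\<in>A. a \<odot>\<^bsub>M\<^esub> g a)}"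
  have Ac: "a \<in> carrier R" if "a \<in> A" for a using A that by auto
  have S_add: "x \<oplus>\<^bsub>M\<^esub> y \<in> S" if xy: "x \<in> S" "y \<in> S" for x y
  proof -
    from xy obtain g h where g: "g \<in> A \<rightarrow> carrier M" "x = (\<Oplus>\<^bsub>M\<^esub>a\<in>A. a \<odot>\<^bsub>M\<^esub> g a)"
      and h: "h \<in> A \<rightarrow> carrier M" "y = (\<Oplus>\<^bsub>M\<^esub>a\<in>A. a \<odot>\<^bsub>M\<^esub> h a)"
      unfolding S_def by blast
    have "x \<oplus>\<^bsub>M\<^esub> y = (\<Oplus>\<^bsub>M\<^esub>a\<in>A. a \<odot>\<^bsub>M\<^esub> g a \<oplus>\<^bsub>M\<^esub> a \<odot>\<^bsub>M\<^esub> h a)"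
      unfolding g(2) h(2) using g(1) h(1) Ac by (intro M.finsum_addf[symmetric]) auto
    also have "\<dots> = (\<Oplus>\<^bsub>M\<^esub>a\<in>A. a \<odot>\<^bsub>M\<^esub> (g a \<oplus>\<^bsub>M\<^esub> h a))"
      using g(1) h(1) Ac by (intro M.finsum_cong') (auto simp: smult_r_distr Pi_iff)
    finally show ?thesis
      unfolding S_def using g(1) h(1) by (auto intro!: bexI[of _ "\<lambda>a. g a \<oplus>\<^bsub>M\<^esub> h a"])
  qed
  have S_smult: "r \<odot>\<^bsub>M\<^esub> x \<in> S" if r: "r \<in> carrier R" and x: "x \<in> S" for r x
  proof -
    from x obtain g where g: "g \<in> A \<rightarrow> carrier M" "x = (\<Oplus>\<^bsub>M\<^esub>a\<in>A. a \<odot>\<^bsub>M\<^esub> g a)"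
      unfolding S_def by blast
    have "r \<odot>\<^bsub>M\<^esub> x = (\<Oplus>\<^bsub>M\<^esub>a\<in>A. r \<odot>\<^bsub>M\<^esub> (a \<odot>\<^bsub>M\<^esub> g a))"
      unfolding g(2) using A r g(1) Ac by (intro finsum_smult_ldistr) auto
    also have "\<dots> = (\<Oplus>\<^bsub>M\<^esub>a\<in>A. a \<odot>\<^bsub>M\<^esub> (r \<odot>\<^bsub>M\<^esub> g a))"
      using g(1) Ac r
      by (intro M.finsum_cong') (auto simp: smult_assoc1[symmetric] R.m_comm Pi_iff)
    finally show ?thesis
      unfolding S_def using g(1) r by (auto intro!: bexI[of _ "\<lambda>a. r \<odot>\<^bsub>M\<^esub> g a"])
  qed
  have S_zero: "\<zero>\<^bsub>M\<^esub> \<in> S"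
  proof -
    have "(\<Oplus>\<^bsub>M\<^esub>a\<in>A. a \<odot>\<^bsub>M\<^esub> \<zero>\<^bsub>M\<^esub>) = \<zero>\<^bsub>M\<^esub>"
      using Ac by (intro M.add.finprod_one_eqI) auto
    then show ?thesis unfolding S_def by (auto intro!: bexI[of _ "\<lambda>a. \<zero>\<^bsub>M\<^esub>"])
  qed
  have S_carrier: "S \<subseteq> carrier M"
    unfolding S_def using Ac by (auto intro!: M.finsum_closed)
  have S_neg: "\<ominus>\<^bsub>M\<^esub> x \<in> S" if "x \<in> S" for x
  proof -
    have "\<ominus>\<^bsub>M\<^esub> x = (\<ominus> \<one>) \<odot>\<^bsub>M\<^esub> x"
      using that S_carrier by (auto simp: smult_l_minus subset_iff)
    then show ?thesis using S_smult[OF _ that, of "\<ominus> \<one>"] by simp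
  qed
  have sub: "submodule S R M"
    by (intro submoduleI S_carrier S_zero S_neg S_add S_smult)
  \<comment> \<open>The scalars carrying M into \<open>S\<close> form an ideal, so it contains
    \<open>Idl A\<close> as soon as it contains \<open>A\<close>.\<close>
  define Q where "Q = {r \<in> carrier R. \<forall>m\<in>carrier M. r \<odot>\<^bsub>M\<^esub> m \<in> S}"
  have "ideal Q R"
  proof (rule idealI)
    show "ring R" by (rule R.ring_axioms)
    show "subgroup Q (add_monoid R)"
    proof (rule R.add.subgroupI)
      show "Q \<subseteq> carrier R" by (auto simp: Q_def)
      have "\<zero> \<in> Q" using S_zero by (auto simp: Q_def)
      then show "Q \<noteq> {}" by auto
      fix a assume a: "a \<in> Q"
      then show "\<ominus> a \<in> Q"
        using S_neg by (auto simp: Q_def smult_l_minus)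
      fix b assume "b \<in> Q"
      with a show "a \<oplus> b \<in> Q"
        using S_add by (auto simp: Q_def smult_l_distr)
    qed
    fix a x assume "a \<in> Q" "x \<in> carrier R"
    then show "x \<otimes> a \<in> Q"
      using S_smult by (auto simp: Q_def smult_assoc1)
    with \<open>a \<in> Q\<close> \<open>x \<in> carrier R\<close> show "a \<otimes> x \<in> Q"
      by (auto simp: Q_def R.m_comm)
  qed
  moreover have "A \<subseteq> Q"
  proof
    fix a assume a: "a \<in> A"
    have "a \<odot>\<^bsub>M\<^esub> m \<in> S" if m: "m \<in> carrier M" for m
    proof -
      let ?g = "\<lambda>b. if b = a then m else \<zero>\<^bsub>M\<^esub>"
      have "(\<Oplus>\<^bsub>M\<^esub>b\<in>A. b \<odot>\<^bsub>M\<^esub> ?g b) = (\<Oplus>\<^bsub>M\<^esub>b\<in>A. if a = b then b \<odot>\<^bsub>M\<^esub> m else \<zero>\<^bsub>M\<^esub>)"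
        using Ac m by (intro M.finsum_cong') auto
      also have "\<dots> = a \<odot>\<^bsub>M\<^esub> m"
        using a A Ac m by (intro M.finsum_singleton) auto
      finally have "a \<odot>\<^bsub>M\<^esub> m = (\<Oplus>\<^bsub>M\<^esub>b\<in>A. b \<odot>\<^bsub>M\<^esub> ?g b)" by (rule sym)
      then show ?thesis
        unfolding S_def using m by (intro CollectI bexI[of _ ?g]) auto
    qed
    then show "a \<in> Q" using Ac a by (auto simp: Q_def)
  qed
  ultimately have "Idl A \<subseteq> Q"
    by (rule R.genideal_minimal)
  then have "ideal_span R (Idl A) M \<subseteq> S"
    by (intro ideal_span_subset_submodule[OF sub]) (auto simp: Q_def)
  then show ?thesis
    using x that unfolding S_def by blast
qed

text \<open>Together with the principal case below, it turns a congruence modulo I + (r) into an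
  equation with an explicit remainder r m, the form in which the chases on cochains use it.\<close>

lemma ideal_span_add_ideals:
  assumes "ideal I R" "ideal J R" "x \<in> ideal_span R (I <+> J) M"
  obtains y z where "y \<in> ideal_span R I M" "z \<in> ideal_span R J M" "x = y \<oplus>\<^bsub>M\<^esub> z"
proof -
  interpret I: ideal I R by fact
  interpret J: ideal J R by fact
  have "\<exists>y\<in>ideal_span R I M. \<exists>z\<in>ideal_span R J M. x = y \<oplus>\<^bsub>M\<^esub> z"
    using assms(3)
  proof (induct rule: ideal_span.induct)
    case zero
    show ?case
      by (rule bexI[of _ "\<zero>\<^bsub>M\<^esub>"], rule bexI[of _ "\<zero>\<^bsub>M\<^esub>"]) (auto intro: ideal_span.zero)
  next
    case (add_smult c m x)
    then obtain y z where yz: "y \<in> ideal_span R I M" "z \<in> ideal_span R J M" "x = y \<oplus>\<^bsub>M\<^esub> z"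
      by auto
    from \<open>c \<in> I <+> J\<close> obtain a b where ab: "a \<in> I" "b \<in> J" "c = a \<oplus> b"
      unfolding set_add_def' by auto
    note yz_c = ideal_span_closed[OF I.a_subset yz(1)] ideal_span_closed[OF J.a_subset yz(2)]
    have "c \<odot>\<^bsub>M\<^esub> m \<oplus>\<^bsub>M\<^esub> x = (a \<odot>\<^bsub>M\<^esub> m \<oplus>\<^bsub>M\<^esub> y) \<oplus>\<^bsub>M\<^esub> (b \<odot>\<^bsub>M\<^esub> m \<oplus>\<^bsub>M\<^esub> z)"
      using ab yz yz_c add_smult(2) by (simp add: smult_l_distr M.a_ac)
    then show ?case
      using ab yz add_smult(2)
      by (intro bexI[of _ "a \<odot>\<^bsub>M\<^esub> m \<oplus>\<^bsub>M\<^esub> y"] bexI[of _ "b \<odot>\<^bsub>M\<^esub> m \<oplus>\<^bsub>M\<^esub> z"])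
        (auto intro: ideal_span.add_smult)
  qed
  then show ?thesis using that by blast
qed

lemma ideal_span_PIdl:
  assumes "r \<in> carrier R" "x \<in> ideal_span R (PIdl r) M"
  obtains m where "m \<in> carrier M" "x = r \<odot>\<^bsub>M\<^esub> m"
proof -
  have "\<exists>m\<in>carrier M. x = r \<odot>\<^bsub>M\<^esub> m"
    using assms(2)
  proof (induct rule: ideal_span.induct)
    case zero
    then show ?case using assms(1) by (auto intro!: bexI[of _ "\<zero>\<^bsub>M\<^esub>"])
  next
    case (add_smult a m x)
    then obtain n where n: "n \<in> carrier M" "x = r \<odot>\<^bsub>M\<^esub> n" by auto
    from add_smult(1) obtain b where b: "b \<in> carrier R" "a = b \<otimes> r"
      unfolding cgenideal_def by auto
    have "a \<odot>\<^bsub>M\<^esub> m \<oplus>\<^bsub>M\<^esub> x = r \<odot>\<^bsub>M\<^esub> (b \<odot>\<^bsub>M\<^esub> m \<oplus>\<^bsub>M\<^esub> n)"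
      using n b add_smult(2) assms(1) by (simp add: smult_r_distr smult_assoc1 R.m_comm[of b r])
    then show ?case
      using n b add_smult(2) by auto
  qed
  then show ?thesis using that by blast
qed

end

lemma ideal_span_hom:
  assumes "f \<in> module_hom R M N" "module R M" "module R N" "I \<subseteq> carrier R" "x \<in> ideal_span R I M"
  shows "f x \<in> ideal_span R I N"
  using assms(5)
proof (induct rule: ideal_span.induct)
  case zero
  then show ?case
    using assms by (simp add: module_hom_zero ideal_span.zero)
next
  case (add_smult a m x)
  interpret M: module R M by fact
  have "f (a \<odot>\<^bsub>M\<^esub> m \<oplus>\<^bsub>M\<^esub> x) = a \<odot>\<^bsub>N\<^esub> f m \<oplus>\<^bsub>N\<^esub> f x"
    using add_smult assms(1,4) M.ideal_span_closed[OF assms(4)]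
    by (simp add: module_hom_add module_hom_smult subset_iff)
  then show ?case
    using add_smult assms(1) by (simp add: ideal_span.add_smult module_hom_closed)
qed


section \<open>Colon ideals and the Artin--Rees lemma\<close>

definition colon :: "('a, 'b) ring_scheme \<Rightarrow> 'a set \<Rightarrow> 'a \<Rightarrow> 'a set"
  where "colon R I x = {a \<in> carrier R. x \<otimes>\<^bsub>R\<^esub> a \<in> I}"

lemma (in cring) colon_ideal:
  assumes "ideal I R" "x \<in> carrier R"
  shows "ideal (colon R I x) R"
proof (rule idealI)
  interpret I: ideal I R by fact
  show "ring R" by (rule ring_axioms)
  show "subgroup (colon R I x) (add_monoid R)"
  proof (rule add.subgroupI)
    show "colon R I x \<subseteq> carrier R" by (auto simp: colon_def)
    have "\<zero> \<in> colon R I x" using assms(2) by (simp add: colon_def)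
    then show "colon R I x \<noteq> {}" by auto
  qed (auto simp: colon_def r_minus r_distr assms(2))
  fix a y assume a: "a \<in> colon R I x" "y \<in> carrier R"
  have "x \<otimes> (y \<otimes> a) = y \<otimes> (x \<otimes> a)"
    using a assms(2) by (simp add: colon_def m_lcomm)
  then show "y \<otimes> a \<in> colon R I x"
    using a by (simp add: colon_def I.I_l_closed)
  then show "a \<otimes> y \<in> colon R I x"
    using a by (simp add: colon_def m_comm)
qed

lemma (in cring) subset_colon:
  assumes "ideal I R" "x \<in> carrier R"
  shows "I \<subseteq> colon R I x"
  using ideal.I_l_closed[OF assms(1)] ideal.Icarr[OF assms(1)] assms(2) by (auto simp: colon_def)

text \<open>This inclusion holds for every module; the converse is flatness. It lets a correction
  known modulo (I : r) disappear modulo I once it is multiplied by r.\<close>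

lemma (in module) smult_ideal_span_colon:
  assumes "ideal I R" "r \<in> carrier R" "m \<in> ideal_span R (colon R I r) M"
  shows "r \<odot>\<^bsub>M\<^esub> m \<in> ideal_span R I M"
  using assms(3)
proof (induct rule: ideal_span.induct)
  case zero
  then show ?case using assms by (simp add: ideal_span.zero)
next
  case (add_smult a m x)
  have "x \<in> carrier M"
    using add_smult by (intro ideal_span_closed[of "colon R I r"]) (auto simp: colon_def)
  then have "r \<odot>\<^bsub>M\<^esub> (a \<odot>\<^bsub>M\<^esub> m \<oplus>\<^bsub>M\<^esub> x) = ((r \<otimes> a) \<odot>\<^bsub>M\<^esub> m) \<oplus>\<^bsub>M\<^esub> r \<odot>\<^bsub>M\<^esub> x"
    using add_smult assms(2) by (simp add: smult_r_distr smult_assoc1 colon_def)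
  then show ?case
    using add_smult by (simp add: ideal_span.add_smult colon_def)
qed

section \<open>Noetherian induction on ideals\<close>

locale noetherian_cring = cring R + noetherian_ring R for R (structure)

context noetherian_cring
begin

text \<open>Over a Noetherian ring the union of a chain of ideals is a member of the chain, and for
  a strictly ascending sequence the next term contradicts this. The induction thus descends from
  larger ideals to smaller ones.\<close>

lemma noetherian_induct [consumes 1, case_names larger]:
  assumes "ideal I R"
    and step: "\<And>I. ideal I R \<Longrightarrow> (\<And>J. ideal J R \<Longrightarrow> I \<subset> J \<Longrightarrow> P J) \<Longrightarrow> P I"
  shows "P I"
proof -
  have "wf {(J, I). ideal I R \<and> ideal J R \<and> I \<subset> J}"
    unfolding wf_iff_no_infinite_down_chain
  proof (rule notI, elim exE)
    fix f assume f: "\<forall>i. (f (Suc i), f i) \<in> {(J, I). ideal I R \<and> ideal J R \<and> I \<subset> J}"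
    then have less: "f i \<subset> f (Suc i)" and id: "ideal (f i) R" for i by auto
    have mono: "f i \<subseteq> f j" if "i \<le> j" for i j
      using that by (induct rule: dec_induct) (use less in blast)+
    then have "subset.chain {I. ideal I R} (range f)"
      using id mono nat_le_linear unfolding pred_on.chain_def psubset_eq by blast
    then have "\<Union>(range f) \<in> range f"
      by (intro ideal_chain_is_trivial) auto
    then obtain n where "\<Union>(range f) = f n" by auto
    then show False using less[of n] by blast
  qed
  then show ?thesis
    using assms(1)
  proof (induct I rule: wf_induct_rule)
    case (less I)
    show ?case by (rule step[OF less(2)]) (use less in auto)
  qed
qed

lemma exists_maximal_ideal_with:
  assumes "ideal I R" "Q I"
  shows "\<exists>K. ideal K R \<and> I \<subseteq> K \<and> Q K \<and> (\<forall>J. ideal J R \<longrightarrow> K \<subset> J \<longrightarrow> \<not> Q J)"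
  using assms
proof (induct rule: noetherian_induct)
  case (larger I)
  show ?case
  proof (cases "\<exists>J. ideal J R \<and> I \<subset> J \<and> Q J")
    case True
    then obtain J where J: "ideal J R" "I \<subset> J" "Q J" by blast
    from larger(2)[OF this] obtain K where "ideal K R" "J \<subseteq> K" "Q K"
        "\<forall>J. ideal J R \<longrightarrow> K \<subset> J \<longrightarrow> \<not> Q J" by blast
    then show ?thesis using J(2) by (intro exI[of _ K]) auto
  qed (use larger(1,3) in blast)
qed

end

section \<open>Powers, products and sums of ideals\<close>

context cring
begin

lemma ideal_power_ideal: "ideal I R \<Longrightarrow> ideal (ideal_power R I n) R"
proof -
  interpret S: comm_monoid "ideals_set R" by (rule ideals_set_is_comm_monoid)
  assume "ideal I R"
  then show ?thesis using S.nat_pow_closed[of I n] by (simp add: ideals_set_def)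
qed

lemma ideal_power_0: "ideal_power R I 0 = carrier R"
  by (simp add: ideals_set_def)

lemma ideal_power_Suc: "ideal_power R I (Suc n) = ideal_prod R (ideal_power R I n) I"
  by (simp add: ideals_set_def)

lemma ideal_power_add:
  assumes "ideal I R"
  shows "ideal_power R I (m + n) = ideal_prod R (ideal_power R I m) (ideal_power R I n)"
proof -
  interpret S: comm_monoid "ideals_set R" by (rule ideals_set_is_comm_monoid)
  show ?thesis
    using S.nat_pow_mult[of I m n] assms by (simp add: ideals_set_def)
qed

lemma ideal_power_mult:
  assumes "ideal I R"
  shows "ideal_power R (ideal_power R I m) n = ideal_power R I (m * n)"
proof -
  interpret S: comm_monoid "ideals_set R" by (rule ideals_set_is_comm_monoid)
  show ?thesis
    using S.nat_pow_pow[of I m n] assms by (simp add: ideals_set_def)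
qed

lemma ideal_power_1: "ideal I R \<Longrightarrow> ideal_power R I 1 = I"
proof -
  interpret S: comm_monoid "ideals_set R" by (rule ideals_set_is_comm_monoid)
  assume "ideal I R"
  then show ?thesis using S.nat_pow_eone[of I] by (simp add: ideals_set_def)
qed

lemma ideal_power_antimono:
  assumes "ideal I R" "m \<le> n"
  shows "ideal_power R I n \<subseteq> ideal_power R I m"
proof -
  have "ideal_power R I n = ideal_prod R (ideal_power R I m) (ideal_power R I (n - m))"
    using ideal_power_add[OF assms(1), of m "n - m"] assms(2) by simp
  then show ?thesis
    using ideal_prod_inter[of "ideal_power R I m" "ideal_power R I (n - m)"] assms(1)
    by (auto simp: ideal_power_ideal simp del: nat_pow_def)
qed

lemma ideal_prod_mono: "I \<subseteq> I' \<Longrightarrow> J \<subseteq> J' \<Longrightarrow> ideal_prod R I J \<subseteq> ideal_prod R I' J'"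
proof
  fix x assume "I \<subseteq> I'" "J \<subseteq> J'" "x \<in> ideal_prod R I J"
  from this(3,1,2) show "x \<in> ideal_prod R I' J'"
    by (induct rule: ideal_prod.induct) (auto intro: ideal_prod.intros)
qed

lemma ideal_prod_subset:
  assumes "ideal K R" "\<And>i j. i \<in> I \<Longrightarrow> j \<in> J \<Longrightarrow> i \<otimes> j \<in> K"
  shows "ideal_prod R I J \<subseteq> K"
proof
  interpret K: ideal K R by fact
  fix x assume "x \<in> ideal_prod R I J"
  then show "x \<in> K"
    by (induct rule: ideal_prod.induct) (auto intro: assms(2))
qed

lemma ideal_power_mono:
  assumes "I \<subseteq> J"
  shows "ideal_power R I n \<subseteq> ideal_power R J n"
proof (induct n)
  case (Suc n)
  then show ?case using assms by (simp only: ideal_power_Suc ideal_prod_mono)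
qed (simp only: ideal_power_0 order_refl)

lemma ideal_add_PIdl_strict:
  assumes "ideal K R" "y \<in> carrier R" "y \<notin> K"
  shows "ideal (K <+> PIdl y) R" "K \<subset> K <+> PIdl y" "y \<in> K <+> PIdl y"
proof -
  interpret K: ideal K R by fact
  interpret P: ideal "PIdl y" R using assms(2) by (rule cgenideal_ideal)
  show "ideal (K <+> PIdl y) R"
    by (rule add_ideals[OF K.is_ideal P.is_ideal])
  show y: "y \<in> K <+> PIdl y"
    unfolding set_add_def' using assms(2) cgenideal_self[of y]
    by (intro UN_I[of \<zero>] UN_I[of y]) auto
  have "k \<in> K <+> PIdl y" if "k \<in> K" for k
    unfolding set_add_def' using that by (intro UN_I[of k] UN_I[of \<zero>]) (auto simp: K.Icarr)
  then show "K \<subset> K <+> PIdl y" using y assms(3) by blast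
qed

end

section \<open>Artin-Rees for intersections and for colon ideals\<close>

context noetherian_cring
begin

text \<open>Induction on K avoids generators of J: for y in J outside K, both (K : y) and K + (y)
  are strictly larger than K and so contain powers of J. The product of these powers lies in (K : y)
  (K + (y)), hence in K.\<close>

lemma ideal_power_subset_of_nilpotent:
  assumes "ideal K R" "ideal J R" and nil: "\<And>y. y \<in> J \<Longrightarrow> \<exists>k::nat. y [^] k \<in> K"
  shows "\<exists>n. ideal_power R J n \<subseteq> K"
  using assms(1) nil
proof (induct rule: noetherian_induct)
  case (larger K)
  interpret K: ideal K R by fact
  interpret J: ideal J R by fact
  have bigger: "\<exists>n. ideal_power R J n \<subseteq> L" if "ideal L R" "K \<subset> L" for L
    using larger(2)[OF that] larger(3) that by blast
  show ?case
  proof (cases "J \<subseteq> K")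
    case True
    then show ?thesis using ideal_power_1[OF assms(2)] by blast
  next
    case False
    then obtain y where y: "y \<in> J" "y \<notin> K" by blast
    then have yR: "y \<in> carrier R" by (simp add: J.Icarr)
    \<comment> \<open>Minimality puts y^(k-1) into (K : y) but not into K, so that (K : y) is
      strictly larger than K.\<close>
    define k where "k = (LEAST k::nat. y [^] k \<in> K)"
    have k: "y [^] k \<in> K"
      unfolding k_def using larger(3)[OF y(1)] by (rule LeastI_ex)
    have "k \<noteq> 0"
    proof
      assume "k = 0"
      then have "\<one> \<in> K" using k by simp
      then show False using y(2) yR K.one_imp_carrier by auto
    qed
    then obtain k' where k': "k = Suc k'" by (cases k) auto
    have "y [^] k' \<notin> K"
      using not_less_Least[of k' "\<lambda>k. y [^] k \<in> K"] k' unfolding k_def[symmetric] by simp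
    moreover have "y [^] k' \<in> colon R K y"
      using k k' yR by (simp add: colon_def m_comm)
    ultimately have "K \<subset> colon R K y"
      using subset_colon[OF larger(1) yR] by blast
    then obtain m where m: "ideal_power R J m \<subseteq> colon R K y"
      using bigger colon_ideal[OF larger(1) yR] by blast
    obtain n where n: "ideal_power R J n \<subseteq> K <+> PIdl y"
      using bigger ideal_add_PIdl_strict[OF larger(1) yR y(2)] by blast
    have "ideal_power R J (m + n) \<subseteq> K"
      unfolding ideal_power_add[OF assms(2)]
    proof (rule ideal_prod_subset[OF larger(1)])
      fix i j assume i: "i \<in> ideal_power R J m" and j: "j \<in> ideal_power R J n"
      have i': "i \<in> carrier R" "y \<otimes> i \<in> K" using i m by (auto simp: colon_def)
      from j n obtain a b where ab: "a \<in> K" "b \<in> carrier R" "j = a \<oplus> b \<otimes> y"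
        unfolding set_add_def' cgenideal_def by blast
      have "i \<otimes> j = i \<otimes> a \<oplus> b \<otimes> (y \<otimes> i)"
        using i' ab yR by (simp add: r_distr K.Icarr m_ac)
      then show "i \<otimes> j \<in> K"
        using i' ab by (simp add: K.I_l_closed)
    qed
    then show ?thesis by blast
  qed
qed

text \<open>This is Herstein's argument: \<open>K\<close> is maximal with \<open>K \<inter> N = B\<close>.\<close>

lemma artin_rees:
  assumes B: "ideal B R" "B \<subseteq> N" and N: "ideal N R" and J: "ideal J R"
    and JN: "\<And>y z. y \<in> J \<Longrightarrow> z \<in> N \<Longrightarrow> y \<otimes> z \<in> B"
  obtains K n where "ideal K R" "B \<subseteq> K" "K \<inter> N = B" "ideal_power R J n \<subseteq> K"
proof -
  obtain K where K: "ideal K R" "B \<subseteq> K" "K \<inter> N = B"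
    and max: "\<And>L. ideal L R \<Longrightarrow> K \<subset> L \<Longrightarrow> L \<inter> N \<noteq> B"
    using exists_maximal_ideal_with[OF B(1), of "\<lambda>K. K \<inter> N = B"] B(2) by (metis Int_absorb2)
  interpret K: ideal K R by fact
  interpret N: ideal N R by fact
  interpret J: ideal J R by fact
  have "\<exists>k::nat. y [^] k \<in> K" if y: "y \<in> J" for y
  proof -
    have yR: "y \<in> carrier R" using y by (simp add: J.Icarr)
    text \<open>The ascending chain \<open>(K : y\<^sup>k)\<close> stabilizes.\<close>
    define Q where "Q = (\<lambda>L. \<exists>k::nat. L = colon R K (y [^] k))"
    have id: "ideal (colon R K (y [^] k)) R" for k :: nat
      by (rule colon_ideal[OF K(1)]) (simp add: yR)
    have Q: "Q (colon R K (y [^] k))" for k :: nat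
      unfolding Q_def by blast
    from exists_maximal_ideal_with[where Q = Q, OF id Q, of 0]
    obtain C where C: "Q C" and Cmax: "\<And>L. ideal L R \<Longrightarrow> C \<subset> L \<Longrightarrow> \<not> Q L" by blast
    from C obtain k :: nat where k: "C = colon R K (y [^] k)" unfolding Q_def by (elim exE)
    have mono: "colon R K (y [^] k) \<subseteq> colon R K (y [^] Suc k)"
    proof
      fix a assume a: "a \<in> colon R K (y [^] k)"
      then have "y [^] Suc k \<otimes> a = y \<otimes> (y [^] k \<otimes> a)"
        using yR by (simp add: colon_def m_assoc m_comm[of _ y])
      then show "a \<in> colon R K (y [^] Suc k)"
        using a yR by (simp add: colon_def K.I_l_closed del: nat_pow_Suc)
    qed
    have stab: "colon R K (y [^] Suc k) \<subseteq> colon R K (y [^] k)"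
      using Cmax[OF id] mono Q unfolding k by blast
    \<comment> \<open>Otherwise K + (y^k) still meets N in B, against the maximality of K: for z = a
      + b y^k in N the product y z lies in B, so y^(k+1) b lies in K, stability gives b y^k in K,
      and hence z lies in K.\<close>
    have "y [^] k \<in> K"
    proof (rule ccontr)
      assume nK: "y [^] k \<notin> K"
      have ykR: "y [^] k \<in> carrier R" using yR by simp
      note ext = ideal_add_PIdl_strict[OF K(1) ykR nK]
      have "(K <+> PIdl (y [^] k)) \<inter> N \<subseteq> B"
      proof
        fix z assume z: "z \<in> (K <+> PIdl (y [^] k)) \<inter> N"
        then obtain a b where ab: "a \<in> K" "b \<in> carrier R" "z = a \<oplus> b \<otimes> y [^] k"
          unfolding set_add_def' cgenideal_def by blast
        have aR: "a \<in> carrier R" using ab by (simp add: K.Icarr)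
        have "y \<otimes> z \<in> K" using JN[OF y] z K(2) by auto
        moreover have "y \<otimes> a \<in> K" using ab yR by (simp add: K.I_l_closed)
        ultimately have "y \<otimes> z \<ominus> y \<otimes> a \<in> K" unfolding a_minus_def by simp
        moreover have "y \<otimes> z \<ominus> y \<otimes> a = y [^] Suc k \<otimes> b"
          unfolding ab(3) nat_pow_Suc using ab(2) aR yR ykR by algebra
        ultimately have "b \<in> colon R K (y [^] Suc k)" using ab(2) by (simp only: colon_def) simp
        then have "b \<in> colon R K (y [^] k)" using stab by blast
        then have "b \<otimes> y [^] k \<in> K" using ab(2) ykR by (simp add: colon_def m_comm)
        then have "z \<in> K" using ab by simp
        then show "z \<in> B" using z K(3) by blast
      qed
      moreover have "B \<subseteq> (K <+> PIdl (y [^] k)) \<inter> N" using ext(2) K(2) B(2) by blast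
      ultimately show False using max[OF ext(1,2)] by blast
    qed
    then show ?thesis by blast
  qed
  then obtain n where "ideal_power R J n \<subseteq> K"
    using ideal_power_subset_of_nilpotent[OF K(1) J] by blast
  then show ?thesis using that K by blast
qed

text \<open>The weak form of Artin-Rees, with n depending on m: \<open>artin_rees\<close> is applied
  to J^m in place of J and to the ideal I J^m inside I. The n-th power of J^m is then the power m n
  of J.\<close>

lemma artin_rees_inter:
  assumes I: "ideal I R" and J: "ideal J R"
  obtains n where "I \<inter> ideal_power R J n \<subseteq> ideal_prod R I (ideal_power R J m)"
proof -
  note Jm = ideal_power_ideal[OF J, of m]
  interpret I: ideal I R by fact
  interpret Jm: ideal "ideal_power R J m" R by (rule Jm)
  obtain K n where K: "ideal K R" "ideal_prod R I (ideal_power R J m) \<subseteq> K"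
      "K \<inter> I = ideal_prod R I (ideal_power R J m)" "ideal_power R (ideal_power R J m) n \<subseteq> K"
  proof (rule artin_rees[OF ideal_prod_is_ideal[OF I Jm] _ I Jm])
    show "ideal_prod R I (ideal_power R J m) \<subseteq> I" using ideal_prod_inter[OF I Jm] by blast
    show "y \<otimes> z \<in> ideal_prod R I (ideal_power R J m)"
      if "y \<in> ideal_power R J m" "z \<in> I" for y z
      using that ideal_prod.prod[of z I y "ideal_power R J m" R]
      by (simp add: m_comm I.Icarr Jm.Icarr)
  qed blast
  then show ?thesis
    using that[of "m * n"] unfolding ideal_power_mult[OF J] by blast
qed

text \<open>Artin-Rees for N = I + (x) and B = I + (x) J^m leads to an equation x a = i + x b with b
  in J^m, and then a - b lies in (I : x). This comparison of colon ideals at finite levels is what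
  flatness of the completion rests on.\<close>

lemma artin_rees_colon:
  assumes I: "ideal I R" and J: "ideal J R" and x: "x \<in> carrier R"
  obtains n where "colon R (I <+> ideal_power R J n) x \<subseteq> colon R I x <+> ideal_power R J m"
proof -
  define P where "P = ideal_power R J m"
  have P: "ideal P R" unfolding P_def by (rule ideal_power_ideal[OF J])
  interpret I: ideal I R by fact
  interpret P: ideal P R by fact
  define Px where "Px = PIdl x"
  have Px: "ideal Px R" unfolding Px_def using x by (rule cgenideal_ideal)
  have XP: "\<exists>b\<in>P. z = x \<otimes> b" if "z \<in> ideal_prod R Px P" for z
    using that
  proof (induct rule: ideal_prod.induct)
    case (prod i j)
    then obtain r where r: "r \<in> carrier R" "i = r \<otimes> x" by (auto simp: Px_def cgenideal_def)
    then have "i \<otimes> j = x \<otimes> (r \<otimes> j)" using prod x by (simp add: m_ac P.Icarr)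
    then show ?case using prod r by (auto intro!: bexI[of _ "r \<otimes> j"] P.I_l_closed)
  next
    case (sum s1 s2)
    then obtain b c where "b \<in> P" "c \<in> P" "s1 = x \<otimes> b" "s2 = x \<otimes> c" by auto
    then show ?case using x by (auto intro!: bexI[of _ "b \<oplus> c"] simp: r_distr P.Icarr)
  qed
  have sub_add: "u \<in> A <+> C" if "u \<in> A" "ideal A R" "ideal C R" for u A C
    unfolding set_add_def'
    using that by (intro UN_I[of u] UN_I[of \<zero>])
      (auto simp: ideal.Icarr additive_subgroup.zero_closed[OF ideal.axioms(1)])
  have sub_add': "u \<in> A <+> C" if "u \<in> C" "ideal A R" "ideal C R" for u A C
    using sub_add[OF that(1,3,2)] set_add_comm[of A C] that ideal.Icarr by (metis subsetI)
  have XPi: "ideal (ideal_prod R Px P) R" by (rule ideal_prod_is_ideal[OF Px P])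
  have B: "ideal (I <+> ideal_prod R Px P) R" by (rule add_ideals[OF I XPi])
  have N: "ideal (I <+> Px) R" by (rule add_ideals[OF I Px])
  obtain K n where K: "ideal K R" "I <+> ideal_prod R Px P \<subseteq> K"
      "K \<inter> (I <+> Px) = I <+> ideal_prod R Px P" "ideal_power R P n \<subseteq> K"
  proof (rule artin_rees[OF B _ N P])
    show "I <+> ideal_prod R Px P \<subseteq> I <+> Px"
      using ideal_prod_inter[OF Px P] unfolding set_add_def' by blast
    show "y \<otimes> z \<in> I <+> ideal_prod R Px P" if y: "y \<in> P" and z: "z \<in> I <+> Px" for y z
    proof -
      from z obtain a b where ab: "a \<in> I" "b \<in> Px" "z = a \<oplus> b" unfolding set_add_def' by blast
      then have "y \<otimes> z = y \<otimes> a \<oplus> b \<otimes> y"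
        using y ideal.Icarr[OF Px] by (simp add: r_distr I.Icarr P.Icarr m_comm)
      moreover have "y \<otimes> a \<in> I" using ab y by (simp add: I.I_l_closed P.Icarr)
      moreover have "b \<otimes> y \<in> ideal_prod R Px P" using ab y by (intro ideal_prod.prod)
      ultimately show ?thesis unfolding set_add_def' by blast
    qed
  qed blast
  have "colon R (I <+> ideal_power R J (m * n)) x \<subseteq> colon R I x <+> P"
  proof
    fix a assume "a \<in> colon R (I <+> ideal_power R J (m * n)) x"
    then have a: "a \<in> carrier R" "x \<otimes> a \<in> I <+> ideal_power R J (m * n)" by (auto simp: colon_def)
    have "I \<subseteq> K" using K(2) sub_add[OF _ I XPi] by blast
    moreover have "ideal_power R J (m * n) \<subseteq> K"
      using K(4) unfolding P_def ideal_power_mult[OF J] .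
    ultimately have "I <+> ideal_power R J (m * n) \<subseteq> K"
      using additive_subgroup.a_closed[OF ideal.axioms(1)[OF K(1)]] unfolding set_add_def' by blast
    then have "x \<otimes> a \<in> K" using a by blast
    moreover have "x \<otimes> a \<in> I <+> Px"
      using a x by (intro sub_add'[OF _ I Px]) (auto simp: Px_def cgenideal_def m_comm)
    ultimately obtain i b where ib: "i \<in> I" "b \<in> P" "x \<otimes> a = i \<oplus> x \<otimes> b"
      using K(3) XP unfolding set_add_def' by blast
    have iR: "i \<in> carrier R" and bR: "b \<in> carrier R" using ib by (auto simp: I.Icarr P.Icarr)
    have "x \<otimes> (a \<ominus> b) = x \<otimes> a \<ominus> x \<otimes> b" using x a bR by algebra
    also have "\<dots> = i" unfolding ib(3) using iR x bR by algebra
    finally have "a \<ominus> b \<in> colon R I x" using ib a bR by (simp add: colon_def)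
    moreover have "a = (a \<ominus> b) \<oplus> b" using a bR by algebra
    ultimately show "a \<in> colon R I x <+> P" using ib(2) unfolding set_add_def' by blast
  qed
  then show ?thesis using that unfolding P_def by blast
qed

end

section \<open>The augmented Bousfield--Kan complex of a cube\<close>

definition mod_cong :: "('x, 'm) ring_scheme \<Rightarrow> 'x set \<Rightarrow> 'x \<Rightarrow> 'x \<Rightarrow> bool"
  where "mod_cong M H x y \<longleftrightarrow> x \<ominus>\<^bsub>M\<^esub> y \<in> H"

context module
begin

lemma minus_eq_smult:
  "x \<in> carrier M \<Longrightarrow> y \<in> carrier M \<Longrightarrow> x \<ominus>\<^bsub>M\<^esub> y = x \<oplus>\<^bsub>M\<^esub> (\<ominus> \<one>) \<odot>\<^bsub>M\<^esub> y"
  by (simp add: a_minus_def smult_l_minus)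

lemma signed_hom: "signed M i \<in> module_hom R M M"
  by (rule module_homI) (auto simp: signed_def M.minus_add smult_r_minus)

lemma signed_closed [simp]: "x \<in> carrier M \<Longrightarrow> signed M i x \<in> carrier M"
  by (simp add: signed_def)

lemma signed_signed: "x \<in> carrier M \<Longrightarrow> signed M i (signed M i x) = x"
  by (simp add: signed_def)

lemma signed_Suc: "x \<in> carrier M \<Longrightarrow> signed M (Suc i) x = \<ominus>\<^bsub>M\<^esub> signed M i x"
  by (simp add: signed_def)

lemma signed_zero [simp]: "signed M i \<zero>\<^bsub>M\<^esub> = \<zero>\<^bsub>M\<^esub>"
  by (simp add: signed_def)

lemma signed_submodule: "submodule H R M \<Longrightarrow> x \<in> H \<Longrightarrow> signed M i x \<in> H"
  by (simp add: signed_def submodule_facts)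

lemma mod_cong_refl: "submodule H R M \<Longrightarrow> x \<in> carrier M \<Longrightarrow> mod_cong M H x x"
  by (simp add: mod_cong_def a_minus_def M.r_neg submodule_facts)

lemma mod_cong_sym:
  assumes "submodule H R M" "x \<in> carrier M" "y \<in> carrier M" "mod_cong M H x y"
  shows "mod_cong M H y x"
proof -
  have "y \<ominus>\<^bsub>M\<^esub> x = \<ominus>\<^bsub>M\<^esub> (x \<ominus>\<^bsub>M\<^esub> y)"
    using assms(2,3) by (simp add: a_minus_def M.minus_add M.a_comm)
  then show ?thesis
    using assms submodule_facts(4)[OF assms(1)] by (simp add: mod_cong_def)
qed

lemma minus_add_minus:
  assumes "x \<in> carrier M" "y \<in> carrier M" "x' \<in> carrier M" "y' \<in> carrier M"
  shows "(x \<oplus>\<^bsub>M\<^esub> y) \<ominus>\<^bsub>M\<^esub> (x' \<oplus>\<^bsub>M\<^esub> y') = (x \<ominus>\<^bsub>M\<^esub> x') \<oplus>\<^bsub>M\<^esub> (y \<ominus>\<^bsub>M\<^esub> y')"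
  using assms by (simp add: a_minus_def M.minus_add M.a_ac)

lemma minus_trans:
  assumes "x \<in> carrier M" "y \<in> carrier M" "z \<in> carrier M"
  shows "x \<ominus>\<^bsub>M\<^esub> z = (x \<ominus>\<^bsub>M\<^esub> y) \<oplus>\<^bsub>M\<^esub> (y \<ominus>\<^bsub>M\<^esub> z)"
proof -
  have "(x \<ominus>\<^bsub>M\<^esub> y) \<oplus>\<^bsub>M\<^esub> (y \<ominus>\<^bsub>M\<^esub> z) = x \<oplus>\<^bsub>M\<^esub> (\<ominus>\<^bsub>M\<^esub> y \<oplus>\<^bsub>M\<^esub> y) \<oplus>\<^bsub>M\<^esub> \<ominus>\<^bsub>M\<^esub> z"
    unfolding a_minus_def using assms by (simp add: M.a_assoc)
  also have "\<dots> = x \<ominus>\<^bsub>M\<^esub> z" unfolding a_minus_def using assms by (simp add: M.l_neg)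
  finally show ?thesis ..
qed

lemma minus_cancel: "x \<in> carrier M \<Longrightarrow> y \<in> carrier M \<Longrightarrow> (x \<ominus>\<^bsub>M\<^esub> y) \<oplus>\<^bsub>M\<^esub> y = x"
  by (simp add: a_minus_def M.a_assoc M.l_neg)

lemma mod_cong_trans:
  assumes "submodule H R M" "x \<in> carrier M" "y \<in> carrier M" "z \<in> carrier M"
    and "mod_cong M H x y" "mod_cong M H y z"
  shows "mod_cong M H x z"
  using assms(5,6) submodule_facts(3)[OF assms(1)]
  unfolding mod_cong_def minus_trans[OF assms(2-4)] by blast

lemma mod_cong_add:
  assumes "submodule H R M" "x \<in> carrier M" "y \<in> carrier M" "x' \<in> carrier M" "y' \<in> carrier M"
    and "mod_cong M H x x'" "mod_cong M H y y'"
  shows "mod_cong M H (x \<oplus>\<^bsub>M\<^esub> y) (x' \<oplus>\<^bsub>M\<^esub> y')"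
  using assms submodule_facts(3)[OF assms(1)] by (simp add: mod_cong_def minus_add_minus)

lemma mod_cong_signed:
  assumes "submodule H R M" "x \<in> carrier M" "y \<in> carrier M" "mod_cong M H x y"
  shows "mod_cong M H (signed M i x) (signed M i y)"
proof -
  have "signed M i x \<ominus>\<^bsub>M\<^esub> signed M i y = signed M i (x \<ominus>\<^bsub>M\<^esub> y)"
    using module_hom_minus[OF module_axioms module_axioms signed_hom assms(2,3)] by simp
  then show ?thesis
    using assms by (simp add: mod_cong_def signed_submodule)
qed

lemma mod_cong_in:
  assumes "submodule H R M" "x \<in> carrier M" "y \<in> carrier M" "mod_cong M H x y" "y \<in> H"
  shows "x \<in> H"
  using assms(4,5) minus_cancel[OF assms(2,3)] submodule_facts(3)[OF assms(1)]
  unfolding mod_cong_def by metis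

lemma mod_cong_finsum_subset:
  assumes H: "submodule H R M" and fin: "finite A" "S \<subseteq> A"
    and f: "\<And>i. i \<in> A \<Longrightarrow> f i \<in> carrier M" "\<And>i. i \<in> A - S \<Longrightarrow> f i \<in> H"
  shows "mod_cong M H (finsum M f A) (finsum M f S)"
proof -
  have c: "finsum M f S \<in> carrier M" "finsum M f (A - S) \<in> carrier M"
    using f fin by (auto intro!: M.finsum_closed)
  have "finsum M f A = finsum M f (A - S) \<oplus>\<^bsub>M\<^esub> finsum M f S"
    using M.finsum_Un_disjoint[of "A - S" S f] fin f
    by (auto simp: Un_absorb2 finite_subset Un_Diff_cancel2 Pi_iff subset_iff)
  then have "finsum M f A \<ominus>\<^bsub>M\<^esub> finsum M f S = finsum M f (A - S)"
    using c by (simp add: a_minus_def M.a_assoc M.r_neg)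
  moreover have "finsum M f (A - S) \<in> H"
    by (rule submodule_facts(7)[OF H f(2)])
  ultimately show ?thesis by (simp add: mod_cong_def)
qed

end

lemma (in abelian_group) minus_zero_right: "x \<in> carrier G \<Longrightarrow> x \<ominus> \<zero> = x"
  by (metis a_minus_def l_neg minus_equality r_zero zero_closed)

text \<open>The entry at (i, j) with i at most j cancels the entry at (j + 1, i), and this pairs off
  the whole rectangle. The induction strips the last row and the last column, which cancel each
  other. It is the cancellation behind d d = 0.\<close>

lemma (in abelian_group) alternating_double_finsum:
  assumes "\<And>i j. i < Suc n \<Longrightarrow> j < n \<Longrightarrow> a i j \<in> carrier G"
    and "\<And>i j. i \<le> j \<Longrightarrow> j < n \<Longrightarrow> a i j = \<ominus> a (Suc j) i"
  shows "(\<Oplus>i\<in>{..<Suc n}. \<Oplus>j\<in>{..<n}. a i j) = \<zero>"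
  using assms
proof (induct n)
  case 0
  have "(\<Oplus>i\<in>{..<Suc 0}. \<Oplus>j\<in>{..<0}. a i j) = (\<Oplus>i\<in>{..<Suc 0}. \<zero>)"
    by (intro finsum_cong') auto
  then show ?case by (simp only: finsum_zero)
next
  case (Suc n)
  have a: "a i j \<in> carrier G" if "i < Suc (Suc n)" "j < Suc n" for i j using Suc(2) that by blast
  have "(\<Oplus>i\<in>{..<Suc (Suc n)}. \<Oplus>j\<in>{..<Suc n}. a i j)
      = (\<Oplus>j\<in>{..<Suc n}. a (Suc n) j) \<oplus> (\<Oplus>i\<in>{..<Suc n}. \<Oplus>j\<in>{..<Suc n}. a i j)"
    unfolding lessThan_Suc[of "Suc n"] using a by (intro finsum_insert) (auto intro!: finsum_closed)
  also have "(\<Oplus>i\<in>{..<Suc n}. \<Oplus>j\<in>{..<Suc n}. a i j)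
      = (\<Oplus>i\<in>{..<Suc n}. a i n \<oplus> (\<Oplus>j\<in>{..<n}. a i j))"
    unfolding lessThan_Suc[of n] using a
    by (intro finsum_cong' refl finsum_insert) (auto intro!: finsum_closed simp: lessThan_Suc)
  also have "\<dots> = (\<Oplus>i\<in>{..<Suc n}. a i n) \<oplus> (\<Oplus>i\<in>{..<Suc n}. \<Oplus>j\<in>{..<n}. a i j)"
    using a by (intro finsum_addf) (auto intro!: finsum_closed)
  also have "(\<Oplus>i\<in>{..<Suc n}. \<Oplus>j\<in>{..<n}. a i j) = \<zero>"
    by (rule Suc(1)) (use Suc(2,3) in auto)
  also have "(\<Oplus>i\<in>{..<Suc n}. a i n) \<oplus> \<zero> = (\<Oplus>i\<in>{..<Suc n}. a i n)"
    using a by (intro r_zero) (auto intro!: finsum_closed)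
  also have "(\<Oplus>j\<in>{..<Suc n}. a (Suc n) j) \<oplus> \<dots> = (\<Oplus>i\<in>{..<Suc n}. a (Suc n) i \<oplus> a i n)"
    using a by (intro finsum_addf[symmetric]) auto
  also have "\<dots> = (\<Oplus>i\<in>{..<Suc n}. \<zero>)"
  proof (rule finsum_cong')
    fix i assume "i \<in> {..<Suc n}"
    then show "a (Suc n) i \<oplus> a i n = \<zero>"
      using Suc(3)[of i n] a[of "Suc n" i] by (simp add: r_neg)
  qed auto
  also have "\<dots> = \<zero>" by (rule finsum_zero)
  finally show ?case .
qed

text \<open>The default value for the empty chain makes the vertex \<open>{}\<close> of the cube its
  coefficient module, so the augmentation needs no separate treatment.\<close>

definition apex :: "'i set list \<Rightarrow> 'i set"
  where "apex c = (if c = [] then {} else last c)"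

lemma apex_Nil [simp]: "apex [] = {}"
  and apex_append_Cons [simp]: "apex (a @ D # b) = apex (D # b)"
  and apex_single [simp]: "apex [D] = D"
  by (auto simp: apex_def)

section \<open>Faces of chains of vertices\<close>

lemma length_omit: "i < length c \<Longrightarrow> length (omit i c) = length c - 1"
  by (auto simp: omit_def)

lemma nth_omit: "i < length c \<Longrightarrow> k < length c - 1 \<Longrightarrow> omit i c ! k = c ! (if k < i then k else Suc k)"
  by (auto simp: omit_def nth_append min_def)

lemma omit_omit:
  assumes "i \<le> j" "Suc j < length c"
  shows "omit j (omit i c) = omit i (omit (Suc j) c)"
  using assms by (intro nth_equalityI) (auto simp: length_omit nth_omit)

lemma set_omit: "set (omit i c) \<subseteq> set c"
  using set_take_subset set_drop_subset by (fastforce simp: omit_def)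

lemma sorted_omit: "sorted_wrt P c \<Longrightarrow> sorted_wrt P (omit i c)"
proof -
  assume *: "sorted_wrt P c"
  have "sorted_wrt P (take i c @ drop i c)" using * by simp
  moreover have "set (drop (Suc i) c) \<subseteq> set (drop i c)" by (rule set_drop_subset_set_drop) simp
  ultimately show ?thesis
    using * sorted_wrt_drop[of P c "Suc i"] unfolding omit_def sorted_wrt_append by blast
qed

lemma apex_omit: "Suc i < length c \<Longrightarrow> apex (omit i c) = apex c"
  by (auto simp: apex_def omit_def)

lemma omit_last: "c \<noteq> [] \<Longrightarrow> omit (length c - 1) c = butlast c"
  by (simp add: omit_def butlast_conv_take)

lemma omit_append_left: "i < length a \<Longrightarrow> omit i (a @ b) = omit i a @ b"
  by (simp add: omit_def)

lemma omit_append_right: "omit (length a + i) (a @ b) = a @ omit i b"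
  by (simp add: omit_def)

lemma sorted_wrt_less_le_last: "sorted_wrt (<) c \<Longrightarrow> D \<in> set c \<Longrightarrow> D \<le> (last c :: 'i::order)"
  by (cases c rule: rev_cases) (auto simp: sorted_wrt_append less_imp_le)

locale cube_diagram = noetherian_cring R for R (structure) +
  fixes E :: "'i set" and F :: "'i set \<Rightarrow> ('a, 'x) module"
    and \<phi> :: "'i set \<Rightarrow> 'i set \<Rightarrow> 'x \<Rightarrow> 'x"
  assumes finite_E: "finite E" and diagram: "module_diagram R (Pow E) F \<phi>"
begin

lemma F_module: "D \<subseteq> E \<Longrightarrow> module R (F D)"
  and phi_hom: "C \<subseteq> D \<Longrightarrow> D \<subseteq> E \<Longrightarrow> \<phi> C D \<in> module_hom R (F C) (F D)"
  and phi_id: "D \<subseteq> E \<Longrightarrow> x \<in> carrier (F D) \<Longrightarrow> \<phi> D D x = x"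
  and phi_comp: "B \<subseteq> C \<Longrightarrow> C \<subseteq> D \<Longrightarrow> D \<subseteq> E \<Longrightarrow> x \<in> carrier (F B) \<Longrightarrow>
    \<phi> C D (\<phi> B C x) = \<phi> B D x"
  using diagram unfolding module_diagram_def by auto

definition chains :: "'i set list set"
  where "chains = {c. set c \<subseteq> Pow E - {{}} \<and> sorted_wrt (<) c}"

lemma finite_chains: "finite chains"
proof -
  have "sorted_wrt (<) c \<Longrightarrow> distinct c" for c :: "'i set list"
    by (induct c) auto
  then have sub: "chains \<subseteq> {c. set c \<subseteq> Pow E \<and> distinct c}" by (auto simp: chains_def)
  show ?thesis
    by (rule finite_subset[OF sub finite_subset_distinct]) (simp add: finite_E)
qed

lemma Nil_chains [simp]: "[] \<in> chains"
  by (simp add: chains_def)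

lemma omit_chains: "c \<in> chains \<Longrightarrow> omit i c \<in> chains"
  using set_omit[of i c] sorted_omit[of "(<)" c i] by (auto simp: chains_def)

lemma apex_subset: "c \<in> chains \<Longrightarrow> apex c \<subseteq> E"
  by (cases c rule: rev_cases) (auto simp: chains_def apex_def)

lemma apex_omit_subset: "c \<in> chains \<Longrightarrow> apex (omit i c) \<subseteq> apex c"
proof (cases "omit i c = []")
  case False
  assume c: "c \<in> chains"
  have "last (omit i c) \<in> set c"
    using set_omit[of i c] last_in_set[OF False] by blast
  then have "last (omit i c) \<le> last c"
    using c sorted_wrt_less_le_last by (auto simp: chains_def)
  moreover have "c \<noteq> []" using False by (auto simp: omit_def)
  ultimately show ?thesis using False by (simp add: apex_def)
qed simp

text \<open>Values off \<open>chains\<close> are unconstrained; cochains are therefore compared at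
  elements of \<open>chains\<close>, and equalities between them are stated there pointwise.\<close>

definition cochains :: "('i set list \<Rightarrow> 'x) set"
  where "cochains = {x. \<forall>c\<in>chains. x c \<in> carrier (F (apex c))}"

lemma cochainsD: "x \<in> cochains \<Longrightarrow> c \<in> chains \<Longrightarrow> x c \<in> carrier (F (apex c))"
  by (simp add: cochains_def)

text \<open>One formula for all faces: unless the last vertex is omitted, the apex does not change
  and the transition map is an identity. For a chain with one vertex it is the augmentation.\<close>

definition face :: "('i set list \<Rightarrow> 'x) \<Rightarrow> 'i set list \<Rightarrow> nat \<Rightarrow> 'x"
  where "face x c i = \<phi> (apex (omit i c)) (apex c) (x (omit i c))"

text \<open>All degrees of the total complex are treated at once: a cochain assigns values to chains of
  every length, the empty chain carrying the augmentation.\<close>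

definition cobd :: "('i set list \<Rightarrow> 'x) \<Rightarrow> 'i set list \<Rightarrow> 'x"
  where "cobd x c = finsum (F (apex c)) (\<lambda>i. signed (F (apex c)) i (face x c i)) {..<length c}"

lemma chain_module: "c \<in> chains \<Longrightarrow> module R (F (apex c))"
  by (intro F_module apex_subset)

lemma face_hom: "c \<in> chains \<Longrightarrow> \<phi> (apex (omit i c)) (apex c) \<in> module_hom R (F (apex (omit i c))) (F (apex c))"
  by (intro phi_hom apex_omit_subset apex_subset)

lemma face_closed: "x \<in> cochains \<Longrightarrow> c \<in> chains \<Longrightarrow> face x c i \<in> carrier (F (apex c))"
  unfolding face_def using module_hom_closed[OF face_hom] cochainsD omit_chains by blast

lemma signed_face_closed:
  "x \<in> cochains \<Longrightarrow> c \<in> chains \<Longrightarrow> signed (F (apex c)) i (face x c i) \<in> carrier (F (apex c))"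
  using module.signed_closed[OF chain_module] face_closed by blast

lemma cobd_closed: "x \<in> cochains \<Longrightarrow> c \<in> chains \<Longrightarrow> cobd x c \<in> carrier (F (apex c))"
proof -
  assume *: "x \<in> cochains" "c \<in> chains"
  interpret M: module R "F (apex c)" by (rule chain_module) fact
  show ?thesis unfolding cobd_def using signed_face_closed[OF *] by (intro M.M.finsum_closed) auto
qed

lemma cobd_cochains: "x \<in> cochains \<Longrightarrow> cobd x \<in> cochains"
  using cobd_closed by (auto simp: cochains_def)

lemma cobd_cong: "(\<And>i. i < length c \<Longrightarrow> x (omit i c) = y (omit i c)) \<Longrightarrow> c \<in> chains \<Longrightarrow> y \<in> cochains \<Longrightarrow>
    cobd x c = cobd y c"
proof -
  assume *: "\<And>i. i < length c \<Longrightarrow> x (omit i c) = y (omit i c)" "c \<in> chains" "y \<in> cochains"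
  interpret M: module R "F (apex c)" by (rule chain_module) fact
  show ?thesis
    unfolding cobd_def using * signed_face_closed[OF *(3,2)]
    by (intro M.M.finsum_cong') (auto simp: face_def)
qed

text \<open>Once the transition maps are composed, omitting two vertices in either order gives the
  same value \<open>v\<close>, by the simplicial identity \<open>omit_omit\<close>. The two
  occurrences carry opposite signs, so the double sum cancels in pairs.\<close>

lemma cobd_cobd:
  assumes x: "x \<in> cochains" and c: "c \<in> chains"
  shows "cobd (cobd x) c = \<zero>\<^bsub>F (apex c)\<^esub>"
proof (cases "length c")
  case 0
  interpret M: module R "F (apex c)" by (rule chain_module) fact
  show ?thesis using 0 unfolding cobd_def by (simp only: lessThan_0 M.M.finsum_empty)
next
  case (Suc n)
  let ?M = "F (apex c)"
  interpret M: module R ?M by (rule chain_module) fact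
  define v where "v i j = \<phi> (apex (omit j (omit i c))) (apex c) (x (omit j (omit i c)))" for i j
  define a where "a i j = signed ?M i (signed ?M j (v i j))" for i j
  have oc: "omit j (omit i c) \<in> chains" for i j using c by (intro omit_chains)
  have sub: "apex (omit j (omit i c)) \<subseteq> apex (omit i c)" for i j
    using c by (intro apex_omit_subset omit_chains)
  have v_closed: "v i j \<in> carrier ?M" for i j
    unfolding v_def using sub apex_omit_subset[OF c] apex_subset[OF c] cochainsD[OF x oc]
    by (intro module_hom_closed[OF phi_hom]) blast+
  have "signed ?M i (face (cobd x) c i) = (\<Oplus>\<^bsub>?M\<^esub>j\<in>{..<n}. a i j)" if i: "i < Suc n" for i
  proof -
    let ?N = "F (apex (omit i c))"
    have oi: "omit i c \<in> chains" by (rule omit_chains[OF c])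
    interpret N: module R ?N by (rule chain_module[OF oi])
    have hom: "(\<lambda>u. signed ?M i (\<phi> (apex (omit i c)) (apex c) u)) \<in> module_hom R ?N ?M"
      by (rule module_hom_comp[OF face_hom[OF c] M.signed_hom])
    have len: "length (omit i c) = n" using i Suc by (simp add: length_omit)
    have "signed ?M i (face (cobd x) c i) =
        (\<Oplus>\<^bsub>?M\<^esub>j\<in>{..<n}. signed ?M i (\<phi> (apex (omit i c)) (apex c) (signed ?N j (face x (omit i c) j))))"
      unfolding face_def[of "cobd x"] cobd_def len
      by (rule module_hom_finsum[OF N.module_axioms M.module_axioms hom signed_face_closed[OF x oi]])
    also have "\<dots> = (\<Oplus>\<^bsub>?M\<^esub>j\<in>{..<n}. a i j)"
    proof (rule M.M.finsum_cong')
      fix j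
      have f: "face x (omit i c) j \<in> carrier ?N" by (rule face_closed[OF x oi])
      have "\<phi> (apex (omit i c)) (apex c) (signed ?N j (face x (omit i c) j))
          = signed ?M j (\<phi> (apex (omit i c)) (apex c) (face x (omit i c) j))"
        using module_hom_neg[OF N.module_axioms M.module_axioms face_hom[OF c] f]
        by (simp add: signed_def)
      also have "\<phi> (apex (omit i c)) (apex c) (face x (omit i c) j) = v i j"
        unfolding face_def v_def
        using phi_comp[OF sub apex_omit_subset[OF c] apex_subset[OF c] cochainsD[OF x oc]] .
      finally show "signed ?M i (\<phi> (apex (omit i c)) (apex c) (signed ?N j (face x (omit i c) j))) = a i j"
        by (simp add: a_def)
    qed (auto simp: a_def v_closed)
    finally show ?thesis .
  qed
  then have "cobd (cobd x) c = (\<Oplus>\<^bsub>?M\<^esub>i\<in>{..<Suc n}. \<Oplus>\<^bsub>?M\<^esub>j\<in>{..<n}. a i j)"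
    unfolding cobd_def[of "cobd x"] Suc
    by (intro M.M.finsum_cong') (auto intro!: M.M.finsum_closed simp: a_def v_closed)
  also have "\<dots> = \<zero>\<^bsub>?M\<^esub>"
  proof (rule M.M.alternating_double_finsum)
    fix i j assume ij: "i \<le> j" "j < n"
    have "v i j = v (Suc j) i"
      using omit_omit[of i j c] ij Suc by (simp add: v_def)
    then show "a i j = \<ominus>\<^bsub>?M\<^esub> a (Suc j) i"
      unfolding a_def using v_closed[of "Suc j" i] by (auto simp: signed_def)
  qed (simp add: a_def v_closed)
  finally show ?thesis .
qed

definition csum :: "('i set list \<Rightarrow> 'x) \<Rightarrow> ('i set list \<Rightarrow> 'x) \<Rightarrow> 'i set list \<Rightarrow> 'x"
  where "csum x y = (\<lambda>c. x c \<oplus>\<^bsub>F (apex c)\<^esub> y c)"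

definition cscale :: "'a \<Rightarrow> ('i set list \<Rightarrow> 'x) \<Rightarrow> 'i set list \<Rightarrow> 'x"
  where "cscale r x = (\<lambda>c. r \<odot>\<^bsub>F (apex c)\<^esub> x c)"

definition cdiff :: "('i set list \<Rightarrow> 'x) \<Rightarrow> ('i set list \<Rightarrow> 'x) \<Rightarrow> 'i set list \<Rightarrow> 'x"
  where "cdiff x y = (\<lambda>c. x c \<ominus>\<^bsub>F (apex c)\<^esub> y c)"

lemma csum_cochains: "x \<in> cochains \<Longrightarrow> y \<in> cochains \<Longrightarrow> csum x y \<in> cochains"
  using module.axioms(2)[OF chain_module]
  by (auto simp: cochains_def csum_def intro: abelian_monoid.a_closed[OF abelian_group.axioms(1)])

lemma cscale_cochains: "r \<in> carrier R \<Longrightarrow> x \<in> cochains \<Longrightarrow> cscale r x \<in> cochains"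
  using module.smult_closed[OF chain_module] by (auto simp: cochains_def cscale_def)

lemma cdiff_eq: "x \<in> cochains \<Longrightarrow> y \<in> cochains \<Longrightarrow> c \<in> chains \<Longrightarrow>
    cdiff x y c = csum x (cscale (\<ominus> \<one>) y) c"
  unfolding cdiff_def csum_def cscale_def
  using module.minus_eq_smult[OF chain_module cochainsD cochainsD] by blast

lemma cdiff_cochains: "x \<in> cochains \<Longrightarrow> y \<in> cochains \<Longrightarrow> cdiff x y \<in> cochains"
  using csum_cochains[OF _ cscale_cochains, of x "\<ominus> \<one>" y] cdiff_eq by (simp add: cochains_def)

lemma cobd_csum:
  assumes x: "x \<in> cochains" and y: "y \<in> cochains" and c: "c \<in> chains"
  shows "cobd (csum x y) c = cobd x c \<oplus>\<^bsub>F (apex c)\<^esub> cobd y c"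
proof -
  let ?M = "F (apex c)"
  interpret M: module R ?M by (rule chain_module) fact
  have "signed ?M i (face (csum x y) c i) = signed ?M i (face x c i) \<oplus>\<^bsub>?M\<^esub> signed ?M i (face y c i)" for i
    using module_hom_add[OF face_hom[OF c] cochainsD[OF x omit_chains[OF c]] cochainsD[OF y omit_chains[OF c]]]
      module_hom_add[OF M.signed_hom face_closed[OF x c] face_closed[OF y c]]
    by (simp add: face_def csum_def)
  then have "cobd (csum x y) c = (\<Oplus>\<^bsub>?M\<^esub>i\<in>{..<length c}. signed ?M i (face x c i) \<oplus>\<^bsub>?M\<^esub> signed ?M i (face y c i))"
    by (simp add: cobd_def)
  also have "\<dots> = cobd x c \<oplus>\<^bsub>?M\<^esub> cobd y c"
    unfolding cobd_def using signed_face_closed[OF _ c] x y by (intro M.M.finsum_addf) auto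
  finally show ?thesis .
qed

lemma cobd_cscale:
  assumes r: "r \<in> carrier R" and x: "x \<in> cochains" and c: "c \<in> chains"
  shows "cobd (cscale r x) c = r \<odot>\<^bsub>F (apex c)\<^esub> cobd x c"
proof -
  let ?M = "F (apex c)"
  interpret M: module R ?M by (rule chain_module) fact
  have "signed ?M i (face (cscale r x) c i) = r \<odot>\<^bsub>?M\<^esub> signed ?M i (face x c i)" for i
    using module_hom_smult[OF face_hom[OF c] r cochainsD[OF x omit_chains[OF c]]]
      module_hom_smult[OF M.signed_hom r face_closed[OF x c]]
    by (simp add: face_def cscale_def)
  then have "cobd (cscale r x) c = (\<Oplus>\<^bsub>?M\<^esub>i\<in>{..<length c}. r \<odot>\<^bsub>?M\<^esub> signed ?M i (face x c i))"
    by (simp add: cobd_def)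
  also have "\<dots> = r \<odot>\<^bsub>?M\<^esub> cobd x c"
    unfolding cobd_def using signed_face_closed[OF x c] r
    by (intro M.finsum_smult_ldistr[symmetric]) auto
  finally show ?thesis .
qed

lemma cobd_cdiff:
  assumes x: "x \<in> cochains" and y: "y \<in> cochains" and c: "c \<in> chains"
  shows "cobd (cdiff x y) c = cobd x c \<ominus>\<^bsub>F (apex c)\<^esub> cobd y c"
proof -
  interpret M: module R "F (apex c)" by (rule chain_module) fact
  note m = cscale_cochains[OF _ y, of "\<ominus> \<one>"]
  have "cobd (cdiff x y) c = cobd (csum x (cscale (\<ominus> \<one>) y)) c"
    using cdiff_eq[OF x y] omit_chains[OF c] csum_cochains[OF x m] c by (intro cobd_cong) auto
  also have "\<dots> = cobd x c \<oplus>\<^bsub>F (apex c)\<^esub> (\<ominus> \<one>) \<odot>\<^bsub>F (apex c)\<^esub> cobd y c"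
    using cobd_csum[OF x m c] cobd_cscale[OF _ y c, of "\<ominus> \<one>"] by simp
  also have "\<dots> = cobd x c \<ominus>\<^bsub>F (apex c)\<^esub> cobd y c"
    using cobd_closed[OF _ c] x y by (simp add: M.minus_eq_smult)
  finally show ?thesis .
qed

lemma cobd_in_subfunctor:
  assumes N: "\<And>D. D \<subseteq> E \<Longrightarrow> submodule (N D) R (F D)"
    and hom: "\<And>C D x. C \<subseteq> D \<Longrightarrow> D \<subseteq> E \<Longrightarrow> x \<in> N C \<Longrightarrow> \<phi> C D x \<in> N D"
    and x: "\<And>c. c \<in> chains \<Longrightarrow> x c \<in> N (apex c)" and c: "c \<in> chains"
  shows "cobd x c \<in> N (apex c)"
proof -
  interpret M: module R "F (apex c)" by (rule chain_module) fact
  note sub = N[OF apex_subset[OF c]]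
  show ?thesis
    unfolding cobd_def face_def
    by (intro M.submodule_facts(7)[OF sub] M.signed_submodule[OF sub] hom
        apex_omit_subset apex_subset x omit_chains c)
qed

lemma cobd_ideal_span:
  assumes "ideal I R" "\<And>c. c \<in> chains \<Longrightarrow> x c \<in> ideal_span R I (F (apex c))" "c \<in> chains"
  shows "cobd x c \<in> ideal_span R I (F (apex c))"
proof (rule cobd_in_subfunctor[of "\<lambda>D. ideal_span R I (F D)"])
  show "D \<subseteq> E \<Longrightarrow> submodule (ideal_span R I (F D)) R (F D)" for D
    using module.ideal_span_submodule[OF F_module assms(1)] .
  show "\<phi> C D x \<in> ideal_span R I (F D)" if "C \<subseteq> D" "D \<subseteq> E" "x \<in> ideal_span R I (F C)" for C D x
    using that ideal.Icarr[OF assms(1)] by (intro ideal_span_hom[OF phi_hom] F_module) auto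
qed (use assms in auto)

text \<open>Exactness of C / I C for the augmented total complex C, expressed on lifts. As there are
  finitely many chains, I C consists of the cochains with all values in the corresponding I
  F.\<close>

definition acyclic_mod :: "'a set \<Rightarrow> bool"
  where "acyclic_mod I \<longleftrightarrow> (\<forall>x\<in>cochains. (\<forall>c\<in>chains. cobd x c \<in> ideal_span R I (F (apex c))) \<longrightarrow>
    (\<exists>y\<in>cochains. \<forall>c\<in>chains. cdiff x (cobd y) c \<in> ideal_span R I (F (apex c))))"

end

text \<open>Applied to all ideals, this is flatness of \<open>M\<close> over a Noetherian ring, in the form
  \<open>(I M : r) = (I : r) M\<close>.\<close>

definition colon_flat :: "('a, 'b) ring_scheme \<Rightarrow> ('a, 'x) module \<Rightarrow> bool"
  where "colon_flat R M \<longleftrightarrow> (\<forall>I r m. ideal I R \<longrightarrow> r \<in> carrier R \<longrightarrow> m \<in> carrier M \<longrightarrow>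
    r \<odot>\<^bsub>M\<^esub> m \<in> ideal_span R I M \<longrightarrow> m \<in> ideal_span R (colon R I r) M)"

section \<open>Noetherian induction for acyclicity modulo an ideal\<close>

locale flat_cube_diagram = cube_diagram +
  assumes flat: "D \<subseteq> E \<Longrightarrow> colon_flat R (F D)"
begin

text \<open>Multiplication by r embeds R/(I : r) into R/I with quotient R/(I + (r)), and flatness
  keeps this exact on the complex; acyclicity of the outer terms gives that of the middle one. On
  elements: x = d y + i + r m with i in I C, then m = d y' modulo (I : r) C, and y + r y' is the
  required primitive.\<close>

lemma acyclic_mod_extension:
  assumes I: "ideal I R" and r: "r \<in> carrier R"
    and ac: "acyclic_mod (colon R I r)" "acyclic_mod (I <+> PIdl r)"
  shows "acyclic_mod I"
  unfolding acyclic_mod_def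
proof (intro ballI impI)
  fix x assume x: "x \<in> cochains" and dx: "\<forall>c\<in>chains. cobd x c \<in> ideal_span R I (F (apex c))"
  note col = colon_ideal[OF I r] and P = cgenideal_ideal[OF r]
  have "I \<subseteq> I <+> PIdl r"
    using additive_subgroup.zero_closed[OF ideal.axioms(1)[OF P]] ideal.Icarr[OF I]
    by (force simp: set_add_def')
  then have "\<forall>c\<in>chains. cobd x c \<in> ideal_span R (I <+> PIdl r) (F (apex c))"
    using dx module.ideal_span_mono[OF chain_module] by blast
  then obtain y where y: "y \<in> cochains"
    and xy: "\<forall>c\<in>chains. cdiff x (cobd y) c \<in> ideal_span R (I <+> PIdl r) (F (apex c))"
    using ac(2) x unfolding acyclic_mod_def by blast
  have "\<exists>i m. i \<in> ideal_span R I (F (apex c)) \<and> m \<in> carrier (F (apex c)) \<and>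
      cdiff x (cobd y) c = i \<oplus>\<^bsub>F (apex c)\<^esub> r \<odot>\<^bsub>F (apex c)\<^esub> m" if c: "c \<in> chains" for c
  proof -
    interpret M: module R "F (apex c)" by (rule chain_module) fact
    obtain i z where iz: "i \<in> ideal_span R I (F (apex c))" "z \<in> ideal_span R (PIdl r) (F (apex c))"
        "cdiff x (cobd y) c = i \<oplus>\<^bsub>F (apex c)\<^esub> z"
      using M.ideal_span_add_ideals[OF I P] xy c by metis
    obtain m where "m \<in> carrier (F (apex c))" "z = r \<odot>\<^bsub>F (apex c)\<^esub> m"
      using M.ideal_span_PIdl[OF r iz(2)] by metis
    then show ?thesis using iz by blast
  qed
  then obtain i m where i: "\<And>c. c \<in> chains \<Longrightarrow> i c \<in> ideal_span R I (F (apex c))"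
    and m: "\<And>c. c \<in> chains \<Longrightarrow> m c \<in> carrier (F (apex c))"
    and im: "\<And>c. c \<in> chains \<Longrightarrow> cdiff x (cobd y) c = i c \<oplus>\<^bsub>F (apex c)\<^esub> r \<odot>\<^bsub>F (apex c)\<^esub> m c"
    by metis
  have mc: "m \<in> cochains" using m by (simp add: cochains_def)
  note rm = cscale_cochains[OF r mc] and dy = cobd_cochains[OF y]
  note xdy = cdiff_cochains[OF x dy]
  have ic: "i \<in> cochains"
    using i module.ideal_span_closed[OF chain_module ideal.axioms(1)[OF I, THEN additive_subgroup.a_subset]]
    by (auto simp: cochains_def)
  \<comment> \<open>Applying the coboundary to x - d y = i + r m gives r d m = d x - d i in I C,
    because d d y = 0. Flatness then removes the factor r at the price of (I : r).\<close>
  have dm: "cobd m c \<in> ideal_span R (colon R I r) (F (apex c))" if c: "c \<in> chains" for c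
  proof -
    interpret M: module R "F (apex c)" by (rule chain_module) fact
    note c1 = cobd_closed[OF x c] cobd_closed[OF ic c] cobd_closed[OF mc c]
    have "cobd (cdiff x (cobd y)) c = cobd (csum i (cscale r m)) c"
      using im omit_chains[OF c] csum_cochains[OF ic rm] c
      by (intro cobd_cong) (auto simp: csum_def cscale_def)
    then have "cobd x c \<ominus>\<^bsub>F (apex c)\<^esub> \<zero>\<^bsub>F (apex c)\<^esub> =
        cobd i c \<oplus>\<^bsub>F (apex c)\<^esub> r \<odot>\<^bsub>F (apex c)\<^esub> cobd m c"
      using cobd_cdiff[OF x dy c] cobd_csum[OF ic rm c] cobd_cscale[OF r mc c] cobd_cobd[OF y c] by simp
    then have "cobd x c = cobd i c \<oplus>\<^bsub>F (apex c)\<^esub> r \<odot>\<^bsub>F (apex c)\<^esub> cobd m c"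
      using c1 by (simp add: M.M.minus_zero_right)
    then have "r \<odot>\<^bsub>F (apex c)\<^esub> cobd m c = cobd x c \<ominus>\<^bsub>F (apex c)\<^esub> cobd i c"
      using c1 r by (simp add: a_minus_def M.M.a_ac M.M.r_neg2 M.M.r_neg)
    then have "r \<odot>\<^bsub>F (apex c)\<^esub> cobd m c \<in> ideal_span R I (F (apex c))"
      using dx c cobd_ideal_span[OF I i c] M.ideal_span_facts(5)[OF I] by simp
    then show ?thesis
      using flat[OF apex_subset[OF c]] I r c1(3) unfolding colon_flat_def by blast
  qed
  then obtain y' where y': "y' \<in> cochains"
    and my': "\<forall>c\<in>chains. cdiff m (cobd y') c \<in> ideal_span R (colon R I r) (F (apex c))"
    using ac(1) mc unfolding acyclic_mod_def by blast
  define w where "w = csum y (cscale r y')"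
  note ry' = cscale_cochains[OF r y']
  have w: "w \<in> cochains" unfolding w_def by (rule csum_cochains[OF y ry'])
  have "cdiff x (cobd w) c \<in> ideal_span R I (F (apex c))" if c: "c \<in> chains" for c
  proof -
    let ?M = "F (apex c)"
    interpret M: module R ?M by (rule chain_module) fact
    note cl = cochainsD[OF x c] cobd_closed[OF y c] cobd_closed[OF y' c] m[OF c] cochainsD[OF ic c]
    have "cdiff x (cobd w) c = x c \<ominus>\<^bsub>?M\<^esub> (cobd y c \<oplus>\<^bsub>?M\<^esub> r \<odot>\<^bsub>?M\<^esub> cobd y' c)"
      using cobd_csum[OF y ry' c] cobd_cscale[OF r y' c] by (simp add: cdiff_def w_def)
    also have "\<dots> = (x c \<ominus>\<^bsub>?M\<^esub> cobd y c) \<ominus>\<^bsub>?M\<^esub> r \<odot>\<^bsub>?M\<^esub> cobd y' c"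
      using cl r by (simp add: a_minus_def M.M.minus_add M.M.a_assoc)
    also have "\<dots> = (i c \<oplus>\<^bsub>?M\<^esub> r \<odot>\<^bsub>?M\<^esub> m c) \<ominus>\<^bsub>?M\<^esub> r \<odot>\<^bsub>?M\<^esub> cobd y' c"
      using im[OF c] by (simp add: cdiff_def)
    also have "\<dots> = i c \<oplus>\<^bsub>?M\<^esub> r \<odot>\<^bsub>?M\<^esub> (m c \<ominus>\<^bsub>?M\<^esub> cobd y' c)"
      using cl r by (simp add: a_minus_def M.smult_r_distr M.smult_r_minus M.M.a_assoc)
    also have "\<dots> \<in> ideal_span R I ?M"
    proof (rule M.ideal_span_facts(3)[OF I i[OF c]])
      show "r \<odot>\<^bsub>?M\<^esub> (m c \<ominus>\<^bsub>?M\<^esub> cobd y' c) \<in> ideal_span R I ?M"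
        using my' c by (intro M.smult_ideal_span_colon[OF I r]) (simp add: cdiff_def)
    qed
    finally show ?thesis .
  qed
  then show "\<exists>y\<in>cochains. \<forall>c\<in>chains. cdiff x (cobd y) c \<in> ideal_span R I (F (apex c))"
    using w by blast
qed

text \<open>For s outside p, multiplication by s on C / p C is injective with quotient C / (p + (s))
  C. The quotient is acyclic, so s acts bijectively on cohomology, and a class killed by s is zero.
  The chase makes this explicit: s (x - d m) is found to lie in p C, and flatness with (p : s)
  inside p removes s.\<close>

lemma acyclic_mod_prime:
  assumes p: "primeideal p R" and ac: "\<And>J. ideal J R \<Longrightarrow> p \<subset> J \<Longrightarrow> acyclic_mod J"
    and local: "\<And>x. x \<in> cochains \<Longrightarrow> (\<And>c. c \<in> chains \<Longrightarrow> cobd x c \<in> ideal_span R p (F (apex c))) \<Longrightarrow>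
      \<exists>s\<in>carrier R - p. \<exists>y\<in>cochains. \<forall>c\<in>chains. cdiff (cscale s x) (cobd y) c \<in> ideal_span R p (F (apex c))"
  shows "acyclic_mod p"
  unfolding acyclic_mod_def
proof (intro ballI impI)
  interpret p: primeideal p R by fact
  fix x assume x: "x \<in> cochains" and dx: "\<forall>c\<in>chains. cobd x c \<in> ideal_span R p (F (apex c))"
  obtain s y where s: "s \<in> carrier R" "s \<notin> p" and y: "y \<in> cochains"
    and xy: "\<And>c. c \<in> chains \<Longrightarrow> cdiff (cscale s x) (cobd y) c \<in> ideal_span R p (F (apex c))"
    using local[OF x] dx by blast
  note P = cgenideal_ideal[OF s(1)] and J = ideal_add_PIdl_strict[OF p.is_ideal s]
  note sx = cscale_cochains[OF s(1) x]
  \<comment> \<open>Modulo p the coboundary of y is s x, so modulo the larger ideal p + (s) the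
    cochain y is a cocycle, and acyclicity there applies to it.\<close>
  have "cobd y c \<in> ideal_span R (p <+> PIdl s) (F (apex c))" if c: "c \<in> chains" for c
  proof -
    let ?M = "F (apex c)"
    interpret M: module R ?M by (rule chain_module) fact
    have "s \<odot>\<^bsub>?M\<^esub> x c \<in> ideal_span R (p <+> PIdl s) ?M"
      using J(1,3) cochainsD[OF x c] ideal.Icarr[OF J(1)] by (intro M.smult_in_ideal_span) auto
    moreover have "cdiff (cscale s x) (cobd y) c \<in> ideal_span R (p <+> PIdl s) ?M"
      using xy[OF c] M.ideal_span_mono[of p "p <+> PIdl s"] J(2) by blast
    ultimately have "s \<odot>\<^bsub>?M\<^esub> x c \<ominus>\<^bsub>?M\<^esub> cdiff (cscale s x) (cobd y) c \<in> ideal_span R (p <+> PIdl s) ?M"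
      by (intro M.ideal_span_facts(5)[OF J(1)])
    moreover have "s \<odot>\<^bsub>?M\<^esub> x c \<ominus>\<^bsub>?M\<^esub> cdiff (cscale s x) (cobd y) c = cobd y c"
      using s cochainsD[OF x c] cobd_closed[OF y c]
      by (simp add: cdiff_def cscale_def a_minus_def M.M.minus_add M.M.r_neg2 M.M.a_assoc[symmetric] M.M.r_neg)
    ultimately show ?thesis by simp
  qed
  then obtain w where w: "w \<in> cochains"
    and yw: "\<And>c. c \<in> chains \<Longrightarrow> cdiff y (cobd w) c \<in> ideal_span R (p <+> PIdl s) (F (apex c))"
    using ac[OF J(1,2)] y unfolding acyclic_mod_def by blast
  have "\<exists>i m. i \<in> ideal_span R p (F (apex c)) \<and> m \<in> carrier (F (apex c)) \<and>
      cdiff y (cobd w) c = i \<oplus>\<^bsub>F (apex c)\<^esub> s \<odot>\<^bsub>F (apex c)\<^esub> m" if c: "c \<in> chains" for c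
  proof -
    interpret M: module R "F (apex c)" by (rule chain_module) fact
    obtain i z where iz: "i \<in> ideal_span R p (F (apex c))" "z \<in> ideal_span R (PIdl s) (F (apex c))"
        "cdiff y (cobd w) c = i \<oplus>\<^bsub>F (apex c)\<^esub> z"
      using M.ideal_span_add_ideals[OF p.is_ideal P] yw[OF c] by metis
    obtain m where "m \<in> carrier (F (apex c))" "z = s \<odot>\<^bsub>F (apex c)\<^esub> m"
      using M.ideal_span_PIdl[OF s(1) iz(2)] by metis
    then show ?thesis using iz by blast
  qed
  then obtain i m where i: "\<And>c. c \<in> chains \<Longrightarrow> i c \<in> ideal_span R p (F (apex c))"
    and m: "\<And>c. c \<in> chains \<Longrightarrow> m c \<in> carrier (F (apex c))"
    and im: "\<And>c. c \<in> chains \<Longrightarrow> cdiff y (cobd w) c = i c \<oplus>\<^bsub>F (apex c)\<^esub> s \<odot>\<^bsub>F (apex c)\<^esub> m c"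
    by metis
  have mc: "m \<in> cochains" using m by (simp add: cochains_def)
  have ic: "i \<in> cochains"
    using i module.ideal_span_closed[OF chain_module p.a_subset] by (auto simp: cochains_def)
  note sm = cscale_cochains[OF s(1) mc] and dw = cobd_cochains[OF w]
  have "cdiff x (cobd m) c \<in> ideal_span R p (F (apex c))" if c: "c \<in> chains" for c
  proof -
    let ?M = "F (apex c)"
    interpret M: module R ?M by (rule chain_module) fact
    note cl = cochainsD[OF x c] cobd_closed[OF y c] cobd_closed[OF mc c] cobd_closed[OF ic c]
    have "cobd (cdiff y (cobd w)) c = cobd (csum i (cscale s m)) c"
      using im omit_chains[OF c] csum_cochains[OF ic sm] c
      by (intro cobd_cong) (auto simp: csum_def cscale_def)
    then have dy: "cobd y c = cobd i c \<oplus>\<^bsub>?M\<^esub> s \<odot>\<^bsub>?M\<^esub> cobd m c"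
      using cobd_cdiff[OF y dw c] cobd_csum[OF ic sm c] cobd_cscale[OF s(1) mc c] cobd_cobd[OF w c] cl
      by (simp add: M.M.minus_zero_right)
    have "s \<odot>\<^bsub>?M\<^esub> (x c \<ominus>\<^bsub>?M\<^esub> cobd m c) = s \<odot>\<^bsub>?M\<^esub> x c \<ominus>\<^bsub>?M\<^esub> s \<odot>\<^bsub>?M\<^esub> cobd m c"
      using cl s by (simp add: a_minus_def M.smult_r_distr M.smult_r_minus)
    also have "\<dots> = (s \<odot>\<^bsub>?M\<^esub> x c \<ominus>\<^bsub>?M\<^esub> cobd y c) \<oplus>\<^bsub>?M\<^esub> (cobd y c \<ominus>\<^bsub>?M\<^esub> s \<odot>\<^bsub>?M\<^esub> cobd m c)"
      using cl s by (intro M.minus_trans) auto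
    also have "cobd y c \<ominus>\<^bsub>?M\<^esub> s \<odot>\<^bsub>?M\<^esub> cobd m c = cobd i c"
      unfolding dy using cl s by (simp add: a_minus_def M.M.a_assoc M.M.r_neg)
    also have "(s \<odot>\<^bsub>?M\<^esub> x c \<ominus>\<^bsub>?M\<^esub> cobd y c) \<oplus>\<^bsub>?M\<^esub> cobd i c \<in> ideal_span R p ?M"
      using xy[OF c] cobd_ideal_span[OF p.is_ideal i c]
      by (intro M.ideal_span_facts(3)[OF p.is_ideal]) (simp_all add: cdiff_def cscale_def)
    finally have "x c \<ominus>\<^bsub>?M\<^esub> cobd m c \<in> ideal_span R (colon R p s) ?M"
      using flat[OF apex_subset[OF c]] p.is_ideal s(1) cl unfolding colon_flat_def by simp
    moreover have "colon R p s \<subseteq> p" using p.I_prime s by (auto simp: colon_def)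
    ultimately show ?thesis
      using M.ideal_span_mono unfolding cdiff_def by blast
  qed
  then show "\<exists>y\<in>cochains. \<forall>c\<in>chains. cdiff x (cobd y) c \<in> ideal_span R p (F (apex c))"
    using mc by blast
qed

text \<open>If I is neither R nor prime, there are a and b outside I with a b in I. Then b lies in
  (I : a) and a in I + (a), so both ideals are strictly larger than I. This recursion takes the
  place of a prime filtration of R / I.\<close>

lemma acyclic_mod_all:
  assumes local: "\<And>p x. primeideal p R \<Longrightarrow> x \<in> cochains \<Longrightarrow>
      (\<And>c. c \<in> chains \<Longrightarrow> cobd x c \<in> ideal_span R p (F (apex c))) \<Longrightarrow>
      \<exists>s\<in>carrier R - p. \<exists>y\<in>cochains. \<forall>c\<in>chains. cdiff (cscale s x) (cobd y) c \<in> ideal_span R p (F (apex c))"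
    and "ideal I R"
  shows "acyclic_mod I"
  using \<open>ideal I R\<close>
proof (induct rule: noetherian_induct)
  case (larger I)
  interpret I: ideal I R by (rule larger(1))
  consider "I = carrier R" | "primeideal I R"
    | a b where "a \<in> carrier R" "b \<in> carrier R" "a \<otimes> b \<in> I" "a \<notin> I" "b \<notin> I"
  proof (cases "\<exists>a\<in>carrier R. \<exists>b\<in>carrier R. a \<otimes> b \<in> I \<and> a \<notin> I \<and> b \<notin> I")
    case False
    have "primeideal I R" if "carrier R \<noteq> I"
      by (rule primeidealI[OF larger(1) is_cring that]) (use False in blast)
    then show ?thesis by (cases "carrier R = I") (simp_all add: that(1,2))
  next
    case True
    then show ?thesis by (elim bexE conjE) (rule that(3))
  qed
  then show ?case
  proof cases
    case 1
    show ?thesis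
      unfolding acyclic_mod_def
    proof (intro ballI impI)
      fix x assume x: "x \<in> cochains"
      define y where "y c = \<zero>\<^bsub>F (apex c)\<^esub>" for c
      have y: "y \<in> cochains"
        using module.smult_r_null module.axioms(2)[OF chain_module]
        by (auto simp: cochains_def y_def intro: abelian_monoid.zero_closed[OF abelian_group.axioms(1)])
      have "m \<in> ideal_span R I (F (apex c))" if "c \<in> chains" "m \<in> carrier (F (apex c))" for c m
      proof -
        interpret M: module R "F (apex c)" by (rule chain_module) fact
        show ?thesis using M.smult_in_ideal_span[of I \<one> m] that 1 by simp
      qed
      then show "\<exists>y\<in>cochains. \<forall>c\<in>chains. cdiff x (cobd y) c \<in> ideal_span R I (F (apex c))"
        using y cochainsD[OF cdiff_cochains[OF x cobd_cochains[OF y]]] by blast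
    qed
  next
    case 2
    show ?thesis
      by (rule acyclic_mod_prime[OF 2]) (erule larger(2), assumption, rule local[OF 2])
  next
    case (3 a b)
    show ?thesis
    proof (rule acyclic_mod_extension[OF larger(1) 3(1)])
      show "acyclic_mod (colon R I a)"
        using 3 subset_colon[OF larger(1) 3(1)] colon_ideal[OF larger(1) 3(1)]
        by (intro larger(2)) (auto simp: colon_def)
      show "acyclic_mod (I <+> PIdl a)"
        using ideal_add_PIdl_strict[OF larger(1) 3(1,4)] by (intro larger(2))
    qed
  qed
qed

end

section \<open>Contracting the complex in one direction of the cube\<close>

text \<open>The kernel of M -> (M / p M) localized at p. Working modulo this submodule of M spares
  the construction of the localized quotient, at the cost of denominators outside p.\<close>

definition negligible :: "('a, 'b) ring_scheme \<Rightarrow> 'a set \<Rightarrow> ('a, 'x, 'm) module_scheme \<Rightarrow> 'x set"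
  where "negligible R p M = {m \<in> carrier M. \<exists>s\<in>carrier R - p. s \<odot>\<^bsub>M\<^esub> m \<in> ideal_span R p M}"

lemma (in primeideal) one_compl: "\<one> \<in> carrier R - I"
  using I_notcarr one_imp_carrier by auto

lemma (in primeideal) mult_compl: "s \<in> carrier R - I \<Longrightarrow> t \<in> carrier R - I \<Longrightarrow> s \<otimes> t \<in> carrier R - I"
  using I_prime by blast

lemma (in primeideal) common_denominator:
  assumes "finite C" "\<And>c. c \<in> C \<Longrightarrow> \<exists>s\<in>carrier R - I. P c s"
    and "\<And>c s r. c \<in> C \<Longrightarrow> s \<in> carrier R - I \<Longrightarrow> r \<in> carrier R - I \<Longrightarrow> P c s \<Longrightarrow> P c (r \<otimes> s)"
  shows "\<exists>s\<in>carrier R - I. \<forall>c\<in>C. P c s"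
  using assms
proof (induct C)
  case empty
  then show ?case using one_compl by blast
next
  case (insert c C)
  have "\<exists>s\<in>carrier R - I. \<forall>c\<in>C. P c s"
    by (rule insert(3); (rule insert(4))?; (rule insert(5))?; simp)
  then obtain s where s: "s \<in> carrier R - I" "\<forall>c\<in>C. P c s" by blast
  from insert(4)[of c] obtain t where t: "t \<in> carrier R - I" "P c t" by blast
  have "P c (s \<otimes> t)" using insert(5)[of c t s] s(1) t by blast
  moreover have "P c' (s \<otimes> t)" if "c' \<in> C" for c'
    using insert(5)[of c' s t] s t(1) that by (auto simp: m_comm)
  ultimately show ?case using mult_compl[OF s(1) t(1)] by blast
qed

lemma (in module) negligible_submodule:
  assumes "primeideal p R"
  shows "submodule (negligible R p M) R M"
proof -
  interpret p: primeideal p R by fact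
  note S = ideal_span_facts[OF p.is_ideal]
  have smult: "a \<odot>\<^bsub>M\<^esub> x \<in> negligible R p M" if a: "a \<in> carrier R" and x: "x \<in> negligible R p M" for a x
  proof -
    from x obtain s where s: "s \<in> carrier R - p" "s \<odot>\<^bsub>M\<^esub> x \<in> ideal_span R p M" "x \<in> carrier M"
      unfolding negligible_def by blast
    have "s \<odot>\<^bsub>M\<^esub> (a \<odot>\<^bsub>M\<^esub> x) = a \<odot>\<^bsub>M\<^esub> (s \<odot>\<^bsub>M\<^esub> x)"
      using s a by (simp add: smult_assoc1[symmetric] R.m_comm)
    then have "s \<odot>\<^bsub>M\<^esub> (a \<odot>\<^bsub>M\<^esub> x) \<in> ideal_span R p M" using S(6)[OF a s(2)] by simp
    then show ?thesis using s(1,3) a unfolding negligible_def by blast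
  qed
  show ?thesis
  proof (rule submoduleI)
    show "\<zero>\<^bsub>M\<^esub> \<in> negligible R p M"
      unfolding negligible_def using p.one_compl S(2) by force
    fix x assume x: "x \<in> negligible R p M"
    then have "\<ominus>\<^bsub>M\<^esub> x = (\<ominus> \<one>) \<odot>\<^bsub>M\<^esub> x" by (simp add: negligible_def smult_l_minus)
    then show "\<ominus>\<^bsub>M\<^esub> x \<in> negligible R p M" using smult[OF _ x, of "\<ominus> \<one>"] by simp
    fix y assume y: "y \<in> negligible R p M"
    obtain s where s: "s \<in> carrier R - p" "s \<odot>\<^bsub>M\<^esub> x \<in> ideal_span R p M" "x \<in> carrier M"
      using x unfolding negligible_def by blast
    obtain t where t: "t \<in> carrier R - p" "t \<odot>\<^bsub>M\<^esub> y \<in> ideal_span R p M" "y \<in> carrier M"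
      using y unfolding negligible_def by blast
    have "(s \<otimes> t) \<odot>\<^bsub>M\<^esub> (x \<oplus>\<^bsub>M\<^esub> y) = t \<odot>\<^bsub>M\<^esub> (s \<odot>\<^bsub>M\<^esub> x) \<oplus>\<^bsub>M\<^esub> s \<odot>\<^bsub>M\<^esub> (t \<odot>\<^bsub>M\<^esub> y)"
      using s t by (simp add: smult_r_distr smult_assoc1[symmetric] R.m_comm)
    also have "\<dots> \<in> ideal_span R p M" using s t S(3,6) by simp
    finally show "x \<oplus>\<^bsub>M\<^esub> y \<in> negligible R p M"
      unfolding negligible_def using p.mult_compl[OF s(1) t(1)] s(3) t(3) by auto
  next
    show "negligible R p M \<subseteq> carrier M" by (auto simp: negligible_def)
    show "\<And>a x. a \<in> carrier R \<Longrightarrow> x \<in> negligible R p M \<Longrightarrow> a \<odot>\<^bsub>M\<^esub> x \<in> negligible R p M"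
      by (rule smult)
  qed
qed

lemma (in module) ideal_span_negligible:
  assumes "primeideal p R" "x \<in> ideal_span R p M"
  shows "x \<in> negligible R p M"
proof -
  interpret p: primeideal p R by fact
  have "x \<in> carrier M" using ideal_span_closed[OF p.a_subset assms(2)] .
  then show ?thesis
    unfolding negligible_def using p.one_compl assms(2) by (auto intro!: bexI[of _ \<one>])
qed

lemma negligible_hom:
  assumes "primeideal p R" "module R M" "module R N" "f \<in> module_hom R M N" "x \<in> negligible R p M"
  shows "f x \<in> negligible R p N"
proof -
  interpret p: primeideal p R by fact
  from assms(5) obtain s where s: "s \<in> carrier R - p" "s \<odot>\<^bsub>M\<^esub> x \<in> ideal_span R p M" "x \<in> carrier M"
    unfolding negligible_def by blast
  have "f (s \<odot>\<^bsub>M\<^esub> x) \<in> ideal_span R p N"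
    by (rule ideal_span_hom[OF assms(4,2,3) p.a_subset s(2)])
  moreover have "f (s \<odot>\<^bsub>M\<^esub> x) = s \<odot>\<^bsub>N\<^esub> f x"
    using s module_hom_smult[OF assms(4)] by simp
  ultimately show ?thesis
    unfolding negligible_def using s module_hom_closed[OF assms(4)] by auto
qed

lemma apex_Cons_Cons [simp]: "apex (C # D # b) = apex (D # b)"
  by (simp add: apex_def)

text \<open>\<open>inj\<close> and \<open>surj\<close> say on representatives that each map
  inserting d becomes bijective after reduction modulo p and localization at p. The factor s in
  \<open>surj\<close> clears the denominator of a preimage.\<close>

locale contractible_direction = cube_diagram R E F \<phi>
  for R :: "('a, 'b) ring_scheme" (structure) and E :: "'i set"
    and F :: "'i set \<Rightarrow> ('a, 'x) module" and \<phi> +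
  fixes p :: "'a set" and d :: 'i
  assumes prime: "primeideal p R" and d: "d \<in> E"
    and inj: "\<And>D m. D \<subseteq> E - {d} \<Longrightarrow> m \<in> carrier (F D) \<Longrightarrow>
      \<phi> D (insert d D) m \<in> negligible R p (F (insert d D)) \<Longrightarrow> m \<in> negligible R p (F D)"
    and surj: "\<And>D y. D \<subseteq> E - {d} \<Longrightarrow> y \<in> carrier (F (insert d D)) \<Longrightarrow>
      \<exists>s\<in>carrier R - p. \<exists>m\<in>carrier (F D).
        mod_cong (F (insert d D)) (negligible R p (F (insert d D))) (s \<odot>\<^bsub>F (insert d D)\<^esub> y) (\<phi> D (insert d D) m)"
begin

sublocale p: primeideal p R by (rule prime)

abbreviation N where "N c \<equiv> negligible R p (F (apex c))"

lemma N_submodule: "c \<in> chains \<Longrightarrow> submodule (N c) R (F (apex c))"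
  by (rule module.negligible_submodule[OF chain_module prime])

text \<open>Containing d is inherited by larger sets, so a chain splits into an initial part without
  d and a final part with d. The vertex toggled between the two parts is \<open>top a\<close>, which
  is the set with sole element d when the initial part is empty. This is a discrete Morse matching
  of the chains.\<close>

definition lower :: "'i set list \<Rightarrow> bool" where "lower a \<longleftrightarrow> (\<forall>D\<in>set a. d \<notin> D)"
definition upper :: "'i set list \<Rightarrow> bool" where "upper b \<longleftrightarrow> (\<forall>D\<in>set b. d \<in> D)"
definition top :: "'i set list \<Rightarrow> 'i set" where "top a = insert d (apex a)"

text \<open>The chains \<open>a @ b\<close> with \<open>free a b\<close> are matched with the chains \<open>a @ top a # b\<close>; together these
  are all chains.\<close>

definition free :: "'i set list \<Rightarrow> 'i set list \<Rightarrow> bool"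
  where "free a b \<longleftrightarrow> a @ b \<in> chains \<and> lower a \<and> upper b \<and> \<not> (b \<noteq> [] \<and> hd b = top a)"

lemma append_chains: "a @ b \<in> chains \<Longrightarrow> a \<in> chains" "a @ b \<in> chains \<Longrightarrow> b \<in> chains"
  by (auto simp: chains_def sorted_wrt_append)

lemma lower_apex: "lower a \<Longrightarrow> d \<notin> apex a"
  by (auto simp: lower_def apex_def)

lemma apex_le: "a @ b \<in> chains \<Longrightarrow> D \<in> set b \<Longrightarrow> apex a \<subset> D"
  by (cases a rule: rev_cases) (auto simp: chains_def sorted_wrt_append apex_def)

text \<open>The vertex \<open>top a\<close> lies strictly above a because d is new. It lies strictly
  below b because the first vertex of b contains both \<open>apex a\<close> and d, equality being
  excluded by \<open>free\<close>.\<close>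

lemma ins_chains:
  assumes "free a b"
  shows "a @ top a # b \<in> chains"
proof -
  have ab: "a @ b \<in> chains" "lower a" "upper b" "b \<noteq> [] \<Longrightarrow> hd b \<noteq> top a"
    using assms by (auto simp: free_def)
  have below: "D \<subset> top a" if "D \<in> set a" for D
  proof -
    have "D \<subseteq> apex a"
      using that append_chains(1)[OF ab(1)] sorted_wrt_less_le_last[of a D]
      by (auto simp: chains_def apex_def)
    then show ?thesis using lower_apex[OF ab(2)] unfolding top_def by blast
  qed
  have above: "top a \<subset> D" if D: "D \<in> set b" for D
  proof -
    from D have b: "b \<noteq> []" by auto
    then have h: "hd b \<in> set b" by simp
    have "hd b \<subseteq> D"
      using D append_chains(2)[OF ab(1)] by (cases b) (auto simp: chains_def)
    moreover have "top a \<subseteq> hd b"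
      using apex_le[OF ab(1) h] ab(3) h unfolding top_def upper_def by blast
    ultimately show ?thesis using ab(4)[OF b] by blast
  qed
  have "top a \<subseteq> E" using apex_subset[OF append_chains(1)[OF ab(1)]] d by (simp add: top_def)
  moreover have "top a \<noteq> {}" by (simp add: top_def)
  ultimately show ?thesis
    using ab(1) below above by (auto simp: chains_def sorted_wrt_append)
qed

lemma freeI:
  assumes "a @ top a # b \<in> chains" "lower a" "upper b"
  shows "free a b"
proof -
  have "a @ b \<in> chains" using omit_chains[OF assms(1), of "length a"] by (simp add: omit_def)
  moreover have "hd b \<noteq> top a" if "b \<noteq> []"
    using assms(1) that by (cases b) (auto simp: chains_def sorted_wrt_append)
  ultimately show ?thesis using assms by (auto simp: free_def)
qed

text \<open>Omitting D from the inserted chain over \<open>(a @ [D]) @ b\<close> yields another free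
  chain, whose lower part is shorter by one vertex. This drives the recursion for the homotopy and
  the final induction. It is free because \<open>apex a\<close> is strictly below D, so the tops
  over a and over \<open>a @ [D]\<close> differ.\<close>

lemma free_step:
  assumes "free (a @ [D]) b"
  shows "free a (top (a @ [D]) # b)"
proof -
  have ch: "a @ D # top (a @ [D]) # b \<in> chains" using ins_chains[OF assms] by simp
  have "a @ top (a @ [D]) # b \<in> chains"
    using omit_chains[OF ch, of "length a"] by (simp add: omit_def)
  moreover have "lower a" "lower (a @ [D])" "upper (top (a @ [D]) # b)"
    using assms by (auto simp: free_def lower_def upper_def top_def)
  moreover have "top (a @ [D]) \<noteq> top a"
  proof -
    have "apex a \<subset> D" using apex_le[OF ch, of D] by simp
    moreover have "d \<notin> apex a" "d \<notin> D"
      using lower_apex[OF \<open>lower a\<close>] lower_apex[OF \<open>lower (a @ [D])\<close>] by simp_all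
    ultimately show ?thesis unfolding top_def apex_single apex_append_Cons by (auto simp: insert_ident)
  qed
  ultimately show ?thesis by (simp add: free_def)
qed

lemma split_lower_upper:
  "sorted_wrt (\<subset>) c \<Longrightarrow> lower (takeWhile (\<lambda>D. d \<notin> D) c) \<and> upper (dropWhile (\<lambda>D. d \<notin> D) c)"
proof (induct c)
  case (Cons D c)
  show ?case
  proof (cases "d \<in> D")
    case True
    have "d \<in> D'" if "D' \<in> set c" for D'
    proof -
      have "D \<subset> D'" using Cons(2) that by simp
      then show ?thesis using True by blast
    qed
    then show ?thesis using True by (simp add: lower_def upper_def)
  next
    case False
    then show ?thesis using Cons by (simp add: lower_def)
  qed
qed (simp add: lower_def upper_def)

lemma takeWhile_lower: "lower a \<Longrightarrow> upper b \<Longrightarrow> takeWhile (\<lambda>D. d \<notin> D) (a @ b) = a"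
  and dropWhile_lower: "lower a \<Longrightarrow> upper b \<Longrightarrow> dropWhile (\<lambda>D. d \<notin> D) (a @ b) = b"
proof -
  assume "lower a" "upper b"
  moreover have "takeWhile (\<lambda>D. d \<notin> D) b = [] \<and> dropWhile (\<lambda>D. d \<notin> D) b = b" if "upper b"
    using that by (cases b) (auto simp: upper_def)
  ultimately show "takeWhile (\<lambda>D. d \<notin> D) (a @ b) = a" "dropWhile (\<lambda>D. d \<notin> D) (a @ b) = b"
    by (induct a) (simp_all add: lower_def)
qed

lemma chain_cases:
  assumes "c \<in> chains"
  obtains a b where "free a b" "c = a @ b" | a b where "free a b" "c = a @ top a # b"
proof -
  define a where "a = takeWhile (\<lambda>D. d \<notin> D) c"
  define b where "b = dropWhile (\<lambda>D. d \<notin> D) c"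
  have ab: "lower a" "upper b" "c = a @ b"
    using split_lower_upper[of c] assms unfolding a_def b_def by (auto simp: chains_def)
  show ?thesis
  proof (cases "b \<noteq> [] \<and> hd b = top a")
    case True
    then obtain b' where b': "b = top a # b'" by (cases b) auto
    have "free a b'" using ab assms b' by (intro freeI) (auto simp: upper_def)
    then show ?thesis using that(2) ab(3) b' by blast
  next
    case False
    then have "free a b" using ab assms by (auto simp: free_def)
    then show ?thesis using that(1) ab(3) by blast
  qed
qed

text \<open>If b is nonempty, inserting \<open>top a\<close> leaves the apex unchanged and the
  transition map is an identity. If b is empty, it is a map inserting d, to which the assumption of
  the locale applies. The same alternative governs surjectivity below.\<close>

lemma matched_inj:
  assumes ab: "free a b" and m: "m \<in> carrier (F (apex (a @ b)))"
    and n: "\<phi> (apex (a @ b)) (apex (a @ top a # b)) m \<in> N (a @ top a # b)"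
  shows "m \<in> N (a @ b)"
proof (cases "b = []")
  case True
  have "a @ b \<in> chains" "d \<notin> apex a" using ab lower_apex by (auto simp: free_def)
  then have "apex a \<subseteq> E - {d}" using apex_subset True by auto
  then show ?thesis using inj[of "apex a" m] m n True by (simp add: top_def)
next
  case False
  then obtain B b' where b: "b = B # b'" by (cases b) auto
  have "apex (a @ b) \<subseteq> E" using ab apex_subset unfolding free_def by blast
  then show ?thesis using m n b phi_id by simp
qed

lemma matched_surj:
  assumes ab: "free a b" and y: "y \<in> carrier (F (apex (a @ top a # b)))"
  shows "\<exists>s\<in>carrier R - p. \<exists>m\<in>carrier (F (apex (a @ b))). mod_cong (F (apex (a @ top a # b))) (N (a @ top a # b))
      (s \<odot>\<^bsub>F (apex (a @ top a # b))\<^esub> y) (\<phi> (apex (a @ b)) (apex (a @ top a # b)) m)"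
proof (cases "b = []")
  case True
  have "a @ b \<in> chains" "d \<notin> apex a" using ab lower_apex by (auto simp: free_def)
  then have "apex a \<subseteq> E - {d}" using apex_subset True by auto
  then show ?thesis using surj[of "apex a" y] y True by (simp add: top_def)
next
  case False
  then obtain B b' where b: "b = B # b'" by (cases b) auto
  have E: "apex (a @ b) \<subseteq> E" using ab apex_subset unfolding free_def by blast
  interpret M: module R "F (apex (a @ top a # b))" by (rule chain_module[OF ins_chains[OF ab]])
  have "mod_cong (F (apex (a @ top a # b))) (N (a @ top a # b)) y y"
    by (rule M.mod_cong_refl[OF N_submodule[OF ins_chains[OF ab]] y])
  then show ?thesis
    using y b phi_id[OF E, of y] p.one_compl M.smult_one[OF y] by (intro bexI[of _ \<one>] bexI[of _ y]) auto
qed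

text \<open>Omitting a vertex of b, or any vertex of a but its last, gives another inserted chain,
  where w is negligible. There remain the face omitting \<open>top a\<close> and, when a is
  nonempty, the face omitting the last vertex of a, for which the toggled vertex is no longer the
  top of what precedes it.\<close>

lemma cobd_matched:
  assumes w: "w \<in> cochains" and wN: "\<And>a b. free a b \<Longrightarrow> w (a @ top a # b) \<in> N (a @ top a # b)"
    and ab: "free a b"
  shows "mod_cong (F (apex (a @ top a # b))) (N (a @ top a # b)) (cobd w (a @ top a # b))
    (finsum (F (apex (a @ top a # b))) (\<lambda>i. signed (F (apex (a @ top a # b))) i (face w (a @ top a # b) i))
      {i. i = length a \<or> Suc i = length a})"
proof -
  let ?c = "a @ top a # b"
  note c = ins_chains[OF ab]
  interpret M: module R "F (apex ?c)" by (rule chain_module[OF c])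
  show ?thesis
    unfolding cobd_def
  proof (rule M.mod_cong_finsum_subset[OF N_submodule[OF c]])
    fix i assume i: "i \<in> {..<length ?c} - {i. i = length a \<or> Suc i = length a}"
    have low: "lower a" "upper b" using ab by (auto simp: free_def)
    have oc: "omit i ?c \<in> chains" by (rule omit_chains[OF c])
    have "\<exists>a' b'. free a' b' \<and> omit i ?c = a' @ top a' # b'"
    proof (cases "i < length a")
      case True
      then have eq: "omit i ?c = omit i a @ top (omit i a) # b"
        using i by (simp add: omit_append_left top_def apex_omit)
      moreover have "free (omit i a) b"
        using oc low set_omit[of i a] unfolding eq by (intro freeI) (auto simp: lower_def)
      ultimately show ?thesis by blast
    next
      case False
      with i obtain j where j: "i = length a + Suc j"
      proof -
        have "length a < i" using False i by auto
        then show thesis using that[of "i - length a - 1"] by simp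
      qed
      have eq: "omit i ?c = a @ top a # omit j b"
        unfolding j omit_append_right by (simp add: omit_def)
      moreover have "free a (omit j b)"
        using oc low set_omit[of j b] unfolding eq by (intro freeI) (auto simp: upper_def)
      ultimately show ?thesis by blast
    qed
    then have "w (omit i ?c) \<in> N (omit i ?c)" using wN by auto
    then have "face w ?c i \<in> N ?c"
      unfolding face_def
      by (rule negligible_hom[OF prime chain_module[OF oc] chain_module[OF c] face_hom[OF c]])
    then show "signed (F (apex ?c)) i (face w ?c i) \<in> N ?c"
      by (rule M.signed_submodule[OF N_submodule[OF c]])
  qed (auto simp del: apex_append_Cons intro: signed_face_closed[OF w c])
qed

lemma face_matched: "face w (a @ top a # b) (length a) = \<phi> (apex (a @ b)) (apex (a @ top a # b)) (w (a @ b))"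
  by (simp add: face_def omit_def)

lemma face_matched_snoc:
  assumes "free (a @ [D]) b" "w \<in> cochains"
  shows "face w ((a @ [D]) @ top (a @ [D]) # b) (length a) = w (a @ top (a @ [D]) # b)"
proof -
  have ch: "a @ top (a @ [D]) # b \<in> chains"
    using free_step[OF assms(1)] by (simp add: free_def)
  then show ?thesis
    using phi_id[OF apex_subset[OF ch] cochainsD[OF assms(2) ch]] by (simp add: face_def omit_def)
qed

lemma cobd_matched_Nil:
  assumes "w \<in> cochains" "\<And>a b. free a b \<Longrightarrow> w (a @ top a # b) \<in> N (a @ top a # b)" "free [] b"
  shows "mod_cong (F (apex (top [] # b))) (N (top [] # b)) (cobd w (top [] # b))
    (\<phi> (apex b) (apex (top [] # b)) (w b))"
proof -
  have c: "top [] # b \<in> chains"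
    using ins_chains[OF assms(3)] by (simp only: append_Nil)
  interpret M: module R "F (apex (top [] # b))" by (rule chain_module[OF c])
  have "face w (top [] # b) 0 \<in> carrier (F (apex (top [] # b)))"
    by (rule face_closed[OF assms(1) c])
  then show ?thesis
    using cobd_matched[OF assms] face_matched[of w "[]" b] M.M.finsum_insert[of "{}" 0]
    by (simp add: signed_def)
qed

lemma cobd_matched_snoc:
  assumes "w \<in> cochains" "\<And>a b. free a b \<Longrightarrow> w (a @ top a # b) \<in> N (a @ top a # b)"
    and "free (a @ [D]) b" and c: "c = (a @ [D]) @ top (a @ [D]) # b"
  shows "mod_cong (F (apex c)) (N c) (cobd w c)
    (signed (F (apex c)) (length a) (w (a @ top (a @ [D]) # b)) \<oplus>\<^bsub>F (apex c)\<^esub>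
     signed (F (apex c)) (Suc (length a)) (\<phi> (apex ((a @ [D]) @ b)) (apex c) (w ((a @ [D]) @ b))))"
proof -
  have cc: "c \<in> chains" unfolding c by (rule ins_chains[OF assms(3)])
  interpret M: module R "F (apex c)" using chain_module[OF cc] by simp
  have set: "{i. i = length (a @ [D]) \<or> Suc i = length (a @ [D])} = {length a, Suc (length a)}" by auto
  have "(\<Oplus>\<^bsub>F (apex c)\<^esub>i\<in>{length a, Suc (length a)}. signed (F (apex c)) i (face w c i)) =
      signed (F (apex c)) (length a) (face w c (length a)) \<oplus>\<^bsub>F (apex c)\<^esub>
      signed (F (apex c)) (Suc (length a)) (face w c (Suc (length a)))"
    using signed_face_closed[OF assms(1) cc] by (subst M.M.finsum_insert) auto
  then show ?thesis
    using cobd_matched[OF assms(1-3), folded c] face_matched[of w "a @ [D]" b, folded c]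
      face_matched_snoc[OF assms(3,1), folded c]
    unfolding set by simp
qed

text \<open>The value \<open>target x (rev a) b\<close> is what the homotopy must take on \<open>a @ b\<close>, up to the (in general
  not invertible) transition map.\<close>

primrec target :: "('i set list \<Rightarrow> 'x) \<Rightarrow> 'i set list \<Rightarrow> 'i set list \<Rightarrow> 'x"
  where
    "target x [] b = x (top [] # b)"
  | "target x (D # a) b =
      signed (F (apex (insert d D # b))) (Suc (length a)) (x (rev a @ D # insert d D # b))
      \<oplus>\<^bsub>F (apex (insert d D # b))\<^esub> target x a (insert d D # b)"

lemma top_snoc: "top (a @ [D]) = insert d D"
  by (simp add: top_def)

lemma target_closed:
  assumes "x \<in> cochains"
  shows "free a b \<Longrightarrow> target x (rev a) b \<in> carrier (F (apex (a @ top a # b)))"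
proof (induct a arbitrary: b rule: rev_induct)
  case Nil
  then show ?case using cochainsD[OF assms ins_chains[OF Nil]] by simp
next
  case (snoc D a)
  note c = ins_chains[OF snoc(2)]
  interpret M: module R "F (apex (insert d D # b))"
    using chain_module[OF c] by (simp add: top_snoc)
  show ?case
    using cochainsD[OF assms c] snoc(1)[OF free_step[OF snoc(2)]]
    by (simp add: top_snoc)
qed

text \<open>A homotopy y is prescribed on free chains and is zero on inserted ones, so that z = s x
  - d y becomes negligible on inserted chains. Since d z is negligible too, the values of z on free
  chains follow one after another along the matching. A last denominator moves z into p F at every
  chain.\<close>

lemma local_acyclic:
  assumes x: "x \<in> cochains" and dx: "\<And>c. c \<in> chains \<Longrightarrow> cobd x c \<in> ideal_span R p (F (apex c))"
  shows "\<exists>s\<in>carrier R - p. \<exists>y\<in>cochains. \<forall>c\<in>chains. cdiff (cscale s x) (cobd y) c \<in> ideal_span R p (F (apex c))"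
proof -
  \<comment> \<open>\<open>Q (a, b) s m\<close> makes m a preimage of s times \<open>target\<close>,
    up to negligible elements. Multiplying m by r turns a witness for s into one for r s, so a
    single s serves the finitely many free pairs.\<close>
  define Q where "Q ab s m \<longleftrightarrow> (case ab of (a, b) \<Rightarrow> m \<in> carrier (F (apex (a @ b))) \<and>
      mod_cong (F (apex (a @ top a # b))) (N (a @ top a # b)) (s \<odot>\<^bsub>F (apex (a @ top a # b))\<^esub> target x (rev a) b)
        (\<phi> (apex (a @ b)) (apex (a @ top a # b)) m))" for ab s m
  have "\<exists>s\<in>carrier R - p. \<forall>ab\<in>{(a, b). free a b}. \<exists>m. Q ab s m"
  proof (rule p.common_denominator)
    have "{(a, b). free a b} \<subseteq> chains \<times> chains"
      unfolding free_def using append_chains by blast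
    then show "finite {(a, b). free a b}"
      by (rule finite_subset) (simp add: finite_chains)
    show "\<exists>s\<in>carrier R - p. \<exists>m. Q ab s m" if abf: "ab \<in> {(a, b). free a b}" for ab
    proof -
      obtain a b where ab: "ab = (a, b)" "free a b" using abf by auto
      show ?thesis
        using matched_surj[OF ab(2) target_closed[OF x ab(2)]] unfolding Q_def ab(1) by blast
    qed
    fix ab s r assume *: "ab \<in> {(a, b). free a b}" "s \<in> carrier R - p" "r \<in> carrier R - p" "\<exists>m. Q ab s m"
    then obtain a b m where ab: "ab = (a, b)" "free a b" and m: "Q (a, b) s m" by auto
    let ?c = "a @ top a # b"
    have abc: "a @ b \<in> chains" using ab(2) by (simp add: free_def)
    note c = ins_chains[OF ab(2)]
    interpret M: module R "F (apex ?c)" by (rule chain_module[OF c])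
    interpret M': module R "F (apex (a @ b))" by (rule chain_module[OF abc])
    have hom: "\<phi> (apex (a @ b)) (apex ?c) \<in> module_hom R (F (apex (a @ b))) (F (apex ?c))"
      using face_hom[OF c, of "length a"] by (simp add: omit_def)
    have mc: "m \<in> carrier (F (apex (a @ b)))" using m by (simp add: Q_def)
    note t = target_closed[OF x ab(2)]
    have "(r \<otimes> s) \<odot>\<^bsub>F (apex ?c)\<^esub> target x (rev a) b \<ominus>\<^bsub>F (apex ?c)\<^esub> \<phi> (apex (a @ b)) (apex ?c) (r \<odot>\<^bsub>F (apex (a @ b))\<^esub> m)
        = r \<odot>\<^bsub>F (apex ?c)\<^esub> (s \<odot>\<^bsub>F (apex ?c)\<^esub> target x (rev a) b \<ominus>\<^bsub>F (apex ?c)\<^esub> \<phi> (apex (a @ b)) (apex ?c) m)"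
      using *(2,3) t module_hom_smult[OF hom _ mc] module_hom_closed[OF hom mc]
      by (simp del: apex_append_Cons add: M.smult_assoc1 a_minus_def M.smult_r_distr M.smult_r_minus)
    also have "\<dots> \<in> N ?c"
      using m *(3) M.submodule_facts(6)[OF N_submodule[OF c]] by (simp add: Q_def mod_cong_def)
    finally have "Q ab (r \<otimes> s) (r \<odot>\<^bsub>F (apex (a @ b))\<^esub> m)"
      using mc *(3) unfolding Q_def ab by (simp add: mod_cong_def)
    then show "\<exists>m. Q ab (r \<otimes> s) m" by blast
  qed
  then obtain s Y where s: "s \<in> carrier R - p" and Y: "\<And>a b. free a b \<Longrightarrow> Q (a, b) s (Y (a, b))"
    by (metis (mono_tags, lifting) case_prodI mem_Collect_eq)
  have sR: "s \<in> carrier R" using s by simp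
  define split where "split c = (takeWhile (\<lambda>D. d \<notin> D) c, dropWhile (\<lambda>D. d \<notin> D) c)" for c
  \<comment> \<open>The value zero on inserted chains provides the negligibility assumed in
    \<open>cobd_matched\<close>, so at an inserted chain at most two faces of y matter.\<close>
  define y where "y c = (if case_prod free (split c) then Y (split c) else \<zero>\<^bsub>F (apex c)\<^esub>)" for c
  have split: "split (a @ b) = (a, b)" if "lower a" "upper b" for a b
    using takeWhile_lower[OF that] dropWhile_lower[OF that] by (simp add: split_def)
  have y_free: "y (a @ b) = Y (a, b)" if "free a b" for a b
    using split[of a b] that by (simp add: y_def free_def)
  have y_ins: "y (a @ top a # b) = \<zero>\<^bsub>F (apex (a @ top a # b))\<^esub>" if "free a b" for a b
  proof -
    have "split (a @ top a # b) = (a, top a # b)"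
      using that by (intro split) (auto simp: free_def upper_def top_def)
    then show ?thesis by (simp add: y_def free_def)
  qed
  have y: "y \<in> cochains"
    unfolding cochains_def
  proof (intro CollectI ballI)
    fix c assume c: "c \<in> chains"
    interpret M: module R "F (apex c)" by (rule chain_module[OF c])
    from c show "y c \<in> carrier (F (apex c))"
    proof (cases rule: chain_cases)
      case (1 a b)
      then show ?thesis using Y[of a b] y_free[of a b] by (simp add: Q_def)
    next
      case (2 a b)
      then show ?thesis using y_ins[of a b] M.M.zero_closed by simp
    qed
  qed
  have yN: "y (a @ top a # b) \<in> N (a @ top a # b)" if "free a b" for a b
    unfolding y_ins[OF that]
    using module.submodule_facts(2)[OF chain_module N_submodule] ins_chains[OF that] by blast
  have approx: "mod_cong (F (apex (a @ top a # b))) (N (a @ top a # b))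
      (\<phi> (apex (a @ b)) (apex (a @ top a # b)) (y (a @ b))) (s \<odot>\<^bsub>F (apex (a @ top a # b))\<^esub> target x (rev a) b)"
    if ab: "free a b" for a b
  proof -
    note c = ins_chains[OF ab]
    interpret M: module R "F (apex (a @ top a # b))" by (rule chain_module[OF c])
    have "y (a @ b) \<in> carrier (F (apex (a @ b)))" using y ab by (simp add: cochains_def free_def)
    then have v: "\<phi> (apex (a @ b)) (apex (a @ top a # b)) (y (a @ b)) \<in> carrier (F (apex (a @ top a # b)))"
      using module_hom_closed[OF face_hom[OF c, of "length a"]] by (simp add: omit_def)
    have t: "s \<odot>\<^bsub>F (apex (a @ top a # b))\<^esub> target x (rev a) b \<in> carrier (F (apex (a @ top a # b)))"
      by (rule M.smult_closed[OF sR target_closed[OF x ab]])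
    show ?thesis
      by (rule M.mod_cong_sym[OF N_submodule[OF c] t v])
        (use Y[OF ab] in \<open>simp only: Q_def case_prod_conv y_free[OF ab]\<close>)
  qed
  define z where "z = cdiff (cscale s x) (cobd y)"
  note sx = cscale_cochains[OF sR x] and dy = cobd_cochains[OF y]
  have z: "z \<in> cochains" unfolding z_def by (rule cdiff_cochains[OF sx dy])
  \<comment> \<open>The recursion for \<open>target\<close> solves the equation
    \<open>cobd y c\<close> = s (x c) at inserted chains for the face that omits the inserted
    vertex; here the solution is substituted back.\<close>
  have z_ins: "z (a @ top a # b) \<in> N (a @ top a # b)" if ab: "free a b" for a b
  proof -
    define c where "c = a @ top a # b"
    have c: "c \<in> chains" unfolding c_def by (rule ins_chains[OF ab])
    let ?M = "F (apex c)"
    interpret M: module R ?M by (rule chain_module[OF c])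
    note sub = N_submodule[OF c] and xc = cochainsD[OF x c] and yc = cobd_closed[OF y c]
    have "mod_cong ?M (N c) (cobd y c) (s \<odot>\<^bsub>?M\<^esub> x c)"
    proof (cases a rule: rev_cases)
      case Nil
      have b: "free [] b" and bc: "b \<in> chains" using ab Nil by (simp_all add: free_def)
      have ceq: "c = top [] # b" using Nil by (simp add: c_def)
      have "apex b \<subseteq> apex c" using apex_omit_subset[OF c, of 0] by (simp add: ceq omit_def)
      then have cl: "\<phi> (apex b) (apex c) (y b) \<in> carrier ?M"
        by (rule module_hom_closed[OF phi_hom[OF _ apex_subset[OF c]] cochainsD[OF y bc]])
      have sx: "s \<odot>\<^bsub>?M\<^esub> x c \<in> carrier ?M" using sR xc by simp
      have "mod_cong ?M (N c) (\<phi> (apex b) (apex c) (y b)) (s \<odot>\<^bsub>?M\<^esub> x c)"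
        using approx[OF b] by (simp add: ceq)
      with cobd_matched_Nil[OF y yN b, folded ceq] show ?thesis
        by (rule M.mod_cong_trans[OF sub yc cl sx])
    next
      case (snoc a' D)
      have ab': "free (a' @ [D]) b" using ab snoc by simp
      note step = free_step[OF ab']
      have ceq: "c = (a' @ [D]) @ top (a' @ [D]) # b" using snoc by (simp add: c_def)
      let ?T = "target x (rev a') (top (a' @ [D]) # b)"
      let ?k = "length a'"
      have apx: "apex (a' @ top a' # top (a' @ [D]) # b) = apex c" by (simp add: ceq)
      have T: "?T \<in> carrier ?M" using target_closed[OF x step] by (simp add: apx del: apex_append_Cons)
      have ch': "a' @ top (a' @ [D]) # b \<in> chains" using step by (simp add: free_def)
      have u: "y (a' @ top (a' @ [D]) # b) \<in> carrier ?M" (is "?u \<in> _")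
        using cochainsD[OF y ch'] by (simp add: ceq)
      have v: "\<phi> (apex ((a' @ [D]) @ b)) (apex c) (y ((a' @ [D]) @ b)) \<in> carrier ?M" (is "?v \<in> _")
        using face_closed[OF y c, of "length (a' @ [D])"] face_matched[of y "a' @ [D]" b, folded ceq] by simp
      have 1: "mod_cong ?M (N c) ?u (s \<odot>\<^bsub>?M\<^esub> ?T)"
        using approx[OF step] phi_id[OF apex_subset[OF ch'] cochainsD[OF y ch']] by (simp add: ceq)
      have tgt: "target x (rev a) b = signed ?M (Suc ?k) (x c) \<oplus>\<^bsub>?M\<^esub> ?T"
        using snoc by (simp add: ceq top_snoc)
      have 2: "mod_cong ?M (N c) ?v (s \<odot>\<^bsub>?M\<^esub> (signed ?M (Suc ?k) (x c) \<oplus>\<^bsub>?M\<^esub> ?T))"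
        using approx[OF ab] unfolding tgt c_def[symmetric] by (simp add: snoc)
      have sT: "s \<odot>\<^bsub>?M\<^esub> ?T \<in> carrier ?M" "s \<odot>\<^bsub>?M\<^esub> x c \<in> carrier ?M" using T sR xc by simp_all
      \<comment> \<open>The two faces carry the signs with indices k and k + 1: the contributions of
        \<open>?T\<close> cancel, and the sign in front of x c is applied twice and
        disappears.\<close>
      have eq: "signed ?M ?k (s \<odot>\<^bsub>?M\<^esub> ?T) \<oplus>\<^bsub>?M\<^esub>
          signed ?M (Suc ?k) (s \<odot>\<^bsub>?M\<^esub> (signed ?M (Suc ?k) (x c) \<oplus>\<^bsub>?M\<^esub> ?T)) = s \<odot>\<^bsub>?M\<^esub> x c"
      proof -
        have "signed ?M (Suc ?k) (s \<odot>\<^bsub>?M\<^esub> (signed ?M (Suc ?k) (x c) \<oplus>\<^bsub>?M\<^esub> ?T)) =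
            s \<odot>\<^bsub>?M\<^esub> x c \<oplus>\<^bsub>?M\<^esub> signed ?M (Suc ?k) (s \<odot>\<^bsub>?M\<^esub> ?T)"
          using T sR xc by (simp add: signed_def M.smult_r_distr M.smult_r_minus M.M.minus_add)
        also have "signed ?M (Suc ?k) (s \<odot>\<^bsub>?M\<^esub> ?T) = \<ominus>\<^bsub>?M\<^esub> signed ?M ?k (s \<odot>\<^bsub>?M\<^esub> ?T)"
          using sT by (simp add: M.signed_Suc)
        finally show ?thesis using sT by (simp add: M.M.a_lcomm M.M.r_neg)
      qed
      have "mod_cong ?M (N c) (signed ?M ?k ?u \<oplus>\<^bsub>?M\<^esub> signed ?M (Suc ?k) ?v) (s \<odot>\<^bsub>?M\<^esub> x c)"
        unfolding eq[symmetric] using 1 2 u v T sR xc sub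
        by (intro M.mod_cong_add[OF sub] M.mod_cong_signed[OF sub]) auto
      moreover have "mod_cong ?M (N c) (cobd y c) (signed ?M ?k ?u \<oplus>\<^bsub>?M\<^esub> signed ?M (Suc ?k) ?v)"
        by (rule cobd_matched_snoc[OF y _ ab' ceq]) (rule yN)
      ultimately show ?thesis
        using M.mod_cong_trans[OF sub yc M.M.a_closed[OF M.signed_closed[OF u] M.signed_closed[OF v]] sT(2)]
        by blast
    qed
    then have "mod_cong ?M (N c) (s \<odot>\<^bsub>?M\<^esub> x c) (cobd y c)"
      by (rule M.mod_cong_sym[OF sub yc M.smult_closed[OF sR xc]])
    then show ?thesis
      unfolding z_def cdiff_def cscale_def mod_cong_def c_def .
  qed
  have dz: "cobd z c \<in> N c" if c: "c \<in> chains" for c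
  proof -
    interpret M: module R "F (apex c)" by (rule chain_module[OF c])
    have "cobd z c = s \<odot>\<^bsub>F (apex c)\<^esub> cobd x c"
      unfolding z_def using cobd_cdiff[OF sx dy c] cobd_cscale[OF sR x c] cobd_cobd[OF y c]
        cobd_closed[OF x c] sR by (simp add: M.M.minus_zero_right)
    also have "\<dots> \<in> N c"
      by (rule M.submodule_facts(6)[OF N_submodule[OF c] sR M.ideal_span_negligible[OF prime dx[OF c]]])
    finally show ?thesis .
  qed
  \<comment> \<open>Induction on the lower part. At the inserted chain over \<open>a @ b\<close> the
    coboundary of z is negligible, and so is the face covered by the induction hypothesis through
    \<open>free_step\<close>. Hence the transition map sends z on \<open>a @ b\<close> to a
    negligible element, and \<open>matched_inj\<close> applies.\<close>
  have z_free: "free a b \<Longrightarrow> z (a @ b) \<in> N (a @ b)" for a b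
  proof (induct a arbitrary: b rule: rev_induct)
    case Nil
    define c where "c = top [] # b"
    have c: "c \<in> chains" unfolding c_def using ins_chains[OF Nil] by simp
    interpret M: module R "F (apex c)" by (rule chain_module[OF c])
    have b: "b \<in> chains" using Nil by (simp add: free_def)
    have "apex b \<subseteq> apex c" using apex_omit_subset[OF c, of 0] by (simp add: c_def omit_def)
    then have cl: "\<phi> (apex b) (apex c) (z b) \<in> carrier (F (apex c))"
      using module_hom_closed[OF phi_hom] apex_subset[OF c] cochainsD[OF z b] by blast
    have "\<phi> (apex b) (apex c) (z b) \<in> N c"
      by (rule M.mod_cong_in[OF N_submodule[OF c] cl cobd_closed[OF z c] _ dz[OF c]],
          rule M.mod_cong_sym[OF N_submodule[OF c] cobd_closed[OF z c] cl],
          rule cobd_matched_Nil[OF z _ Nil, folded c_def], rule z_ins)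
    then show ?case
      using matched_inj[OF Nil] cochainsD[OF z b] by (simp add: c_def)
  next
    case (snoc D a)
    define c where "c = (a @ [D]) @ top (a @ [D]) # b"
    have c: "c \<in> chains" unfolding c_def by (rule ins_chains[OF snoc(2)])
    let ?M = "F (apex c)"
    interpret M: module R ?M by (rule chain_module[OF c])
    note sub = N_submodule[OF c]
    have u: "z (a @ top (a @ [D]) # b) \<in> N c" (is "?u \<in> _")
      using snoc(1)[OF free_step[OF snoc(2)]] by (simp add: c_def)
    then have uc: "?u \<in> carrier ?M" by (simp add: negligible_def)
    have v: "\<phi> (apex ((a @ [D]) @ b)) (apex c) (z ((a @ [D]) @ b)) \<in> carrier ?M" (is "?v \<in> _")
      using face_closed[OF z c, of "length (a @ [D])"] face_matched[of z "a @ [D]" b, folded c_def] by simp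
    let ?su = "signed ?M (length a) ?u" and ?sv = "signed ?M (Suc (length a)) ?v"
    note suv = M.signed_closed[OF uc, of "length a"] M.signed_closed[OF v, of "Suc (length a)"]
    have cl: "?su \<oplus>\<^bsub>?M\<^esub> ?sv \<in> carrier ?M" using suv by simp
    have "?su \<oplus>\<^bsub>?M\<^esub> ?sv \<in> N c"
      by (rule M.mod_cong_in[OF sub cl cobd_closed[OF z c] _ dz[OF c]],
          rule M.mod_cong_sym[OF sub cobd_closed[OF z c] cl], rule cobd_matched_snoc[OF z _ snoc(2) c_def], rule z_ins)
    moreover have "?su \<in> N c" using u by (rule M.signed_submodule[OF sub])
    ultimately have "\<ominus>\<^bsub>?M\<^esub> ?su \<oplus>\<^bsub>?M\<^esub> (?su \<oplus>\<^bsub>?M\<^esub> ?sv) \<in> N c"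
      by (intro M.submodule_facts(3)[OF sub M.submodule_facts(4)[OF sub]])
    then have "?sv \<in> N c" by (simp only: M.M.r_neg1[OF suv])
    then have "signed ?M (Suc (length a)) ?sv \<in> N c" by (rule M.signed_submodule[OF sub])
    then have "?v \<in> N c" using v by (simp only: M.signed_signed)
    then show ?case
      using matched_inj[OF snoc(2)] cochainsD[OF z, of "(a @ [D]) @ b"] snoc(2)
      unfolding c_def free_def by blast
  qed
  have "z c \<in> N c" if "c \<in> chains" for c
    using that by (cases rule: chain_cases) (use z_free z_ins in auto)
  \<comment> \<open>Each negligible value is moved into p F by some denominator. The finitely many
    chains share one, r, which then rescales both s x and y.\<close>
  then have "\<exists>r\<in>carrier R - p. \<forall>c\<in>chains. r \<odot>\<^bsub>F (apex c)\<^esub> z c \<in> ideal_span R p (F (apex c))"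
  proof (intro p.common_denominator finite_chains)
    fix c r t assume *: "c \<in> chains" "r \<in> carrier R - p" "t \<in> carrier R - p"
        "r \<odot>\<^bsub>F (apex c)\<^esub> z c \<in> ideal_span R p (F (apex c))"
    interpret M: module R "F (apex c)" by (rule chain_module) fact
    show "(t \<otimes> r) \<odot>\<^bsub>F (apex c)\<^esub> z c \<in> ideal_span R p (F (apex c))"
      using * cochainsD[OF z] M.ideal_span_facts(6)[OF p.is_ideal] by (simp add: M.smult_assoc1)
  qed (auto simp: negligible_def)
  then obtain r where r: "r \<in> carrier R - p"
    and rz: "\<And>c. c \<in> chains \<Longrightarrow> r \<odot>\<^bsub>F (apex c)\<^esub> z c \<in> ideal_span R p (F (apex c))" by blast
  have rR: "r \<in> carrier R" using r by simp
  have "cdiff (cscale (r \<otimes> s) x) (cobd (cscale r y)) c \<in> ideal_span R p (F (apex c))" if c: "c \<in> chains" for c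
  proof -
    interpret M: module R "F (apex c)" by (rule chain_module[OF c])
    have "cdiff (cscale (r \<otimes> s) x) (cobd (cscale r y)) c = r \<odot>\<^bsub>F (apex c)\<^esub> z c"
      using cobd_cscale[OF rR y c] cobd_closed[OF y c] cochainsD[OF x c] rR sR
      by (simp add: cdiff_def cscale_def z_def M.smult_assoc1 a_minus_def M.smult_r_distr M.smult_r_minus)
    then show ?thesis using rz[OF c] by simp
  qed
  then show ?thesis using p.mult_compl[OF r s] cscale_cochains[OF rR y] by blast
qed

end

section \<open>Homotopy pullbacks from acyclicity\<close>

lemma product_algebra_simps [simp]:
  "carrier (product_algebra I M) = (\<Pi>\<^sub>E i\<in>I. carrier (M i))"
  "\<zero>\<^bsub>product_algebra I M\<^esub> = (\<lambda>i\<in>I. \<zero>\<^bsub>M i\<^esub>)"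
  "x \<oplus>\<^bsub>product_algebra I M\<^esub> y = (\<lambda>i\<in>I. x i \<oplus>\<^bsub>M i\<^esub> y i)"
  "a \<odot>\<^bsub>product_algebra I M\<^esub> x = (\<lambda>i\<in>I. a \<odot>\<^bsub>M i\<^esub> x i)"
  by (simp_all add: product_algebra_def)

lemma product_algebra_module:
  assumes "cring R" "\<And>i. i \<in> I \<Longrightarrow> module R (M i)"
  shows "module R (product_algebra I M)"
proof -
  interpret cring R by fact
  have group: "abelian_group (M i)" if "i \<in> I" for i
    using assms(2)[OF that] by (rule module.axioms)
  have mon: "abelian_monoid (M i)" if "i \<in> I" for i
    using group[OF that] by (rule abelian_group.axioms)
  have "abelian_group (product_algebra I M)"
  proof (rule abelian_groupI)
    fix x assume x: "x \<in> carrier (product_algebra I M)"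
    show "\<exists>y\<in>carrier (product_algebra I M). y \<oplus>\<^bsub>product_algebra I M\<^esub> x = \<zero>\<^bsub>product_algebra I M\<^esub>"
      using x by (intro bexI[of _ "\<lambda>i\<in>I. \<ominus>\<^bsub>M i\<^esub> x i"])
        (auto simp: PiE_iff abelian_group.l_neg[OF group] abelian_group.a_inv_closed[OF group]
          intro!: restrict_ext)
    show "\<zero>\<^bsub>product_algebra I M\<^esub> \<oplus>\<^bsub>product_algebra I M\<^esub> x = x"
      using x by (auto simp: PiE_iff abelian_monoid.l_zero[OF mon] extensional_def fun_eq_iff)
    fix y assume "y \<in> carrier (product_algebra I M)"
    then show "x \<oplus>\<^bsub>product_algebra I M\<^esub> y = y \<oplus>\<^bsub>product_algebra I M\<^esub> x"
      using x by (auto simp: PiE_iff abelian_monoid.a_comm[OF mon] intro!: restrict_ext)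
  qed (auto simp: PiE_iff abelian_monoid.a_closed[OF mon] abelian_monoid.zero_closed[OF mon]
      abelian_monoid.a_assoc[OF mon] intro!: restrict_ext)
  then show ?thesis
    by (intro moduleI is_cring)
      (auto simp: PiE_iff module.smult_closed[OF assms(2)] module.smult_l_distr[OF assms(2)]
        module.smult_r_distr[OF assms(2)] module.smult_assoc1[OF assms(2)] module.smult_one[OF assms(2)]
        extensional_def fun_eq_iff)
qed

lemma trivial_submodule_module:
  assumes "module R M"
  shows "module R (M\<lparr>carrier := {\<zero>\<^bsub>M\<^esub>}, one := \<zero>\<^bsub>M\<^esub>\<rparr>)"
proof -
  interpret M: module R M by fact
  show ?thesis
    by (intro moduleI M.R.is_cring abelian_groupI) auto
qed

section \<open>The total complex and the homotopy limit\<close>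

context cube_diagram
begin

lemma strict_chains_eq: "strict_chains (Pow E - {{}}) n = {c \<in> chains. length c = Suc n}"
  by (auto simp: strict_chains_def chains_def)

lemma apex_last: "length c = Suc n \<Longrightarrow> apex c = last c"
  by (auto simp: apex_def)

text \<open>Embeds one degree into the total cochains. Degree n of the homotopy limit is m = n + 1,
  since an n-simplex has n + 1 vertices; m = 0 is the augmentation.\<close>

definition extend :: "nat \<Rightarrow> ('i set list \<Rightarrow> 'x) \<Rightarrow> 'i set list \<Rightarrow> 'x"
  where "extend m x c = (if c \<in> chains \<and> length c = m then x c else \<zero>\<^bsub>F (apex c)\<^esub>)"

lemma chain_zero: "c \<in> chains \<Longrightarrow> \<zero>\<^bsub>F (apex c)\<^esub> \<in> carrier (F (apex c))"
  using module.axioms(2)[OF chain_module] abelian_group.axioms(1) abelian_monoid.zero_closed by blast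

lemma extend_cochains:
  "(\<And>c. c \<in> chains \<Longrightarrow> length c = m \<Longrightarrow> x c \<in> carrier (F (apex c))) \<Longrightarrow> extend m x \<in> cochains"
  by (simp add: cochains_def extend_def chain_zero)

lemma cobd_extend_zero:
  assumes "c \<in> chains" "length c \<noteq> Suc m"
  shows "cobd (extend m x) c = \<zero>\<^bsub>F (apex c)\<^esub>"
proof -
  interpret M: module R "F (apex c)" by (rule chain_module) fact
  have "signed (F (apex c)) i (face (extend m x) c i) = \<zero>\<^bsub>F (apex c)\<^esub>" if "i < length c" for i
  proof -
    have "length (omit i c) \<noteq> m" using that assms(2) by (simp add: length_omit)
    then have "face (extend m x) c i = \<zero>\<^bsub>F (apex c)\<^esub>"
      using module_hom_zero[OF chain_module[OF omit_chains[OF assms(1)]] M.module_axioms face_hom[OF assms(1)]]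
      by (simp add: face_def extend_def)
    then show ?thesis by simp
  qed
  then have "cobd (extend m x) c = (\<Oplus>\<^bsub>F (apex c)\<^esub>i\<in>{..<length c}. \<zero>\<^bsub>F (apex c)\<^esub>)"
    unfolding cobd_def by (intro M.M.finsum_cong') auto
  then show ?thesis by (simp only: M.M.finsum_zero)
qed

lemma cobd_extend:
  assumes "c \<in> chains" "length c = Suc m" "y \<in> cochains"
  shows "cobd (extend m y) c = cobd y c"
  using assms by (intro cobd_cong) (auto simp: extend_def omit_chains length_omit)

abbreviation H where "H \<equiv> holim (Pow E - {{}}) F \<phi>"

lemma Term_H: "Term H n = product_algebra {c \<in> chains. length c = Suc n} (\<lambda>c. F (last c))"
  by (simp add: holim_def strict_chains_eq)

lemma Term_H_module: "module R (Term H n)"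
  unfolding Term_H
  by (intro product_algebra_module is_cring) (auto simp flip: apex_last intro!: chain_module)

lemma carrier_TermD: "x \<in> carrier (Term H n) \<Longrightarrow> c \<in> chains \<Longrightarrow> length c = Suc n \<Longrightarrow> x c \<in> carrier (F (apex c))"
  by (auto simp: Term_H apex_last)

lemma restrict_in_Term:
  assumes "\<And>c. c \<in> chains \<Longrightarrow> y c \<in> carrier (F (apex c))"
  shows "(\<lambda>c\<in>{c \<in> chains. length c = Suc n}. y c) \<in> carrier (Term H n)"
  using assms apex_last by (fastforce simp: Term_H)

lemma Term_extend: "x \<in> carrier (Term H n) \<Longrightarrow> extend (Suc n) x \<in> cochains"
  by (intro extend_cochains carrier_TermD)

text \<open>The uniform formula for faces specializes to the two cases of the differential: for
  indices up to n the transition map is an identity, and the last face is \<open>butlast c\<close>,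
  whose apex is the vertex with index n.\<close>

lemma Diff_H:
  assumes x: "x \<in> carrier (Term H n)"
  shows "Diff H n x = (\<lambda>c\<in>{c \<in> chains. length c = Suc (Suc n)}. cobd (extend (Suc n) x) c)"
proof -
  have "finsum (F (last c)) (\<lambda>i. signed (F (last c)) i
         (if i \<le> n then x (omit i c) else \<phi> (c ! n) (last c) (x (butlast c)))) {..Suc n} = cobd (extend (Suc n) x) c"
    if c: "c \<in> chains" "length c = Suc (Suc n)" for c
  proof -
    interpret M: module R "F (apex c)" by (rule chain_module) fact
    have last: "last c = apex c" and set: "{..Suc n} = {..<length c}"
      using c by (auto simp: apex_last)
    note e = Term_extend[OF x]
    show ?thesis
      unfolding cobd_def last set
    proof (rule M.M.finsum_cong')
      fix i assume i: "i \<in> {..<length c}"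
      have oi: "omit i c \<in> chains" "length (omit i c) = Suc n"
        using c i by (auto simp: omit_chains length_omit)
      have xi: "x (omit i c) \<in> carrier (F (apex (omit i c)))" by (rule carrier_TermD[OF x oi])
      have "(if i \<le> n then x (omit i c) else \<phi> (c ! n) (apex c) (x (butlast c))) = face (extend (Suc n) x) c i"
      proof (cases "i \<le> n")
        case True
        then have "apex (omit i c) = apex c" using c by (intro apex_omit) simp
        then show ?thesis
          using True oi xi phi_id[OF apex_subset[OF c(1)]] by (simp add: face_def extend_def)
      next
        case False
        then have "i = length c - 1" using i c by auto
        moreover have "c \<noteq> []" using c by auto
        ultimately have oc: "omit i c = butlast c" using omit_last[of c] by simp
        have "butlast c \<noteq> []" using c by (cases c rule: rev_cases) auto
        then have "apex (butlast c) = c ! n"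
          using c by (simp add: apex_def last_conv_nth nth_butlast)
        then show ?thesis using False oi oc by (simp add: face_def extend_def)
      qed
      then show "signed (F (apex c)) i (if i \<le> n then x (omit i c) else \<phi> (c ! n) (apex c) (x (butlast c)))
          = signed (F (apex c)) i (face (extend (Suc n) x) c i)" by simp
    qed (auto intro: signed_face_closed[OF e c(1)])
  qed
  then show ?thesis
    by (auto simp: holim_def strict_chains_eq intro!: restrict_ext)
qed

lemma Diff_hom: "Diff H n \<in> module_hom R (Term H n) (Term H (Suc n))"
proof (rule module_homI)
  fix x assume x: "x \<in> carrier (Term H n)"
  note e = Term_extend[OF x]
  show "Diff H n x \<in> carrier (Term H (Suc n))"
    unfolding Diff_H[OF x] by (rule restrict_in_Term[OF cobd_closed[OF e]])
  {
    fix y assume y: "y \<in> carrier (Term H n)"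
    have xy: "x \<oplus>\<^bsub>Term H n\<^esub> y \<in> carrier (Term H n)"
      using x y module.axioms(2)[OF Term_H_module] abelian_group.axioms(1) abelian_monoid.a_closed by metis
    have "cobd (extend (Suc n) (x \<oplus>\<^bsub>Term H n\<^esub> y)) c =
        cobd (extend (Suc n) x) c \<oplus>\<^bsub>F (apex c)\<^esub> cobd (extend (Suc n) y) c"
      if c: "c \<in> chains" "length c = Suc (Suc n)" for c
    proof -
      have "cobd (extend (Suc n) (x \<oplus>\<^bsub>Term H n\<^esub> y)) c = cobd (csum (extend (Suc n) x) (extend (Suc n) y)) c"
        using c csum_cochains[OF e Term_extend[OF y]]
        by (intro cobd_cong) (auto simp: extend_def csum_def Term_H omit_chains length_omit apex_last)
      then show ?thesis using cobd_csum[OF e Term_extend[OF y] c(1)] by simp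
    qed
    then show "Diff H n (x \<oplus>\<^bsub>Term H n\<^esub> y) = Diff H n x \<oplus>\<^bsub>Term H (Suc n)\<^esub> Diff H n y"
      unfolding Diff_H[OF x] Diff_H[OF y] Diff_H[OF xy] unfolding Term_H[of "Suc n"]
      by (auto simp: apex_last intro!: restrict_ext)
  }
  fix a assume a: "a \<in> carrier R"
  have ax: "a \<odot>\<^bsub>Term H n\<^esub> x \<in> carrier (Term H n)"
    using module.smult_closed[OF Term_H_module a x] .
  have "cobd (extend (Suc n) (a \<odot>\<^bsub>Term H n\<^esub> x)) c = a \<odot>\<^bsub>F (apex c)\<^esub> cobd (extend (Suc n) x) c"
    if c: "c \<in> chains" "length c = Suc (Suc n)" for c
  proof -
    have "cobd (extend (Suc n) (a \<odot>\<^bsub>Term H n\<^esub> x)) c = cobd (cscale a (extend (Suc n) x)) c"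
      using c cscale_cochains[OF a e]
      by (intro cobd_cong) (auto simp: extend_def cscale_def Term_H omit_chains length_omit apex_last)
    then show ?thesis using cobd_cscale[OF a e c(1)] by simp
  qed
  then show "Diff H n (a \<odot>\<^bsub>Term H n\<^esub> x) = a \<odot>\<^bsub>Term H (Suc n)\<^esub> Diff H n x"
    unfolding Diff_H[OF x] Diff_H[OF ax] unfolding Term_H[of "Suc n"]
    by (auto simp: apex_last intro!: restrict_ext)
qed

lemma Diff_restrict_cobd:
  assumes y: "y \<in> cochains"
  shows "Diff H n (\<lambda>c\<in>{c \<in> chains. length c = Suc n}. cobd y c) = \<zero>\<^bsub>Term H (Suc n)\<^esub>"
proof -
  let ?x = "\<lambda>c\<in>{c \<in> chains. length c = Suc n}. cobd y c"
  have x: "?x \<in> carrier (Term H n)"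
    by (rule restrict_in_Term[OF cobd_closed[OF y]])
  have "cobd (extend (Suc n) ?x) c = \<zero>\<^bsub>F (apex c)\<^esub>" if c: "c \<in> chains" "length c = Suc (Suc n)" for c
  proof -
    have "cobd (extend (Suc n) ?x) c = cobd (cobd y) c"
      using c cobd_cochains[OF y] by (intro cobd_cong) (auto simp: extend_def omit_chains length_omit)
    then show ?thesis using cobd_cobd[OF y c(1)] by simp
  qed
  then show ?thesis
    unfolding Diff_H[OF x] unfolding Term_H by (auto simp: apex_last intro!: restrict_ext)
qed

lemma restrict_cobd_Suc:
  assumes y: "y \<in> cochains"
  shows "(\<lambda>c\<in>{c \<in> chains. length c = Suc (Suc n)}. cobd y c) = Diff H n (\<lambda>c\<in>{c \<in> chains. length c = Suc n}. y c)"
proof -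
  let ?x = "\<lambda>c\<in>{c \<in> chains. length c = Suc n}. y c"
  have x: "?x \<in> carrier (Term H n)"
    by (rule restrict_in_Term[OF cochainsD[OF y]])
  have "extend (Suc n) ?x = extend (Suc n) y" by (auto simp: extend_def)
  then show ?thesis
    unfolding Diff_H[OF x] using y by (auto intro!: restrict_ext simp: cobd_extend)
qed

text \<open>A chain with one vertex has the empty chain as its only face, taken with positive sign,
  so the coboundary in this length is the map into the homotopy limit.\<close>

lemma restrict_cobd_0:
  assumes y: "y \<in> cochains"
  shows "(\<lambda>c\<in>{c \<in> chains. length c = Suc 0}. cobd y c) = to_holim {} (Pow E - {{}}) F \<phi> 0 (y [])"
proof -
  have "cobd y c = \<phi> {} (last c) (y [])" if c: "c \<in> chains" "length c = Suc 0" for c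
  proof -
    obtain D where D: "c = [D]" using c(2) by (cases c) auto
    have f: "face y c 0 = \<phi> {} D (y [])" by (simp add: face_def D omit_def)
    interpret M: module R "F (apex c)" by (rule chain_module) fact
    have "cobd y c = (\<Oplus>\<^bsub>F (apex c)\<^esub>i\<in>{0}. signed (F (apex c)) i (face y c i))"
      by (simp add: cobd_def D lessThan_Suc)
    also have "\<dots> = face y c 0"
      using face_closed[OF y c(1)] by (subst M.M.finsum_insert) (auto simp: signed_def)
    finally show ?thesis using f D by simp
  qed
  then show ?thesis by (auto simp: to_holim_def strict_chains_eq intro!: restrict_ext)
qed

text \<open>A cocycle in one length, extended by zero, is a cocycle of the total complex, and
  congruence modulo the zero ideal is equality. The primitive y need not be homogeneous; the
  coboundary on chains of length m sees only its values one length below.\<close>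

lemma exact_at:
  assumes ac: "acyclic_mod {\<zero>}"
    and x: "\<And>c. c \<in> chains \<Longrightarrow> length c = m \<Longrightarrow> x c \<in> carrier (F (apex c))"
    and dx: "\<And>c. c \<in> chains \<Longrightarrow> length c = Suc m \<Longrightarrow> cobd (extend m x) c = \<zero>\<^bsub>F (apex c)\<^esub>"
  shows "\<exists>y\<in>cochains. \<forall>c\<in>chains. length c = m \<longrightarrow> x c = cobd y c"
proof -
  note e = extend_cochains[of m x, OF x]
  have "\<forall>c\<in>chains. cobd (extend m x) c \<in> ideal_span R {\<zero>} (F (apex c))"
    using dx cobd_extend_zero by (metis ideal_span.zero)
  then obtain y where y: "y \<in> cochains"
    and xy: "\<And>c. c \<in> chains \<Longrightarrow> cdiff (extend m x) (cobd y) c \<in> ideal_span R {\<zero>} (F (apex c))"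
    using ac e unfolding acyclic_mod_def by blast
  have "x c = cobd y c" if c: "c \<in> chains" "length c = m" for c
  proof -
    interpret M: module R "F (apex c)" by (rule chain_module) fact
    have "x c \<ominus>\<^bsub>F (apex c)\<^esub> cobd y c = \<zero>\<^bsub>F (apex c)\<^esub>"
      using M.ideal_span_zero_ideal[OF xy[OF c(1)]] c by (simp add: cdiff_def extend_def)
    then show ?thesis
      using M.minus_cancel[OF x[OF c] cobd_closed[OF y c(1)]] cobd_closed[OF y c(1)] by simp
  qed
  then show ?thesis using y by blast
qed

text \<open>Exactness at the empty chain and at chains of one vertex identifies F at the empty set
  with the degree 0 cocycles of the homotopy limit; exactness at longer chains kills its cohomology
  in positive degrees.\<close>

theorem homotopy_pullback_of_acyclic:
  assumes ac: "acyclic_mod {\<zero>}"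
  shows "homotopy_pullback R E F \<phi>"
proof -
  let ?M = "F {}"
  let ?K = "in_degree_zero ?M"
  let ?f = "to_holim {} (Pow E - {{}}) F \<phi>"
  interpret M: module R ?M by (rule F_module) simp
  have K_module: "module R (Term ?K n)" for n
    using trivial_submodule_module[OF M.module_axioms] M.module_axioms by (simp add: in_degree_zero_def)
  have K_zero: "Diff ?K n x = \<zero>\<^bsub>Term ?K (Suc n)\<^esub>" for n x
    by (simp add: in_degree_zero_def)
  have K: "cochain_complex R ?K"
    unfolding cochain_complex_def
  proof (intro conjI allI ballI K_module)
    show "Diff ?K n \<in> module_hom R (Term ?K n) (Term ?K (Suc n))" for n
      by (rule module_homI) (auto simp: in_degree_zero_def)
  qed (auto simp: in_degree_zero_def)
  \<comment> \<open>The augmentation cochain: on chains with one vertex its coboundary is the image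
    of x in the homotopy limit.\<close>
  define base where "base x c = (if c = [] then x else \<zero>\<^bsub>F (apex c)\<^esub>)" for x and c :: "'i set list"
  have base: "base x \<in> cochains" if "x \<in> carrier ?M" for x
    using that chain_zero by (auto simp: cochains_def base_def)
  have f0: "?f 0 x = (\<lambda>c\<in>{c \<in> chains. length c = Suc 0}. cobd (base x) c)" if "x \<in> carrier ?M" for x
    using restrict_cobd_0[OF base[OF that]] by (simp add: base_def)
  have L_zero: "Diff H (Suc n) (Diff H n x) = \<zero>\<^bsub>Term H (Suc (Suc n))\<^esub>" if x: "x \<in> carrier (Term H n)" for n x
    unfolding Diff_H[OF x] by (rule Diff_restrict_cobd[OF Term_extend[OF x]])
  have L: "cochain_complex R H"
    unfolding cochain_complex_def using Term_H_module Diff_hom L_zero by blast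
  have last_sub: "last c \<subseteq> E" if "c \<in> chains" "length c = Suc 0" for c
    using apex_subset[OF that(1)] apex_last[OF that(2)] by simp
  have f_hom: "?f n \<in> module_hom R (Term ?K n) (Term H n)" for n
  proof (cases n)
    case 0
    show ?thesis
      unfolding 0 Term_H
      by (rule module_homI) (auto simp: in_degree_zero_def to_holim_def strict_chains_eq
        module_hom_closed[OF phi_hom[OF _ last_sub]] module_hom_add[OF phi_hom[OF _ last_sub]]
        module_hom_smult[OF phi_hom[OF _ last_sub]] intro!: restrict_ext)
  next
    case (Suc k)
    interpret T: module R "Term H (Suc k)" by (rule Term_H_module)
    show ?thesis
      unfolding Suc by (rule module_homI) (auto simp: to_holim_def)
  qed
  have f_map: "?f (Suc n) (Diff ?K n x) = Diff H n (?f n x)" if x: "x \<in> carrier (Term ?K n)" for n x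
  proof (cases n)
    case 0
    then have "x \<in> carrier ?M" using x by (simp add: in_degree_zero_def)
    then show ?thesis
      using Diff_restrict_cobd[OF base, of x 0] f0[of x] 0 by (simp add: to_holim_def)
  next
    case (Suc k)
    then show ?thesis
      using module_hom_zero[OF Term_H_module Term_H_module Diff_hom, of n] by (simp add: to_holim_def)
  qed
  have f: "cochain_map R ?K H ?f"
    unfolding cochain_map_def using f_hom f_map by blast
  have cocycle_exact: "\<exists>y\<in>cochains. \<forall>c\<in>chains. length c = Suc n \<longrightarrow> z c = cobd y c"
    if z: "z \<in> cocycles H n" for z n
  proof -
    have zc: "z \<in> carrier (Term H n)" and dz: "Diff H n z = \<zero>\<^bsub>Term H (Suc n)\<^esub>"
      using z by (auto simp: cocycles_def)
    show ?thesis
    proof (rule exact_at[OF ac carrier_TermD[OF zc]])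
      fix c assume c: "c \<in> chains" "length c = Suc (Suc n)"
      show "cobd (extend (Suc n) z) c = \<zero>\<^bsub>F (apex c)\<^esub>"
        using fun_cong[OF dz, of c] c unfolding Diff_H[OF zc] unfolding Term_H by (simp add: apex_last)
    qed
  qed
  have cocycle_ext: "z = (\<lambda>c\<in>{c \<in> chains. length c = Suc n}. z c)" if "z \<in> cocycles H n" for z n
    using that unfolding cocycles_def Term_H by (auto simp: PiE_iff extensional_def fun_eq_iff)
  \<comment> \<open>Surjectivity onto the cocycles is exactness at chains with one vertex.
    Injectivity is exactness at the empty chain, where a coboundary is an empty sum and so
    vanishes.\<close>
  have bij0: "bij_betw (?f 0) (carrier ?M) (cocycles H 0)"
  proof (rule bij_betw_imageI)
    show "?f 0 ` carrier ?M = cocycles H 0"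
    proof
      have "?f 0 x \<in> cocycles H 0" if x: "x \<in> carrier ?M" for x
        using Diff_restrict_cobd[OF base[OF x], of 0] f0[OF x] module_hom_closed[OF f_hom[of 0], of x] x
        by (auto simp: cocycles_def in_degree_zero_def)
      then show "?f 0 ` carrier ?M \<subseteq> cocycles H 0" by blast
      show "cocycles H 0 \<subseteq> ?f 0 ` carrier ?M"
      proof
        fix z assume z: "z \<in> cocycles H 0"
        then obtain y where y: "y \<in> cochains" "\<forall>c\<in>chains. length c = Suc 0 \<longrightarrow> z c = cobd y c"
          using cocycle_exact by blast
        have "z = (\<lambda>c\<in>{c \<in> chains. length c = Suc 0}. cobd y c)"
          using cocycle_ext[OF z] y(2) by (metis (mono_tags, lifting) mem_Collect_eq restrict_ext)
        also have "\<dots> = ?f 0 (y [])" by (rule restrict_cobd_0[OF y(1)])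
        finally show "z \<in> ?f 0 ` carrier ?M" using cochainsD[OF y(1), of "[]"] by auto
      qed
    qed
    have zero: "x = \<zero>\<^bsub>?M\<^esub>" if x: "x \<in> carrier ?M" and fx: "?f 0 x = \<zero>\<^bsub>Term H 0\<^esub>" for x
    proof -
      have "\<exists>y\<in>cochains. \<forall>c\<in>chains. length c = 0 \<longrightarrow> base x c = cobd y c"
      proof (rule exact_at[OF ac])
        show "base x c \<in> carrier (F (apex c))" if "c \<in> chains" for c
          using base[OF x] that by (rule cochainsD)
        fix c assume c: "c \<in> chains" "length c = Suc 0"
        have "cobd (base x) c = \<zero>\<^bsub>F (apex c)\<^esub>"
          using fun_cong[OF fx, of c] c unfolding f0[OF x] Term_H by (simp add: apex_last)
        then show "cobd (extend 0 (base x)) c = \<zero>\<^bsub>F (apex c)\<^esub>"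
          using cobd_extend[OF c base[OF x]] by simp
      qed
      then obtain y where "base x [] = cobd y []" by force
      then show ?thesis by (simp add: base_def cobd_def M.M.finsum_empty)
    qed
    show "inj_on (?f 0) (carrier ?M)"
    proof (rule inj_onI)
      fix x y assume xy: "x \<in> carrier ?M" "y \<in> carrier ?M" "?f 0 x = ?f 0 y"
      interpret T: module R "Term H 0" by (rule Term_H_module)
      have "?f 0 \<in> module_hom R ?M (Term H 0)"
        using f_hom[of 0] by (simp add: in_degree_zero_def)
      then have "?f 0 (x \<ominus>\<^bsub>?M\<^esub> y) = ?f 0 x \<ominus>\<^bsub>Term H 0\<^esub> ?f 0 y" and "?f 0 y \<in> carrier (Term H 0)"
        using module_hom_minus[OF M.module_axioms T.module_axioms _ xy(1,2)] module_hom_closed[OF _ xy(2)]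
        by blast+
      then have "?f 0 (x \<ominus>\<^bsub>?M\<^esub> y) = \<zero>\<^bsub>Term H 0\<^esub>"
        unfolding xy(3) a_minus_def by (simp only: T.M.r_neg)
      then have "x \<ominus>\<^bsub>?M\<^esub> y = \<zero>\<^bsub>?M\<^esub>"
        using xy by (intro zero) (auto simp: a_minus_def)
      then show "x = y" using M.minus_cancel[OF xy(1,2)] xy by simp
    qed
  qed
  have "bij_betw (cohomology_map H ?f n) (cohomology ?K n) (cohomology H n)" for n
  proof (cases n)
    case 0
    interpret T: module R "Term H 0" by (rule Term_H_module)
    \<comment> \<open>In degree 0 the coboundaries are zero, so cohomology classes are singletons
      and the induced map is the map on cocycles.\<close>
    have cK: "cohomology ?K 0 = (\<lambda>z. {z}) ` carrier ?M"
      unfolding cohomology_def cocycles_def a_r_coset_def'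
      by (intro image_cong) (auto simp: in_degree_zero_def)
    have cH: "cohomology H 0 = (\<lambda>z. {z}) ` cocycles H 0"
      unfolding cohomology_def a_r_coset_def'
      by (intro image_cong) (auto simp: cocycles_def simp del: product_algebra_simps)
    have cm: "cohomology_map H ?f 0 {x} = {?f 0 x}" if "x \<in> carrier ?M" for x
    proof -
      have "?f 0 x \<in> carrier (Term H 0)"
        using bij0 that unfolding bij_betw_def cocycles_def by blast
      then show ?thesis by (simp add: cohomology_map_def set_add_def')
    qed
    have "cohomology_map H ?f 0 ` cohomology ?K 0 = cohomology H 0"
      unfolding cK cH bij_betw_imp_surj_on[OF bij0, symmetric] image_image
      by (rule image_cong) (simp_all add: cm)
    moreover have "inj_on (cohomology_map H ?f 0) (cohomology ?K 0)"
      using bij_betw_imp_inj_on[OF bij0] unfolding cK inj_on_def by (simp add: cm)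
    ultimately show ?thesis unfolding 0 bij_betw_def by blast
  next
    case (Suc k)
    let ?B = "coboundaries H n"
    interpret T: module R "Term H n" by (rule Term_H_module)
    interpret T': module R "Term H k" by (rule Term_H_module)
    have B: "?B = Diff H k ` carrier (Term H k)" by (simp add: Suc)
    \<comment> \<open>In positive degree every cocycle is a coboundary, so each of the two
      cohomologies consists of one class, and it remains to match these classes.\<close>
    have B_eq: "cocycles H n = ?B"
    proof
      show "cocycles H n \<subseteq> ?B"
      proof
        fix z assume z: "z \<in> cocycles H n"
        then obtain y where y: "y \<in> cochains" "\<forall>c\<in>chains. length c = Suc n \<longrightarrow> z c = cobd y c"
          using cocycle_exact by blast
        have "z = (\<lambda>c\<in>{c \<in> chains. length c = Suc n}. cobd y c)"
          using cocycle_ext[OF z] y(2) by (metis (mono_tags, lifting) mem_Collect_eq restrict_ext)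
        also have "\<dots> = Diff H k (\<lambda>c\<in>{c \<in> chains. length c = Suc k}. y c)"
          unfolding Suc by (rule restrict_cobd_Suc[OF y(1)])
        finally show "z \<in> ?B"
          unfolding B by (rule image_eqI[OF _ restrict_in_Term[OF cochainsD[OF y(1)]]])
      qed
      show "?B \<subseteq> cocycles H n"
        unfolding B cocycles_def Suc using L_zero module_hom_closed[OF Diff_hom[of k]] by auto
    qed
    have hom: "Diff H k \<in> module_hom R (Term H k) (Term H n)" unfolding Suc by (rule Diff_hom)
    have "submodule ?B R (Term H n)"
    proof (rule T.submoduleI)
      show "?B \<subseteq> carrier (Term H n)" unfolding B using module_hom_closed[OF hom] by blast
      show "\<zero>\<^bsub>Term H n\<^esub> \<in> ?B"
        unfolding B using module_hom_zero[OF T'.module_axioms T.module_axioms hom] T'.M.zero_closed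
        by (metis imageI)
      fix a assume "a \<in> ?B"
      then obtain u where u: "u \<in> carrier (Term H k)" "a = Diff H k u" unfolding B by blast
      show "\<ominus>\<^bsub>Term H n\<^esub> a \<in> ?B"
        unfolding B u(2) module_hom_neg[OF T'.module_axioms T.module_axioms hom u(1), symmetric]
        using u(1) by (intro imageI T'.M.a_inv_closed)
      fix b assume "b \<in> ?B"
      then obtain v where v: "v \<in> carrier (Term H k)" "b = Diff H k v" unfolding B by blast
      show "a \<oplus>\<^bsub>Term H n\<^esub> b \<in> ?B"
        unfolding B u(2) v(2) module_hom_add[OF hom u(1) v(1), symmetric]
        using u(1) v(1) by (intro imageI T'.M.a_closed)
    next
      fix r a assume r: "r \<in> carrier R" and "a \<in> ?B"
      then obtain u where u: "u \<in> carrier (Term H k)" "a = Diff H k u" unfolding B by blast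
      show "r \<odot>\<^bsub>Term H n\<^esub> a \<in> ?B"
        unfolding B u(2) module_hom_smult[OF hom r u(1), symmetric]
        using u(1) r by (intro imageI T'.smult_closed)
    qed
    then have add: "additive_subgroup ?B (Term H n)" by (rule T.submodule_additive_subgroup)
    interpret B: abelian_subgroup ?B "Term H n"
      by (rule abelian_subgroupI3[OF add module.axioms(2)[OF T.module_axioms]])
    have "cohomology H n = (\<lambda>_. ?B) ` ?B"
      unfolding cohomology_def B_eq by (rule image_cong[OF refl B.a_rcos_const])
    then have cH: "cohomology H n = {?B}" by (simp only: image_constant[OF B.zero_closed])
    have cK: "cohomology ?K n = {{\<zero>\<^bsub>?M\<^esub>}}"
      unfolding cohomology_def cocycles_def a_r_coset_def' Suc
      by (auto simp: in_degree_zero_def)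
    have "cohomology_map H ?f n {\<zero>\<^bsub>?M\<^esub>} = ?B"
    proof -
      have "b \<oplus>\<^bsub>Term H n\<^esub> \<zero>\<^bsub>Term H n\<^esub> = b" if "b \<in> ?B" for b
        using that B.a_subset by (intro T.M.r_zero) blast
      then show ?thesis
        unfolding cohomology_map_def set_add_def' by (auto simp: Suc to_holim_def simp del: product_algebra_simps coboundaries.simps)
    qed
    then show ?thesis unfolding cH cK by (simp add: bij_betw_def)
  qed
  then have "quasi_iso R ?K H ?f"
    unfolding quasi_iso_def using K L f by blast
  then show ?thesis
    unfolding homotopy_pullback_def using diagram by blast
qed

end

text \<open>The direction d may vary with p, because the Noetherian induction asks for local
  acyclicity at one prime at a time.\<close>

theorem (in flat_cube_diagram) homotopy_pullback_of_directions:
  assumes "\<And>p. primeideal p R \<Longrightarrow> \<exists>d. contractible_direction R E F \<phi> p d"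
  shows "homotopy_pullback R E F \<phi>"
proof (rule homotopy_pullback_of_acyclic, rule acyclic_mod_all)
  fix p x assume p: "primeideal p R"
  then obtain d where "contractible_direction R E F \<phi> p d" using assms by blast
  then interpret contractible_direction R E F \<phi> p d .
  assume "x \<in> cochains" "\<And>c. c \<in> chains \<Longrightarrow> cobd x c \<in> ideal_span R p (F (apex c))"
  then show "\<exists>s\<in>carrier R - p. \<exists>y\<in>cochains. \<forall>c\<in>chains. cdiff (cscale s x) (cobd y) c \<in> ideal_span R p (F (apex c))"
    by (rule local_acyclic)
qed (rule zeroideal)

section \<open>Transport, products and localizations\<close>

lemma image_algebra_carrier [simp]: "carrier (image_algebra h M) = h ` carrier M"
  and image_algebra_zero [simp]: "\<zero>\<^bsub>image_algebra h M\<^esub> = h \<zero>\<^bsub>M\<^esub>"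
  by (simp_all add: image_algebra_def image_ring_def image_group_def ring.defs monoid.defs)

lemma image_algebra_add [simp]: "inj_on h (carrier M) \<Longrightarrow> x \<in> carrier M \<Longrightarrow> y \<in> carrier M \<Longrightarrow>
    h x \<oplus>\<^bsub>image_algebra h M\<^esub> h y = h (x \<oplus>\<^bsub>M\<^esub> y)"
  and image_algebra_smult [simp]: "inj_on h (carrier M) \<Longrightarrow> x \<in> carrier M \<Longrightarrow>
    a \<odot>\<^bsub>image_algebra h M\<^esub> h x = h (a \<odot>\<^bsub>M\<^esub> x)"
  by (simp_all add: image_algebra_def image_ring_def image_group_def ring.defs monoid.defs)

lemma image_algebra_module:
  assumes "module R M" "inj_on h (carrier M)"
  shows "module R (image_algebra h M)"
proof -
  interpret M: module R M by fact
  have "abelian_group (image_algebra h M)"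
  proof (rule abelian_groupI)
    fix x assume "x \<in> carrier (image_algebra h M)"
    then obtain m where "x = h m" "m \<in> carrier M" by auto
    then show "\<exists>y\<in>carrier (image_algebra h M). y \<oplus>\<^bsub>image_algebra h M\<^esub> x = \<zero>\<^bsub>image_algebra h M\<^esub>"
      using assms(2) by (auto intro!: bexI[of _ "\<ominus>\<^bsub>M\<^esub> m"] simp: M.M.l_neg)
  qed (use assms(2) in \<open>auto simp: M.M.a_ac\<close>)
  then show ?thesis
    by (intro moduleI M.R.is_cring)
      (use assms(2) in \<open>auto simp: M.smult_l_distr M.smult_r_distr M.smult_assoc1\<close>)
qed

lemma image_algebra_hom:
  assumes "module R M" "inj_on h (carrier M)"
  shows "h \<in> module_hom R M (image_algebra h M)"
  using assms(2) by (intro module_homI) auto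

lemma image_algebra_ideal_span:
  assumes "module R M" "inj_on h (carrier M)" "ideal I R"
  shows "ideal_span R I (image_algebra h M) = h ` ideal_span R I M"
proof
  interpret M: module R M by fact
  interpret N: module R "image_algebra h M" by (rule image_algebra_module) fact+
  note sub = ideal.axioms(1)[OF assms(3), THEN additive_subgroup.a_subset]
  show "h ` ideal_span R I M \<subseteq> ideal_span R I (image_algebra h M)"
    using ideal_span_hom[OF image_algebra_hom[OF assms(1,2)] M.module_axioms N.module_axioms sub] by blast
  show "ideal_span R I (image_algebra h M) \<subseteq> h ` ideal_span R I M"
  proof
    fix x assume "x \<in> ideal_span R I (image_algebra h M)"
    then show "x \<in> h ` ideal_span R I M"
    proof (induct rule: ideal_span.induct)
      case zero
      then show ?case by (auto intro: ideal_span.zero)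
    next
      case (add_smult a m x)
      then obtain n y where n: "n \<in> carrier M" "m = h n" and y: "y \<in> ideal_span R I M" "x = h y" by auto
      have "a \<odot>\<^bsub>image_algebra h M\<^esub> m \<oplus>\<^bsub>image_algebra h M\<^esub> x = h (a \<odot>\<^bsub>M\<^esub> n \<oplus>\<^bsub>M\<^esub> y)"
        using n y assms(2) M.ideal_span_closed[OF sub] add_smult(1) sub by (simp add: subset_iff)
      then show ?case using n y add_smult(1) by (auto intro: ideal_span.add_smult)
    qed
  qed
qed

lemma image_algebra_colon_flat:
  assumes "module R M" "inj_on h (carrier M)" "colon_flat R M"
  shows "colon_flat R (image_algebra h M)"
  unfolding colon_flat_def
proof (intro allI impI)
  interpret M: module R M by fact
  fix I r x assume I: "ideal I R" and r: "r \<in> carrier R" and x: "x \<in> carrier (image_algebra h M)"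
    and rx: "r \<odot>\<^bsub>image_algebra h M\<^esub> x \<in> ideal_span R I (image_algebra h M)"
  obtain m where m: "m \<in> carrier M" "x = h m" using x by auto
  obtain y where y: "y \<in> ideal_span R I M" "h (r \<odot>\<^bsub>M\<^esub> m) = h y"
    using rx m assms(2) unfolding image_algebra_ideal_span[OF assms(1,2) I] by auto
  have "r \<odot>\<^bsub>M\<^esub> m = y"
    using y m r assms(2) M.ideal_span_facts(1)[OF I] by (auto dest: inj_onD)
  then have "m \<in> ideal_span R (colon R I r) M"
    using assms(3) I r m y unfolding colon_flat_def by blast
  then show "x \<in> ideal_span R (colon R I r) (image_algebra h M)"
    unfolding image_algebra_ideal_span[OF assms(1,2) M.colon_ideal[OF I r]] m(2) by blast
qed

text \<open>Finite generation of I makes this true for an infinite index set: every coordinate is a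
  sum over the same finite set \<open>A\<close> of generators, so the coefficients of each generator
  assemble to one element of the product.\<close>

lemma (in noetherian_cring) product_ideal_span:
  assumes M: "\<And>i. i \<in> S \<Longrightarrow> module R (M i)" and I: "ideal I R"
  shows "x \<in> ideal_span R I (product_algebra S M) \<longleftrightarrow>
    x \<in> carrier (product_algebra S M) \<and> (\<forall>i\<in>S. x i \<in> ideal_span R I (M i))"
proof (intro iffI conjI ballI)
  interpret P: module R "product_algebra S M" by (rule product_algebra_module[OF is_cring M])
  note sub = ideal.axioms(1)[OF I, THEN additive_subgroup.a_subset]
  show "x \<in> ideal_span R I (product_algebra S M) \<Longrightarrow> x \<in> carrier (product_algebra S M)"
    by (rule P.ideal_span_closed[OF sub])
  show "x i \<in> ideal_span R I (M i)" if x: "x \<in> ideal_span R I (product_algebra S M)" and i: "i \<in> S" for i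
  proof -
    have "(\<lambda>x. x i) \<in> module_hom R (product_algebra S M) (M i)"
      using i by (intro module_homI) auto
    then show ?thesis by (rule ideal_span_hom[OF _ P.module_axioms M[OF i] sub x])
  qed
  assume x: "x \<in> carrier (product_algebra S M) \<and> (\<forall>i\<in>S. x i \<in> ideal_span R I (M i))"
  obtain A where A: "A \<subseteq> carrier R" "finite A" "I = Idl A" using finetely_gen[OF I] by blast
  have "\<exists>g. g \<in> A \<rightarrow> carrier (M i) \<and> x i = (\<Oplus>\<^bsub>M i\<^esub>a\<in>A. a \<odot>\<^bsub>M i\<^esub> g a)" if i: "i \<in> S" for i
  proof -
    interpret N: module R "M i" by (rule M[OF i])
    have "x i \<in> ideal_span R (Idl A) (M i)" using x i A(3) by blast
    then show ?thesis using N.ideal_span_Idl[OF A(2,1)] by metis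
  qed
  then obtain g where g: "\<And>i. i \<in> S \<Longrightarrow> g i \<in> A \<rightarrow> carrier (M i)"
    and xg: "\<And>i. i \<in> S \<Longrightarrow> x i = (\<Oplus>\<^bsub>M i\<^esub>a\<in>A. a \<odot>\<^bsub>M i\<^esub> g i a)"
    by metis
  define G where "G a = (\<lambda>i\<in>S. g i a)" for a
  have G: "G a \<in> carrier (product_algebra S M)" if "a \<in> A" for a
    using g that by (auto simp: G_def)
  let ?s = "\<Oplus>\<^bsub>product_algebra S M\<^esub>a\<in>A. a \<odot>\<^bsub>product_algebra S M\<^esub> G a"
  have aG: "a \<odot>\<^bsub>product_algebra S M\<^esub> G a \<in> carrier (product_algebra S M)" if "a \<in> A" for a
    using P.smult_closed[OF _ G[OF that]] A(1) that by blast
  have "?s i = x i" if i: "i \<in> S" for i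
  proof -
    interpret N: module R "M i" by (rule M[OF i])
    have "(\<lambda>x. x i) \<in> module_hom R (product_algebra S M) (M i)"
      using i by (intro module_homI) auto
    then have "?s i = (\<Oplus>\<^bsub>M i\<^esub>a\<in>A. (a \<odot>\<^bsub>product_algebra S M\<^esub> G a) i)"
      by (rule module_hom_finsum[OF P.module_axioms N.module_axioms]) (rule aG)
    also have "\<dots> = (\<Oplus>\<^bsub>M i\<^esub>a\<in>A. a \<odot>\<^bsub>M i\<^esub> g i a)"
      using i g[OF i] A(1) by (intro N.M.finsum_cong') (auto simp: G_def Pi_iff subset_iff)
    finally show ?thesis using xg[OF i] by simp
  qed
  moreover have "?s \<in> carrier (product_algebra S M)"
    using aG by (intro P.M.finsum_closed) auto
  ultimately have "x = ?s"
    using x by (intro extensionalityI[of x S]) (auto simp: PiE_iff simp del: product_algebra_simps(2-))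
  also have "?s \<in> ideal_span R I (product_algebra S M)"
    by (rule P.ideal_span_facts(7)[OF I], rule P.smult_in_ideal_span[OF sub _ G])
      (use A genideal_self in auto)
  finally show "x \<in> ideal_span R I (product_algebra S M)" .
qed

lemma (in noetherian_cring) product_colon_flat:
  assumes M: "\<And>i. i \<in> S \<Longrightarrow> module R (M i)" and flat: "\<And>i. i \<in> S \<Longrightarrow> colon_flat R (M i)"
  shows "colon_flat R (product_algebra S M)"
  unfolding colon_flat_def
proof (intro allI impI)
  fix I r m assume *: "ideal I R" "r \<in> carrier R" "m \<in> carrier (product_algebra S M)"
    "r \<odot>\<^bsub>product_algebra S M\<^esub> m \<in> ideal_span R I (product_algebra S M)"
  then have "\<forall>i\<in>S. r \<odot>\<^bsub>M i\<^esub> m i \<in> ideal_span R I (M i)"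
    using product_ideal_span[where S = S and M = M, OF M *(1)] by simp
  then have "\<forall>i\<in>S. m i \<in> ideal_span R (colon R I r) (M i)"
    using *(1-3) flat unfolding colon_flat_def by (auto dest: PiE_mem)
  then show "m \<in> ideal_span R (colon R I r) (product_algebra S M)"
    using product_ideal_span[where S = S and M = M, OF M colon_ideal[OF *(1,2)]] *(3) by blast
qed

text \<open>The operations of \<open>localization\<close> are unions over all representatives. Such
  a union is the intended fraction once every representative gives the same one and there is at
  least one representative.\<close>

lemma UN_eq_const: "z \<in> A \<Longrightarrow> (\<And>z. z \<in> A \<Longrightarrow> g z = C) \<Longrightarrow> (\<Union>z\<in>A. g z) = C"
  by auto

section \<open>Localization of a module at a prime\<close>

locale module_localization = module R M + p: primeideal p R
  for R :: "('a, 'b) ring_scheme" (structure) and M :: "('a, 'x) module" (structure) and p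
begin

abbreviation frac where "frac m s \<equiv> fraction R p M m s"

lemma denominatorD: "s \<in> carrier R - p \<Longrightarrow> s \<in> carrier R" by simp

lemma localization_rel_iff:
  "((m, s), (n, t)) \<in> localization_rel R p M \<longleftrightarrow> m \<in> carrier M \<and> n \<in> carrier M \<and>
    s \<in> carrier R - p \<and> t \<in> carrier R - p \<and> (\<exists>u\<in>carrier R - p. (u \<otimes> t) \<odot>\<^bsub>M\<^esub> m = (u \<otimes> s) \<odot>\<^bsub>M\<^esub> n)"
  by (auto simp: localization_rel_def smult_assoc1)

lemma localization_rel_equiv: "equiv (carrier M \<times> (carrier R - p)) (localization_rel R p M)"
proof (rule equivI)
  show "localization_rel R p M \<subseteq> (carrier M \<times> (carrier R - p)) \<times> (carrier M \<times> (carrier R - p))"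
    by (auto simp: localization_rel_def)
  show "refl_on (carrier M \<times> (carrier R - p)) (localization_rel R p M)"
    using p.one_compl by (auto simp: refl_on_def localization_rel_iff)
  show "sym (localization_rel R p M)"
    by (auto simp: sym_def localization_rel_iff) (metis DiffI)
  show "trans (localization_rel R p M)"
  proof (rule transI)
    fix x y z assume "(x, y) \<in> localization_rel R p M" "(y, z) \<in> localization_rel R p M"
    then obtain m s n t q r where xyz: "x = (m, s)" "y = (n, t)" "z = (q, r)"
      and a: "((m, s), (n, t)) \<in> localization_rel R p M" and b: "((n, t), (q, r)) \<in> localization_rel R p M"
      by (cases x, cases y, cases z) auto
    from a obtain u where u: "u \<in> carrier R - p" "(u \<otimes> t) \<odot>\<^bsub>M\<^esub> m = (u \<otimes> s) \<odot>\<^bsub>M\<^esub> n"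
      and mem: "m \<in> carrier M" "n \<in> carrier M" "s \<in> carrier R - p" "t \<in> carrier R - p"
      unfolding localization_rel_iff by blast
    from b obtain v where v: "v \<in> carrier R - p" "(v \<otimes> r) \<odot>\<^bsub>M\<^esub> n = (v \<otimes> t) \<odot>\<^bsub>M\<^esub> q"
      and mem': "q \<in> carrier M" "r \<in> carrier R - p"
      unfolding localization_rel_iff by blast
    note R = denominatorD[OF u(1)] denominatorD[OF v(1)] denominatorD[OF mem(3)]
      denominatorD[OF mem(4)] denominatorD[OF mem'(2)]
    \<comment> \<open>The denominator t of the middle fraction has to enter the witness, because M
      may have t-torsion and t cannot be cancelled.\<close>
    let ?w = "u \<otimes> v \<otimes> t"
    have "(?w \<otimes> r) \<odot>\<^bsub>M\<^esub> m = (v \<otimes> r) \<odot>\<^bsub>M\<^esub> ((u \<otimes> t) \<odot>\<^bsub>M\<^esub> m)"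
      using R mem by (subst smult_assoc1[symmetric]) (auto intro!: arg_cong2[where f = "(\<odot>\<^bsub>M\<^esub>)"], algebra)
    also have "\<dots> = (u \<otimes> s) \<odot>\<^bsub>M\<^esub> ((v \<otimes> r) \<odot>\<^bsub>M\<^esub> n)"
      unfolding u(2) using R mem by (simp add: smult_assoc1[symmetric] R.m_comm)
    also have "\<dots> = (?w \<otimes> s) \<odot>\<^bsub>M\<^esub> q"
      unfolding v(2) using R mem' by (subst smult_assoc1[symmetric]) (auto intro!: arg_cong2[where f = "(\<odot>\<^bsub>M\<^esub>)"], algebra)
    finally show "(x, z) \<in> localization_rel R p M"
      unfolding xyz localization_rel_iff using mem mem' p.mult_compl[OF p.mult_compl[OF u(1) v(1)] mem(4)] by blast
  qed
qed

lemma frac_eq_iff: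
  assumes "m \<in> carrier M" "s \<in> carrier R - p" "n \<in> carrier M" "t \<in> carrier R - p"
  shows "frac m s = frac n t \<longleftrightarrow> (\<exists>u\<in>carrier R - p. (u \<otimes> t) \<odot>\<^bsub>M\<^esub> m = (u \<otimes> s) \<odot>\<^bsub>M\<^esub> n)"
  unfolding fraction_def using assms
  by (subst eq_equiv_class_iff[OF localization_rel_equiv]) (auto simp: localization_rel_iff)

lemma frac_mem_iff:
  assumes "m \<in> carrier M" "s \<in> carrier R - p"
  shows "(n, t) \<in> frac m s \<longleftrightarrow> n \<in> carrier M \<and> t \<in> carrier R - p \<and> frac n t = frac m s"
proof
  assume "(n, t) \<in> frac m s"
  then have r: "((m, s), (n, t)) \<in> localization_rel R p M" by (simp add: fraction_def)
  then show "n \<in> carrier M \<and> t \<in> carrier R - p \<and> frac n t = frac m s"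
    unfolding fraction_def using equiv_class_eq[OF localization_rel_equiv r]
    by (auto simp: localization_rel_iff)
next
  assume "n \<in> carrier M \<and> t \<in> carrier R - p \<and> frac n t = frac m s"
  then show "(n, t) \<in> frac m s"
    using equiv_class_self[OF localization_rel_equiv, of "(n, t)"] by (auto simp: fraction_def)
qed

lemma frac_self: "m \<in> carrier M \<Longrightarrow> s \<in> carrier R - p \<Longrightarrow> (m, s) \<in> frac m s"
  by (simp add: frac_mem_iff)

lemma localization_carrier: "carrier (localization R p M) = {frac m s | m s. m \<in> carrier M \<and> s \<in> carrier R - p}"
  by (auto simp: localization_def quotient_def fraction_def)

lemma localization_zero: "\<zero>\<^bsub>localization R p M\<^esub> = frac \<zero>\<^bsub>M\<^esub> \<one>"
  by (simp add: localization_def)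

lemma localization_smult:
  assumes "a \<in> carrier R" "m \<in> carrier M" "s \<in> carrier R - p"
  shows "a \<odot>\<^bsub>localization R p M\<^esub> frac m s = frac (a \<odot>\<^bsub>M\<^esub> m) s"
proof -
  have "frac (a \<odot>\<^bsub>M\<^esub> n) t = frac (a \<odot>\<^bsub>M\<^esub> m) s" if nt: "(n, t) \<in> frac m s" for n t
  proof -
    have n: "n \<in> carrier M" "t \<in> carrier R - p" "frac n t = frac m s"
      using nt frac_mem_iff[OF assms(2,3)] by auto
    then obtain u where u: "u \<in> carrier R - p" "(u \<otimes> s) \<odot>\<^bsub>M\<^esub> n = (u \<otimes> t) \<odot>\<^bsub>M\<^esub> m"
      using n(3) unfolding frac_eq_iff[OF n(1,2) assms(2,3)] by blast
    have "(u \<otimes> s) \<odot>\<^bsub>M\<^esub> (a \<odot>\<^bsub>M\<^esub> n) = a \<odot>\<^bsub>M\<^esub> ((u \<otimes> s) \<odot>\<^bsub>M\<^esub> n)"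
      using assms n u(1) by (simp add: smult_assoc1[symmetric] R.m_comm)
    also have "\<dots> = (u \<otimes> t) \<odot>\<^bsub>M\<^esub> (a \<odot>\<^bsub>M\<^esub> m)"
      unfolding u(2) using assms n u(1) by (simp add: smult_assoc1[symmetric] R.m_comm)
    finally show ?thesis
      using u(1) by (subst frac_eq_iff[OF smult_closed[OF assms(1) n(1)] n(2) smult_closed[OF assms(1,2)] assms(3)]) blast
  qed
  then have "(\<Union>(n, t)\<in>frac m s. frac (a \<odot>\<^bsub>M\<^esub> n) t) = frac (a \<odot>\<^bsub>M\<^esub> m) s"
    by (intro UN_eq_const[OF frac_self[OF assms(2,3)]]) auto
  then show ?thesis by (simp add: localization_def)
qed

lemma localization_add:
  assumes "m \<in> carrier M" "s \<in> carrier R - p" "n \<in> carrier M" "t \<in> carrier R - p"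
  shows "frac m s \<oplus>\<^bsub>localization R p M\<^esub> frac n t = frac (t \<odot>\<^bsub>M\<^esub> m \<oplus>\<^bsub>M\<^esub> s \<odot>\<^bsub>M\<^esub> n) (s \<otimes> t)"
proof -
  have *: "frac (t' \<odot>\<^bsub>M\<^esub> m' \<oplus>\<^bsub>M\<^esub> s' \<odot>\<^bsub>M\<^esub> n') (s' \<otimes> t') = frac (t \<odot>\<^bsub>M\<^esub> m \<oplus>\<^bsub>M\<^esub> s \<odot>\<^bsub>M\<^esub> n) (s \<otimes> t)"
    if "(m', s') \<in> frac m s" "(n', t') \<in> frac n t" for m' s' n' t'
  proof -
    have m': "m' \<in> carrier M" "s' \<in> carrier R - p" "frac m' s' = frac m s"
      and n': "n' \<in> carrier M" "t' \<in> carrier R - p" "frac n' t' = frac n t"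
      using that frac_mem_iff assms by auto
    obtain u where u: "u \<in> carrier R - p" "(u \<otimes> s) \<odot>\<^bsub>M\<^esub> m' = (u \<otimes> s') \<odot>\<^bsub>M\<^esub> m"
      using m'(3) unfolding frac_eq_iff[OF m'(1,2) assms(1,2)] by blast
    obtain v where v: "v \<in> carrier R - p" "(v \<otimes> t) \<odot>\<^bsub>M\<^esub> n' = (v \<otimes> t') \<odot>\<^bsub>M\<^esub> n"
      using n'(3) unfolding frac_eq_iff[OF n'(1,2) assms(3,4)] by blast
    note R = denominatorD[OF u(1)] denominatorD[OF v(1)] denominatorD[OF assms(2)] denominatorD[OF assms(4)]
      denominatorD[OF m'(2)] denominatorD[OF n'(2)]
    have "((u \<otimes> v) \<otimes> (s \<otimes> t)) \<odot>\<^bsub>M\<^esub> (t' \<odot>\<^bsub>M\<^esub> m' \<oplus>\<^bsub>M\<^esub> s' \<odot>\<^bsub>M\<^esub> n')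
        = (v \<otimes> t \<otimes> t') \<odot>\<^bsub>M\<^esub> ((u \<otimes> s) \<odot>\<^bsub>M\<^esub> m') \<oplus>\<^bsub>M\<^esub> (u \<otimes> s \<otimes> s') \<odot>\<^bsub>M\<^esub> ((v \<otimes> t) \<odot>\<^bsub>M\<^esub> n')"
    proof -
      have 1: "((u \<otimes> v) \<otimes> (s \<otimes> t)) \<otimes> t' = (v \<otimes> t \<otimes> t') \<otimes> (u \<otimes> s)" using R by algebra
      have 2: "((u \<otimes> v) \<otimes> (s \<otimes> t)) \<otimes> s' = (u \<otimes> s \<otimes> s') \<otimes> (v \<otimes> t)" using R by algebra
      show ?thesis using R m' n' 1 2 by (simp add: smult_r_distr smult_assoc1[symmetric])
    qed
    also have "\<dots> = (v \<otimes> t \<otimes> t') \<odot>\<^bsub>M\<^esub> ((u \<otimes> s') \<odot>\<^bsub>M\<^esub> m) \<oplus>\<^bsub>M\<^esub> (u \<otimes> s \<otimes> s') \<odot>\<^bsub>M\<^esub> ((v \<otimes> t') \<odot>\<^bsub>M\<^esub> n)"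
      by (simp only: u(2) v(2))
    also have "\<dots> = ((u \<otimes> v) \<otimes> (s' \<otimes> t')) \<odot>\<^bsub>M\<^esub> (t \<odot>\<^bsub>M\<^esub> m \<oplus>\<^bsub>M\<^esub> s \<odot>\<^bsub>M\<^esub> n)"
    proof -
      have 1: "(v \<otimes> t \<otimes> t') \<otimes> (u \<otimes> s') = ((u \<otimes> v) \<otimes> (s' \<otimes> t')) \<otimes> t" using R by algebra
      have 2: "(u \<otimes> s \<otimes> s') \<otimes> (v \<otimes> t') = ((u \<otimes> v) \<otimes> (s' \<otimes> t')) \<otimes> s" using R by algebra
      show ?thesis using R assms 1 2 by (simp add: smult_r_distr smult_assoc1[symmetric])
    qed
    finally show ?thesis
      using p.mult_compl u(1) v(1) R m' n' assms
      by (subst frac_eq_iff) (auto simp del: Diff_iff intro!: p.mult_compl bexI[of _ "u \<otimes> v"])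
  qed
  have "(\<Union>(n', t')\<in>frac n t. frac (t' \<odot>\<^bsub>M\<^esub> m' \<oplus>\<^bsub>M\<^esub> s' \<odot>\<^bsub>M\<^esub> n') (s' \<otimes> t')) = frac (t \<odot>\<^bsub>M\<^esub> m \<oplus>\<^bsub>M\<^esub> s \<odot>\<^bsub>M\<^esub> n) (s \<otimes> t)"
    if "(m', s') \<in> frac m s" for m' s'
    by (rule UN_eq_const[OF frac_self[OF assms(3,4)]]) (use that * in auto)
  then have "(\<Union>(m', s')\<in>frac m s. \<Union>(n', t')\<in>frac n t. frac (t' \<odot>\<^bsub>M\<^esub> m' \<oplus>\<^bsub>M\<^esub> s' \<odot>\<^bsub>M\<^esub> n') (s' \<otimes> t')) = frac (t \<odot>\<^bsub>M\<^esub> m \<oplus>\<^bsub>M\<^esub> s \<odot>\<^bsub>M\<^esub> n) (s \<otimes> t)"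
    by (intro UN_eq_const[OF frac_self[OF assms(1,2)]]) auto
  then show ?thesis by (simp add: localization_def)
qed

lemma localization_module: "module R (localization R p M)"
proof -
  let ?L = "localization R p M"
  have mem: "frac m s \<in> carrier ?L" if "m \<in> carrier M" "s \<in> carrier R - p" for m s
    using that by (auto simp: localization_carrier)
  have "abelian_group ?L"
  proof (rule abelian_groupI)
    show "\<zero>\<^bsub>?L\<^esub> \<in> carrier ?L" unfolding localization_zero using p.one_compl by (intro mem) auto
    fix x assume "x \<in> carrier ?L"
    then obtain m s where x: "x = frac m s" "m \<in> carrier M" "s \<in> carrier R - p"
      by (auto simp: localization_carrier)
    note sR = denominatorD[OF x(3)]
    show "\<zero>\<^bsub>?L\<^esub> \<oplus>\<^bsub>?L\<^esub> x = x"
      unfolding localization_zero x(1) using x sR p.one_compl by (simp add: localization_add)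
    have "frac (s \<odot>\<^bsub>M\<^esub> (\<ominus>\<^bsub>M\<^esub> m) \<oplus>\<^bsub>M\<^esub> s \<odot>\<^bsub>M\<^esub> m) (s \<otimes> s) = frac \<zero>\<^bsub>M\<^esub> \<one>"
      using x sR p.one_compl p.mult_compl[OF x(3) x(3)]
      by (subst frac_eq_iff) (auto simp: smult_r_minus M.l_neg)
    then have "frac (\<ominus>\<^bsub>M\<^esub> m) s \<oplus>\<^bsub>?L\<^esub> x = \<zero>\<^bsub>?L\<^esub>"
      unfolding localization_zero x(1) using x by (simp add: localization_add)
    then show "\<exists>y\<in>carrier ?L. y \<oplus>\<^bsub>?L\<^esub> x = \<zero>\<^bsub>?L\<^esub>" using mem[of "\<ominus>\<^bsub>M\<^esub> m" s] x by auto
    fix y assume "y \<in> carrier ?L"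
    then obtain n t where y: "y = frac n t" "n \<in> carrier M" "t \<in> carrier R - p"
      by (auto simp: localization_carrier)
    note tR = denominatorD[OF y(3)]
    show "x \<oplus>\<^bsub>?L\<^esub> y \<in> carrier ?L"
      unfolding x(1) y(1) localization_add[OF x(2,3) y(2,3)]
      using x y sR tR p.mult_compl[OF x(3) y(3)] by (intro mem) auto
    show "x \<oplus>\<^bsub>?L\<^esub> y = y \<oplus>\<^bsub>?L\<^esub> x"
      unfolding x(1) y(1) localization_add[OF x(2,3) y(2,3)] localization_add[OF y(2,3) x(2,3)]
      using x y sR tR by (simp add: M.a_comm R.m_comm)
    fix z assume "z \<in> carrier ?L"
    then obtain q r where z: "z = frac q r" "q \<in> carrier M" "r \<in> carrier R - p"
      by (auto simp: localization_carrier)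
    note rR = denominatorD[OF z(3)]
    show "x \<oplus>\<^bsub>?L\<^esub> y \<oplus>\<^bsub>?L\<^esub> z = x \<oplus>\<^bsub>?L\<^esub> (y \<oplus>\<^bsub>?L\<^esub> z)"
    proof -
      have "r \<odot>\<^bsub>M\<^esub> (t \<odot>\<^bsub>M\<^esub> m \<oplus>\<^bsub>M\<^esub> s \<odot>\<^bsub>M\<^esub> n) \<oplus>\<^bsub>M\<^esub> (s \<otimes> t) \<odot>\<^bsub>M\<^esub> q =
          (t \<otimes> r) \<odot>\<^bsub>M\<^esub> m \<oplus>\<^bsub>M\<^esub> s \<odot>\<^bsub>M\<^esub> (r \<odot>\<^bsub>M\<^esub> n \<oplus>\<^bsub>M\<^esub> t \<odot>\<^bsub>M\<^esub> q)"
        using x y z sR tR rR R.m_comm[of t r] R.m_comm[of s r]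
        by (simp add: smult_r_distr smult_assoc1[symmetric] M.a_assoc)
      moreover have "s \<otimes> t \<otimes> r = s \<otimes> (t \<otimes> r)" using sR tR rR by (simp add: R.m_assoc)
      ultimately show ?thesis
        unfolding x(1) y(1) z(1) localization_add[OF x(2,3) y(2,3)] localization_add[OF y(2,3) z(2,3)]
        using x y z sR tR rR p.mult_compl[OF x(3) y(3)] p.mult_compl[OF y(3) z(3)]
        by (subst (1 2) localization_add) auto
    qed
  qed
  then show ?thesis
  proof (rule moduleI[OF R.is_cring])
    fix a x assume a: "a \<in> carrier R" and "x \<in> carrier ?L"
    then obtain m s where x: "x = frac m s" "m \<in> carrier M" "s \<in> carrier R - p"
      by (auto simp: localization_carrier)
    note sR = denominatorD[OF x(3)]
    show "a \<odot>\<^bsub>?L\<^esub> x \<in> carrier ?L" unfolding x(1) using a x by (simp add: localization_smult mem)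
    {
      fix b assume b: "b \<in> carrier R"
      show "(a \<otimes> b) \<odot>\<^bsub>?L\<^esub> x = a \<odot>\<^bsub>?L\<^esub> (b \<odot>\<^bsub>?L\<^esub> x)"
        unfolding x(1) using a b x by (simp add: localization_smult smult_assoc1)
      have "frac ((a \<oplus> b) \<odot>\<^bsub>M\<^esub> m) s = frac (s \<odot>\<^bsub>M\<^esub> (a \<odot>\<^bsub>M\<^esub> m) \<oplus>\<^bsub>M\<^esub> s \<odot>\<^bsub>M\<^esub> (b \<odot>\<^bsub>M\<^esub> m)) (s \<otimes> s)"
        using a b x sR p.one_compl p.mult_compl[OF x(3) x(3)]
        by (subst frac_eq_iff) (auto simp: smult_l_distr smult_r_distr smult_assoc1)
      then show "(a \<oplus> b) \<odot>\<^bsub>?L\<^esub> x = a \<odot>\<^bsub>?L\<^esub> x \<oplus>\<^bsub>?L\<^esub> b \<odot>\<^bsub>?L\<^esub> x"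
        unfolding x(1) using a b x by (simp add: localization_smult localization_add)
    }
    fix y assume "y \<in> carrier ?L"
    then obtain n t where y: "y = frac n t" "n \<in> carrier M" "t \<in> carrier R - p"
      by (auto simp: localization_carrier)
    note tR = denominatorD[OF y(3)]
    have "a \<odot>\<^bsub>M\<^esub> (t \<odot>\<^bsub>M\<^esub> m \<oplus>\<^bsub>M\<^esub> s \<odot>\<^bsub>M\<^esub> n) = t \<odot>\<^bsub>M\<^esub> (a \<odot>\<^bsub>M\<^esub> m) \<oplus>\<^bsub>M\<^esub> s \<odot>\<^bsub>M\<^esub> (a \<odot>\<^bsub>M\<^esub> n)"
      using a x y sR tR by (simp add: smult_r_distr smult_assoc1[symmetric] R.m_comm)
    then show "a \<odot>\<^bsub>?L\<^esub> (x \<oplus>\<^bsub>?L\<^esub> y) = a \<odot>\<^bsub>?L\<^esub> x \<oplus>\<^bsub>?L\<^esub> a \<odot>\<^bsub>?L\<^esub> y"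
      unfolding x(1) y(1) using a x y sR tR p.mult_compl[OF x(3) y(3)]
      by (simp add: localization_smult localization_add)
  next
    fix x assume "x \<in> carrier ?L"
    then show "\<one> \<odot>\<^bsub>?L\<^esub> x = x"
      by (auto simp: localization_carrier localization_smult)
  qed
qed

end

section \<open>Localization encoded by chosen representatives\<close>

locale adele_localization = module_localization R M p
  for R :: "('a, 'b) ring_scheme" (structure) and M :: "('a, 'a adele) module" (structure) and p
begin

definition fr :: "'a adele \<Rightarrow> 'a \<Rightarrow> 'a adele"
  where "fr m s = encode_fraction (fraction R p M m s)"

text \<open>The stored pair lies in the class it encodes and therefore determines it; this gives
  injectivity of the encoding, and with it the transport of all structure.\<close>

lemma encode_frac:
  assumes "m \<in> carrier M" "s \<in> carrier R - p"
  obtains n t where "fr m s = Fraction n t" "n \<in> carrier M" "t \<in> carrier R - p" "frac n t = frac m s"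
proof -
  obtain n t where nt: "(SOME z. z \<in> frac m s) = (n, t)" by (cases "SOME z. z \<in> frac m s")
  have "(n, t) \<in> frac m s"
    unfolding nt[symmetric] using frac_self[OF assms] by (rule someI)
  then have "n \<in> carrier M" "t \<in> carrier R - p" "frac n t = frac m s"
    by (simp_all add: frac_mem_iff[OF assms])
  moreover have "fr m s = Fraction n t" by (simp add: fr_def encode_fraction_def nt)
  ultimately show ?thesis using that by blast
qed

lemma encode_inj: "inj_on encode_fraction (carrier (localization R p M))"
proof (rule inj_onI)
  fix x y assume "x \<in> carrier (localization R p M)" "y \<in> carrier (localization R p M)"
    and eq: "encode_fraction x = encode_fraction y"
  then obtain m s n t where x: "x = frac m s" "m \<in> carrier M" "s \<in> carrier R - p"
    and y: "y = frac n t" "n \<in> carrier M" "t \<in> carrier R - p"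
    by (auto simp: localization_carrier)
  obtain m' s' where "fr m s = Fraction m' s'" "frac m' s' = frac m s" by (rule encode_frac[OF x(2,3)])
  moreover obtain n' t' where "fr n t = Fraction n' t'" "frac n' t' = frac n t" by (rule encode_frac[OF y(2,3)])
  ultimately show "x = y" using eq unfolding x(1) y(1) fr_def by simp
qed

lemma localize_module: "module R (localize R p M)"
  unfolding localize_def by (rule image_algebra_module[OF localization_module encode_inj])

lemma localize_carrier: "carrier (localize R p M) = {fr m s | m s. m \<in> carrier M \<and> s \<in> carrier R - p}"
  by (auto simp: localize_def localization_carrier fr_def)

lemma frac_in: "m \<in> carrier M \<Longrightarrow> s \<in> carrier R - p \<Longrightarrow> frac m s \<in> carrier (localization R p M)"
  by (auto simp: localization_carrier)

lemma fr_in: "m \<in> carrier M \<Longrightarrow> s \<in> carrier R - p \<Longrightarrow> fr m s \<in> carrier (localize R p M)"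
  by (auto simp: localize_carrier)

lemma fr_eq_iff:
  assumes "m \<in> carrier M" "s \<in> carrier R - p" "n \<in> carrier M" "t \<in> carrier R - p"
  shows "fr m s = fr n t \<longleftrightarrow> (\<exists>u\<in>carrier R - p. (u \<otimes> t) \<odot>\<^bsub>M\<^esub> m = (u \<otimes> s) \<odot>\<^bsub>M\<^esub> n)"
  unfolding fr_def inj_on_eq_iff[OF encode_inj frac_in[OF assms(1,2)] frac_in[OF assms(3,4)]]
  by (rule frac_eq_iff[OF assms])

lemma fr_repr:
  assumes "m \<in> carrier M" "s \<in> carrier R - p"
  shows "numerator (fr m s) \<in> carrier M" "denominator (fr m s) \<in> carrier R - p"
    "fr (numerator (fr m s)) (denominator (fr m s)) = fr m s"
proof -
  obtain n t where nt: "fr m s = Fraction n t" "n \<in> carrier M" "t \<in> carrier R - p" "frac n t = frac m s"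
    by (rule encode_frac[OF assms])
  then show "numerator (fr m s) \<in> carrier M" "denominator (fr m s) \<in> carrier R - p" by simp_all
  have "fr (numerator (fr m s)) (denominator (fr m s)) = fr n t" by (simp add: nt(1))
  also have "\<dots> = fr m s" by (simp add: fr_def nt(4))
  finally show "fr (numerator (fr m s)) (denominator (fr m s)) = fr m s" .
qed

lemma fr_smult:
  "a \<in> carrier R \<Longrightarrow> m \<in> carrier M \<Longrightarrow> s \<in> carrier R - p \<Longrightarrow> a \<odot>\<^bsub>localize R p M\<^esub> fr m s = fr (a \<odot>\<^bsub>M\<^esub> m) s"
  unfolding localize_def fr_def by (subst image_algebra_smult[OF encode_inj frac_in]) (simp_all add: localization_smult)

lemma fr_add:
  "m \<in> carrier M \<Longrightarrow> s \<in> carrier R - p \<Longrightarrow> n \<in> carrier M \<Longrightarrow> t \<in> carrier R - p \<Longrightarrow>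
    fr m s \<oplus>\<^bsub>localize R p M\<^esub> fr n t = fr (t \<odot>\<^bsub>M\<^esub> m \<oplus>\<^bsub>M\<^esub> s \<odot>\<^bsub>M\<^esub> n) (s \<otimes> t)"
  unfolding localize_def fr_def
  by (subst image_algebra_add[OF encode_inj frac_in frac_in]) (simp_all add: localization_add)

lemma fr_zero: "\<zero>\<^bsub>localize R p M\<^esub> = fr \<zero>\<^bsub>M\<^esub> \<one>"
  by (simp add: localize_def fr_def localization_zero)

lemma fr_cancel:
  assumes "m \<in> carrier M" "s \<in> carrier R - p" "u \<in> carrier R - p"
  shows "fr (u \<odot>\<^bsub>M\<^esub> m) (u \<otimes> s) = fr m s"
proof -
  have "(\<one> \<otimes> s) \<odot>\<^bsub>M\<^esub> (u \<odot>\<^bsub>M\<^esub> m) = (\<one> \<otimes> (u \<otimes> s)) \<odot>\<^bsub>M\<^esub> m"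
    using assms by (simp add: smult_assoc1[symmetric] R.m_comm)
  then show ?thesis
    using assms p.one_compl p.mult_compl[OF assms(3,2)] by (subst fr_eq_iff) blast+
qed

lemma to_localize_eq: "to_localize R p M m = fr m \<one>"
  by (simp add: to_localize_def fr_def)

lemma to_localize_hom: "to_localize R p M \<in> module_hom R M (localize R p M)"
  using p.one_compl
  by (intro module_homI) (auto simp: to_localize_eq fr_in fr_add fr_smult)

text \<open>Extending J commutes with localization: J times the localization of M is the
  localization of J M. A sum of multiples is brought to one common denominator, and conversely a
  multiplier u is cancelled as a unit.\<close>

lemma fr_in_ideal_span_iff:
  assumes J: "ideal J R" and m: "m \<in> carrier M" and s: "s \<in> carrier R - p"
  shows "fr m s \<in> ideal_span R J (localize R p M) \<longleftrightarrow> (\<exists>u\<in>carrier R - p. u \<odot>\<^bsub>M\<^esub> m \<in> ideal_span R J M)"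
proof
  interpret J: ideal J R by fact
  interpret L: module R "localize R p M" by (rule localize_module)
  assume "fr m s \<in> ideal_span R J (localize R p M)"
  moreover have "\<exists>n t. x = fr n t \<and> n \<in> ideal_span R J M \<and> t \<in> carrier R - p"
    if "x \<in> ideal_span R J (localize R p M)" for x
    using that
  proof (induct rule: ideal_span.induct)
    case zero
    then show ?case using p.one_compl fr_zero ideal_span.zero by blast
  next
    case (add_smult a l x)
    then obtain n t where nt: "x = fr n t" "n \<in> ideal_span R J M" "t \<in> carrier R - p" by blast
    obtain q r where qr: "l = fr q r" "q \<in> carrier M" "r \<in> carrier R - p"
      using add_smult(2) by (auto simp: localize_carrier)
    note nM = ideal_span_closed[OF J.a_subset nt(2)] and aR = J.a_Hcarr[OF add_smult(1)]
    have "a \<odot>\<^bsub>localize R p M\<^esub> l \<oplus>\<^bsub>localize R p M\<^esub> x = fr (t \<odot>\<^bsub>M\<^esub> (a \<odot>\<^bsub>M\<^esub> q) \<oplus>\<^bsub>M\<^esub> r \<odot>\<^bsub>M\<^esub> n) (r \<otimes> t)"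
      unfolding qr(1) nt(1) using qr nt nM aR by (simp add: fr_smult fr_add)
    moreover have "t \<odot>\<^bsub>M\<^esub> (a \<odot>\<^bsub>M\<^esub> q) \<oplus>\<^bsub>M\<^esub> r \<odot>\<^bsub>M\<^esub> n \<in> ideal_span R J M"
      using nt qr add_smult(1)
      by (intro ideal_span_facts(3,6)[OF J] smult_in_ideal_span[OF J.a_subset]) auto
    ultimately show ?case using p.mult_compl[OF qr(3) nt(3)] by blast
  qed
  ultimately obtain n t where nt: "fr m s = fr n t" "n \<in> ideal_span R J M" "t \<in> carrier R - p" by blast
  note nM = ideal_span_closed[OF J.a_subset nt(2)]
  obtain u where u: "u \<in> carrier R - p" "(u \<otimes> t) \<odot>\<^bsub>M\<^esub> m = (u \<otimes> s) \<odot>\<^bsub>M\<^esub> n"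
    using nt(1) fr_eq_iff[OF m s nM nt(3)] by blast
  have "(u \<otimes> t) \<odot>\<^bsub>M\<^esub> m \<in> ideal_span R J M"
    unfolding u(2) using u(1) s by (intro ideal_span_facts(6)[OF J _ nt(2)]) auto
  then show "\<exists>u\<in>carrier R - p. u \<odot>\<^bsub>M\<^esub> m \<in> ideal_span R J M" using p.mult_compl[OF u(1) nt(3)] by blast
next
  interpret J: ideal J R by fact
  interpret L: module R "localize R p M" by (rule localize_module)
  have fr_span: "x \<in> ideal_span R J M \<Longrightarrow> t \<in> carrier R - p \<Longrightarrow> fr x t \<in> ideal_span R J (localize R p M)" for x t
  proof (induct rule: ideal_span.induct)
    case zero
    have "fr \<zero>\<^bsub>M\<^esub> t = fr \<zero>\<^bsub>M\<^esub> \<one>"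
      using zero p.one_compl by (subst fr_eq_iff) auto
    then show ?case by (simp add: fr_zero[symmetric] ideal_span.zero)
  next
    case (add_smult a l x)
    note xM = ideal_span_closed[OF J.a_subset add_smult(3)] and aR = J.a_Hcarr[OF add_smult(1)]
      and tR = denominatorD[OF add_smult(5)]
    have "fr (a \<odot>\<^bsub>M\<^esub> l \<oplus>\<^bsub>M\<^esub> x) t = fr (t \<odot>\<^bsub>M\<^esub> (a \<odot>\<^bsub>M\<^esub> l \<oplus>\<^bsub>M\<^esub> x)) (t \<otimes> t)"
      using fr_cancel[of "a \<odot>\<^bsub>M\<^esub> l \<oplus>\<^bsub>M\<^esub> x" t t] add_smult xM aR by simp
    also have "\<dots> = a \<odot>\<^bsub>localize R p M\<^esub> fr l t \<oplus>\<^bsub>localize R p M\<^esub> fr x t"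
      using add_smult xM aR tR by (simp add: fr_smult fr_add smult_r_distr)
    finally show ?case
      using add_smult fr_in[OF add_smult(2,5)] by (simp add: ideal_span.add_smult)
  qed
  assume "\<exists>u\<in>carrier R - p. u \<odot>\<^bsub>M\<^esub> m \<in> ideal_span R J M"
  then obtain u where u: "u \<in> carrier R - p" "u \<odot>\<^bsub>M\<^esub> m \<in> ideal_span R J M" by blast
  then show "fr m s \<in> ideal_span R J (localize R p M)"
    using fr_span[OF u(2) p.mult_compl[OF u(1) s]] fr_cancel[OF m s u(1)] by simp
qed

lemma localize_colon_flat:
  assumes "colon_flat R M"
  shows "colon_flat R (localize R p M)"
  unfolding colon_flat_def
proof (intro allI impI)
  fix I r x assume I: "ideal I R" and r: "r \<in> carrier R" and x: "x \<in> carrier (localize R p M)"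
    and rx: "r \<odot>\<^bsub>localize R p M\<^esub> x \<in> ideal_span R I (localize R p M)"
  obtain m s where m: "x = fr m s" "m \<in> carrier M" "s \<in> carrier R - p"
    using x by (auto simp: localize_carrier)
  have "fr (r \<odot>\<^bsub>M\<^esub> m) s \<in> ideal_span R I (localize R p M)"
    using rx r m by (simp add: fr_smult)
  then obtain u where u: "u \<in> carrier R - p" "u \<odot>\<^bsub>M\<^esub> (r \<odot>\<^bsub>M\<^esub> m) \<in> ideal_span R I M"
    using fr_in_ideal_span_iff[OF I _ m(3)] r m by auto
  have "u \<odot>\<^bsub>M\<^esub> (r \<odot>\<^bsub>M\<^esub> m) = r \<odot>\<^bsub>M\<^esub> (u \<odot>\<^bsub>M\<^esub> m)"
    using u(1) r m by (simp add: smult_assoc1[symmetric] R.m_comm)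
  then have "u \<odot>\<^bsub>M\<^esub> m \<in> ideal_span R (colon R I r) M"
    using assms u I r m unfolding colon_flat_def by auto
  then show "x \<in> ideal_span R (colon R I r) (localize R p M)"
    unfolding m(1) using fr_in_ideal_span_iff[OF R.colon_ideal[OF I r] m(2,3)] u(1) by blast
qed

text \<open>The element a of J becomes a unit after localization at p. This is how factors at primes
  not containing a given ideal vanish modulo that ideal.\<close>

lemma localize_ideal_span_full:
  assumes J: "ideal J R" and "a \<in> J" "a \<notin> p" and x: "x \<in> carrier (localize R p M)"
  shows "x \<in> ideal_span R J (localize R p M)"
proof -
  obtain m s where m: "x = fr m s" "m \<in> carrier M" "s \<in> carrier R - p"
    using x by (auto simp: localize_carrier)
  show ?thesis
    unfolding m(1) fr_in_ideal_span_iff[OF J m(2,3)]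
    using assms m ideal.Icarr[OF J] by (intro bexI[of _ a] smult_in_ideal_span) auto
qed

end

text \<open>\<open>localize_map\<close> reads off the stored representative, which may differ from m
  and s; linearity of f makes the resulting fraction independent of that choice.\<close>

lemma localize_map_fr:
  assumes M: "adele_localization R M p" and N: "adele_localization R N p" and f: "f \<in> module_hom R M N"
    and m: "m \<in> carrier M" "s \<in> carrier R - p"
  shows "localize_map R p N f (adele_localization.fr R M p m s) = adele_localization.fr R N p (f m) s"
proof -
  interpret M: adele_localization R M p by fact
  interpret N: adele_localization R N p by fact
  note r = M.fr_repr[OF m]
  let ?n = "numerator (M.fr m s)" and ?d = "denominator (M.fr m s)"
  obtain u where u: "u \<in> carrier R - p"
      and eq: "(u \<otimes>\<^bsub>R\<^esub> s) \<odot>\<^bsub>M\<^esub> ?n = (u \<otimes>\<^bsub>R\<^esub> ?d) \<odot>\<^bsub>M\<^esub> m"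
    using r(3) M.fr_eq_iff[OF r(1,2) m] by blast
  have "(u \<otimes>\<^bsub>R\<^esub> s) \<odot>\<^bsub>N\<^esub> f ?n = f ((u \<otimes>\<^bsub>R\<^esub> s) \<odot>\<^bsub>M\<^esub> ?n)"
    using u m(2) by (intro module_hom_smult[OF f _ r(1), symmetric]) auto
  also have "\<dots> = (u \<otimes>\<^bsub>R\<^esub> ?d) \<odot>\<^bsub>N\<^esub> f m"
    unfolding eq using u r(2) by (intro module_hom_smult[OF f _ m(1)]) auto
  finally have "N.fr (f ?n) ?d = N.fr (f m) s"
    using N.fr_eq_iff[OF module_hom_closed[OF f r(1)] r(2) module_hom_closed[OF f m(1)] m(2)] u by blast
  then show ?thesis by (simp add: localize_map_def N.fr_def)
qed

lemma localize_map_hom: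
  assumes M: "adele_localization R M p" and N: "adele_localization R N p" and f: "f \<in> module_hom R M N"
  shows "localize_map R p N f \<in> module_hom R (localize R p M) (localize R p N)"
proof -
  interpret M: adele_localization R M p by fact
  interpret N: adele_localization R N p by fact
  note map = localize_map_fr[OF M N f] and c = module_hom_closed[OF f]
  show ?thesis
  proof (rule module_homI)
    fix x assume "x \<in> carrier (localize R p M)"
    then obtain m s where x: "x = M.fr m s" "m \<in> carrier M" "s \<in> carrier R - p"
      by (auto simp: M.localize_carrier)
    note s = M.denominatorD[OF x(3)]
    show "localize_map R p N f x \<in> carrier (localize R p N)"
      unfolding x(1) using x c by (simp add: map N.fr_in)
    show "localize_map R p N f (a \<odot>\<^bsub>localize R p M\<^esub> x) = a \<odot>\<^bsub>localize R p N\<^esub> localize_map R p N f x"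
      if "a \<in> carrier R" for a
      unfolding x(1) using x c that by (simp add: M.fr_smult map N.fr_smult module_hom_smult[OF f])
    fix y assume "y \<in> carrier (localize R p M)"
    then obtain n t where y: "y = M.fr n t" "n \<in> carrier M" "t \<in> carrier R - p"
      by (auto simp: M.localize_carrier)
    note t = M.denominatorD[OF y(3)]
    show "localize_map R p N f (x \<oplus>\<^bsub>localize R p M\<^esub> y) = localize_map R p N f x \<oplus>\<^bsub>localize R p N\<^esub> localize_map R p N f y"
      unfolding x(1) y(1) using x y c s t M.p.mult_compl[OF x(3) y(3)]
      by (simp add: M.fr_add map N.fr_add module_hom_smult[OF f] module_hom_add[OF f])
  qed
qed

section \<open>Adic completions\<close>

lemma (in ring) coset_project:
  assumes "ideal I R" "ideal J R" "J \<subseteq> I" "a \<in> carrier R"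
  shows "I <+> (J +> a) = I +> a"
proof -
  interpret I: ideal I R by fact
  interpret J: ideal J R by fact
  show ?thesis
  proof
    show "I <+> (J +> a) \<subseteq> I +> a"
    proof
      fix z assume "z \<in> I <+> (J +> a)"
      then obtain i j where ij: "i \<in> I" "j \<in> J" "z = i \<oplus> (j \<oplus> a)"
        unfolding set_add_def' a_r_coset_def' by blast
      then have "z = (i \<oplus> j) \<oplus> a" using assms(4) by (simp add: a_assoc I.Icarr J.Icarr)
      moreover have "i \<oplus> j \<in> I" using ij assms(3) by auto
      ultimately show "z \<in> I +> a" unfolding a_r_coset_def' by blast
    qed
    show "I +> a \<subseteq> I <+> (J +> a)"
    proof
      fix z assume "z \<in> I +> a"
      then obtain i where i: "i \<in> I" "z = i \<oplus> (\<zero> \<oplus> a)"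
        using assms(4) unfolding a_r_coset_def' by auto
      then show "z \<in> I <+> (J +> a)" unfolding set_add_def' a_r_coset_def' using J.zero_closed by blast
    qed
  qed
qed

lemma (in ring) coset_eq_iff:
  assumes "ideal I R" "a \<in> carrier R" "b \<in> carrier R"
  shows "I +> a = I +> b \<longleftrightarrow> a \<ominus> b \<in> I"
  using quotient_eq_iff_same_a_r_cos[OF assms] by simp

locale completion = noetherian_cring R + Q: ideal Q R for R (structure) and Q
begin

abbreviation P where "P n \<equiv> ideal_power R Q n"

lemma P_ideal: "ideal (P n) R"
  by (rule ideal_power_ideal[OF Q.is_ideal])

lemma P_facts: "\<zero> \<in> P n" "x \<in> P n \<Longrightarrow> y \<in> P n \<Longrightarrow> x \<oplus> y \<in> P n" "x \<in> P n \<Longrightarrow> \<ominus> x \<in> P n"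
  "x \<in> P n \<Longrightarrow> r \<in> carrier R \<Longrightarrow> r \<otimes> x \<in> P n" "x \<in> P n \<Longrightarrow> x \<in> carrier R"
proof -
  interpret P: ideal "P n" R by (rule P_ideal)
  show "\<zero> \<in> P n" "x \<in> P n \<Longrightarrow> y \<in> P n \<Longrightarrow> x \<oplus> y \<in> P n" "x \<in> P n \<Longrightarrow> \<ominus> x \<in> P n"
    "x \<in> P n \<Longrightarrow> r \<in> carrier R \<Longrightarrow> r \<otimes> x \<in> P n" "x \<in> P n \<Longrightarrow> x \<in> carrier R"
    by (auto intro: P.I_l_closed simp: P.Icarr)
qed

lemma P_antimono: "m \<le> n \<Longrightarrow> x \<in> P n \<Longrightarrow> x \<in> P m"
  using ideal_power_antimono[OF Q.is_ideal, of m n] by blast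

text \<open>Elements of the completion are handled through sequences of ring elements, with a n
  representing the class modulo the n-th power. Since the power with exponent 0 is R, the term a 0
  carries no information.\<close>

definition coherent :: "(nat \<Rightarrow> 'a) \<Rightarrow> bool"
  where "coherent a \<longleftrightarrow> (\<forall>n. a n \<in> carrier R \<and> a (Suc n) \<ominus> a n \<in> P n)"

definition adic :: "(nat \<Rightarrow> 'a) \<Rightarrow> nat \<Rightarrow> 'a set"
  where "adic a = (\<lambda>n. P n +> a n)"

lemma coherentD: "coherent a \<Longrightarrow> a n \<in> carrier R" "coherent a \<Longrightarrow> a (Suc n) \<ominus> a n \<in> P n"
  by (auto simp: coherent_def)

lemma coherent_le:
  assumes a: "coherent a" and mn: "m \<le> n"
  shows "a n \<ominus> a m \<in> P m"
  using mn
proof (induct n rule: dec_induct)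
  case base
  then show ?case using coherentD(1)[OF a, of m] P_facts(1) by (simp add: a_minus_def r_neg)
next
  case (step n)
  have "a (Suc n) \<ominus> a n \<in> P m"
    using coherentD(2)[OF a] P_antimono step(1) by blast
  then have "(a (Suc n) \<ominus> a n) \<oplus> (a n \<ominus> a m) \<in> P m" using step(3) P_facts(2) by blast
  moreover have "(a (Suc n) \<ominus> a n) \<oplus> (a n \<ominus> a m) = a (Suc n) \<ominus> a m"
    using coherentD(1)[OF a, of "Suc n"] coherentD(1)[OF a, of n] coherentD(1)[OF a, of m]
    by algebra
  ultimately show ?case by simp
qed

lemma adic_eq_iff:
  "(\<And>n. a n \<in> carrier R) \<Longrightarrow> (\<And>n. b n \<in> carrier R) \<Longrightarrow> adic a = adic b \<longleftrightarrow> (\<forall>n. a n \<ominus> b n \<in> P n)"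
  unfolding adic_def fun_eq_iff using coset_eq_iff[OF P_ideal] by simp

lemma adic_carrier: "carrier (adic_completion R Q) = {adic a | a. coherent a}"
proof
  have proj: "P n <+> (P (Suc n) +> a) = P n +> a" if "a \<in> carrier R" for n a
    by (rule coset_project[OF P_ideal P_ideal ideal_power_antimono[OF Q.is_ideal le_SucI[OF order_refl]] that])
  show "carrier (adic_completion R Q) \<subseteq> {adic a | a. coherent a}"
  proof
    fix x assume "x \<in> carrier (adic_completion R Q)"
    then have x: "\<And>n. x n \<in> a_rcosets (P n)" and xs: "\<And>n. P n <+> x (Suc n) = x n"
      by (auto simp: adic_completion_def FactRing_def)
    from x have "\<forall>n. \<exists>a\<in>carrier R. x n = P n +> a" by (auto simp: A_RCOSETS_def')
    then obtain a where a: "\<And>n. a n \<in> carrier R" "\<And>n. x n = P n +> a n" by metis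
    have "P n +> a (Suc n) = P n +> a n" for n
      using xs[of n] unfolding a(2) proj[OF a(1)] .
    then have "coherent a" using a(1) by (simp add: coherent_def coset_eq_iff[OF P_ideal])
    moreover have "x = adic a" using a(2) by (auto simp: adic_def)
    ultimately show "x \<in> {adic a | a. coherent a}" by blast
  qed
  show "{adic a | a. coherent a} \<subseteq> carrier (adic_completion R Q)"
  proof
    fix x assume "x \<in> {adic a | a. coherent a}"
    then obtain a where a: "x = adic a" "coherent a" by blast
    have "P n +> a (Suc n) = P n +> a n" for n
      using coherentD[OF a(2)] by (simp add: coset_eq_iff[OF P_ideal])
    moreover have "P n +> a n \<in> a_rcosets (P n)" for n
      using coherentD(1)[OF a(2)] P_facts(5) by (intro a_rcosetsI) auto
    ultimately show "x \<in> carrier (adic_completion R Q)"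
      using proj[OF coherentD(1)[OF a(2)]] by (simp add: a(1) adic_def adic_completion_def FactRing_def)
  qed
qed

lemma coherent_const: "r \<in> carrier R \<Longrightarrow> coherent (\<lambda>n. r)"
  using P_facts(1) by (simp add: coherent_def a_minus_def r_neg)

lemma coherent_add:
  assumes "coherent a" "coherent b"
  shows "coherent (\<lambda>n. a n \<oplus> b n)"
  unfolding coherent_def
proof (intro allI conjI)
  fix n
  note c = coherentD(1)[OF assms(1), of n] coherentD(1)[OF assms(1), of "Suc n"]
    coherentD(1)[OF assms(2), of n] coherentD(1)[OF assms(2), of "Suc n"]
  have "(a (Suc n) \<oplus> b (Suc n)) \<ominus> (a n \<oplus> b n) = (a (Suc n) \<ominus> a n) \<oplus> (b (Suc n) \<ominus> b n)"
    using c by algebra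
  then show "(a (Suc n) \<oplus> b (Suc n)) \<ominus> (a n \<oplus> b n) \<in> P n"
    using coherentD(2)[OF assms(1)] coherentD(2)[OF assms(2)] P_facts(2) by simp
qed (simp add: coherentD[OF assms(1)] coherentD[OF assms(2)])

lemma coherent_mult:
  assumes "r \<in> carrier R" "coherent a"
  shows "coherent (\<lambda>n. r \<otimes> a n)"
  unfolding coherent_def
proof (intro allI conjI)
  fix n
  have "r \<otimes> a (Suc n) \<ominus> r \<otimes> a n = r \<otimes> (a (Suc n) \<ominus> a n)"
    using coherentD(1)[OF assms(2), of n] coherentD(1)[OF assms(2), of "Suc n"] assms(1) by algebra
  then show "r \<otimes> a (Suc n) \<ominus> r \<otimes> a n \<in> P n"
    using coherentD(2)[OF assms(2)] P_facts(4) assms(1) by simp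
qed (simp add: coherentD[OF assms(2)] assms(1))

lemma adic_add: "coherent a \<Longrightarrow> coherent b \<Longrightarrow>
    adic a \<oplus>\<^bsub>adic_completion R Q\<^esub> adic b = adic (\<lambda>n. a n \<oplus> b n)"
  by (auto simp: adic_completion_def FactRing_def adic_def coherentD(1) fun_eq_iff
      abelian_subgroup.a_rcos_sum ideal.axioms(1) P_ideal ideal.a_rcos_sum[OF P_ideal])

lemma adic_zero: "\<zero>\<^bsub>adic_completion R Q\<^esub> = adic (\<lambda>n. \<zero>)"
  using P_facts(5) by (auto simp: adic_completion_def FactRing_def adic_def fun_eq_iff subset_iff)

lemma adic_smult: "r \<in> carrier R \<Longrightarrow> coherent a \<Longrightarrow>
    r \<odot>\<^bsub>adic_completion R Q\<^esub> adic a = adic (\<lambda>n. r \<otimes> a n)"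
  by (auto simp: adic_completion_def FactRing_def adic_def fun_eq_iff coherentD(1)
      ideal.rcoset_mult_add[OF P_ideal])

lemma adic_in: "coherent a \<Longrightarrow> adic a \<in> carrier (adic_completion R Q)"
  by (auto simp: adic_carrier)

lemma adic_module: "module R (adic_completion R Q)"
proof -
  let ?C = "adic_completion R Q"
  note ops = adic_add adic_zero adic_smult coherent_add coherent_mult adic_in coherentD(1)
  have "abelian_group ?C"
  proof (rule abelian_groupI)
    show "\<zero>\<^bsub>?C\<^esub> \<in> carrier ?C" by (simp add: adic_zero adic_in coherent_const)
    fix x assume "x \<in> carrier ?C"
    then obtain a where a: "x = adic a" "coherent a" by (auto simp: adic_carrier)
    show "\<zero>\<^bsub>?C\<^esub> \<oplus>\<^bsub>?C\<^esub> x = x"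
      using a by (simp add: ops coherent_const)
    have na: "coherent (\<lambda>n. \<ominus> \<one> \<otimes> a n)" by (rule coherent_mult[OF _ a(2)]) simp
    have "adic (\<lambda>n. \<ominus> \<one> \<otimes> a n) \<oplus>\<^bsub>?C\<^esub> x = \<zero>\<^bsub>?C\<^esub>"
      using a na by (simp add: adic_add adic_zero coherentD(1) l_minus l_neg)
    then show "\<exists>y\<in>carrier ?C. y \<oplus>\<^bsub>?C\<^esub> x = \<zero>\<^bsub>?C\<^esub>" using adic_in[OF na] by blast
    fix y assume "y \<in> carrier ?C"
    then obtain b where b: "y = adic b" "coherent b" by (auto simp: adic_carrier)
    show "x \<oplus>\<^bsub>?C\<^esub> y \<in> carrier ?C" "x \<oplus>\<^bsub>?C\<^esub> y = y \<oplus>\<^bsub>?C\<^esub> x"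
      using a b by (simp_all add: ops a_comm)
    fix z assume "z \<in> carrier ?C"
    then obtain c where c: "z = adic c" "coherent c" by (auto simp: adic_carrier)
    show "x \<oplus>\<^bsub>?C\<^esub> y \<oplus>\<^bsub>?C\<^esub> z = x \<oplus>\<^bsub>?C\<^esub> (y \<oplus>\<^bsub>?C\<^esub> z)"
      using a b c by (simp add: ops a_assoc)
  qed
  then show ?thesis
  proof (rule moduleI[OF is_cring])
    fix r x assume r: "r \<in> carrier R" and "x \<in> carrier ?C"
    then obtain a where a: "x = adic a" "coherent a" by (auto simp: adic_carrier)
    show "r \<odot>\<^bsub>?C\<^esub> x \<in> carrier ?C" using a r by (simp add: ops)
    show "(r \<oplus> s) \<odot>\<^bsub>?C\<^esub> x = r \<odot>\<^bsub>?C\<^esub> x \<oplus>\<^bsub>?C\<^esub> s \<odot>\<^bsub>?C\<^esub> x" "(r \<otimes> s) \<odot>\<^bsub>?C\<^esub> x = r \<odot>\<^bsub>?C\<^esub> (s \<odot>\<^bsub>?C\<^esub> x)"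
      if "s \<in> carrier R" for s
      using a r that by (simp_all add: ops l_distr m_assoc)
    fix y assume "y \<in> carrier ?C"
    then obtain b where b: "y = adic b" "coherent b" by (auto simp: adic_carrier)
    show "r \<odot>\<^bsub>?C\<^esub> (x \<oplus>\<^bsub>?C\<^esub> y) = r \<odot>\<^bsub>?C\<^esub> x \<oplus>\<^bsub>?C\<^esub> r \<odot>\<^bsub>?C\<^esub> y"
      using a b r by (simp add: ops r_distr)
  next
    fix x assume "x \<in> carrier ?C"
    then obtain a where a: "x = adic a" "coherent a" by (auto simp: adic_carrier)
    show "\<one> \<odot>\<^bsub>?C\<^esub> x = x" using a by (simp add: ops)
  qed
qed

lemma adic_finsum:
  assumes "finite A" "\<And>x. x \<in> A \<Longrightarrow> coherent (u x)"
  shows "coherent (\<lambda>n. \<Oplus>x\<in>A. u x n)"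
    and "(\<Oplus>\<^bsub>adic_completion R Q\<^esub>x\<in>A. adic (u x)) = adic (\<lambda>n. \<Oplus>x\<in>A. u x n)"
proof -
  interpret C: module R "adic_completion R Q" by (rule adic_module)
  have "coherent (\<lambda>n. \<Oplus>x\<in>A. u x n) \<and>
      (\<Oplus>\<^bsub>adic_completion R Q\<^esub>x\<in>A. adic (u x)) = adic (\<lambda>n. \<Oplus>x\<in>A. u x n)"
    using assms
  proof (induct A)
    case empty
    show ?case by (simp add: coherent_const adic_zero)
  next
    case (insert x A)
    have "(\<Oplus>y\<in>insert x A. u y n) = u x n \<oplus> (\<Oplus>y\<in>A. u y n)" for n
      using insert by (intro finsum_insert) (auto simp: coherentD)
    moreover have "(\<Oplus>\<^bsub>adic_completion R Q\<^esub>y\<in>insert x A. adic (u y)) =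
        adic (u x) \<oplus>\<^bsub>adic_completion R Q\<^esub> (\<Oplus>\<^bsub>adic_completion R Q\<^esub>y\<in>A. adic (u y))"
      using insert by (intro C.M.finsum_insert) (auto simp: adic_in)
    ultimately show ?case
      using insert by (simp add: coherent_add adic_add)
  qed
  then show "coherent (\<lambda>n. \<Oplus>x\<in>A. u x n)"
    "(\<Oplus>\<^bsub>adic_completion R Q\<^esub>x\<in>A. adic (u x)) = adic (\<lambda>n. \<Oplus>x\<in>A. u x n)" by blast+
qed

text \<open>Applying \<open>ideal_span_Idl\<close> to K itself, regarded as an R-module, keeps the
  coefficients in K. This control is what makes the coefficient sequences in the completion
  coherent.\<close>

lemma ideal_prod_Idl:
  assumes A: "A \<subseteq> carrier R" "finite A" and K: "ideal K R" and c: "c \<in> ideal_prod R (Idl A) K"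
  shows "\<exists>g\<in>A \<rightarrow> K. c = (\<Oplus>x\<in>A. x \<otimes> g x)"
proof -
  interpret K: ideal K R by fact
  define N where "N = (self_algebra R)\<lparr>carrier := K\<rparr>"
  have N_simps: "carrier N = K" "\<And>x y. x \<oplus>\<^bsub>N\<^esub> y = x \<oplus> y" "\<And>x y. x \<odot>\<^bsub>N\<^esub> y = x \<otimes> y" "\<zero>\<^bsub>N\<^esub> = \<zero>"
    by (simp_all add: N_def self_algebra_def)
  have "abelian_group N"
  proof (rule abelian_groupI)
    fix x assume "x \<in> carrier N"
    then show "\<exists>y\<in>carrier N. y \<oplus>\<^bsub>N\<^esub> x = \<zero>\<^bsub>N\<^esub>"
      by (intro bexI[of _ "\<ominus> x"]) (auto simp: N_simps l_neg K.Icarr)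
  qed (auto simp: N_simps a_ac K.Icarr)
  then interpret N: module R N
    by (intro moduleI is_cring) (auto simp: N_simps K.I_l_closed l_distr r_distr m_assoc K.Icarr)
  have sub: "Idl A \<subseteq> carrier R"
    by (rule additive_subgroup.a_subset[OF ideal.axioms(1)[OF genideal_ideal[OF A(1)]]])
  have "c \<in> ideal_span R (Idl A) N"
    using c
  proof (induct rule: ideal_prod.induct)
    case (prod i j)
    then show ?case using N.smult_in_ideal_span[OF sub prod(1), of j] by (simp add: N_simps)
  next
    case (sum x y)
    then show ?case using N.ideal_span_add[OF sub sum(2,4)] by (simp add: N_simps)
  qed
  then obtain g where g: "g \<in> A \<rightarrow> K" "c = (\<Oplus>\<^bsub>N\<^esub>x\<in>A. x \<odot>\<^bsub>N\<^esub> g x)"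
    using N.ideal_span_Idl[OF A(2,1)] by (metis N_simps(1))
  have "(\<Oplus>\<^bsub>N\<^esub>x\<in>A. x \<odot>\<^bsub>N\<^esub> g x) = (\<Oplus>x\<in>A. x \<otimes> g x)"
    using A(2,1) g(1)
  proof (induct A)
    case (insert x A)
    have "(\<Oplus>\<^bsub>N\<^esub>x\<in>insert x A. x \<odot>\<^bsub>N\<^esub> g x) = x \<odot>\<^bsub>N\<^esub> g x \<oplus>\<^bsub>N\<^esub> (\<Oplus>\<^bsub>N\<^esub>x\<in>A. x \<odot>\<^bsub>N\<^esub> g x)"
      using insert by (intro N.M.finsum_insert) (auto simp: N_simps intro!: K.I_l_closed)
    moreover have "(\<Oplus>x\<in>insert x A. x \<otimes> g x) = x \<otimes> g x \<oplus> (\<Oplus>x\<in>A. x \<otimes> g x)"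
      using insert by (intro finsum_insert) (auto simp: K.Icarr subset_iff Pi_iff)
    ultimately show ?case using insert by (simp add: N_simps)
  qed (simp add: N_simps)
  then show ?thesis using g by auto
qed

section \<open>Extended ideals and flatness of the completion\<close>

lemma in_sum_ideals: "u \<in> J \<Longrightarrow> v \<in> P n \<Longrightarrow> u \<oplus> v \<in> J <+> P n"
  by (auto simp: set_add_def')

text \<open>The right side describes the limit of the (J + Q^n)/Q^n. Multiples by J clearly have
  representatives in J at every level. Conversely, representatives in J are chosen along a sparse
  subsequence; by Artin-Rees their differences expand over fixed generators of J with coefficients
  in growing powers of Q, and the coefficients sum up in the completion.\<close>

lemma adic_ideal_span_iff:
  assumes J: "ideal J R" and a: "coherent a"
  shows "adic a \<in> ideal_span R J (adic_completion R Q) \<longleftrightarrow> (\<forall>n. a n \<in> J <+> P n)"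
proof
  interpret J: ideal J R by fact
  assume "adic a \<in> ideal_span R J (adic_completion R Q)"
  moreover have "\<exists>b. x = adic b \<and> coherent b \<and> (\<forall>n. b n \<in> J)"
    if "x \<in> ideal_span R J (adic_completion R Q)" for x
    using that
  proof (induct rule: ideal_span.induct)
    case zero
    show ?case using adic_zero coherent_const[of \<zero>] by (intro exI[of _ "\<lambda>n. \<zero>"]) auto
  next
    case (add_smult r m x)
    obtain b where b: "x = adic b" "coherent b" "\<And>n. b n \<in> J" using add_smult by blast
    obtain c where c: "m = adic c" "coherent c" using add_smult(2) by (auto simp: adic_carrier)
    have r: "r \<in> carrier R" using add_smult(1) by (simp add: J.Icarr)
    show ?case
      using b c r add_smult(1) coherentD(1)[OF c(2)]
      by (intro exI[of _ "\<lambda>n. r \<otimes> c n \<oplus> b n"])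
        (auto simp: adic_smult adic_add coherent_add coherent_mult intro!: J.I_r_closed)
  qed
  ultimately obtain b where b: "adic a = adic b" "coherent b" "\<And>n. b n \<in> J" by blast
  show "\<forall>n. a n \<in> J <+> P n"
  proof
    fix n
    have "a n \<ominus> b n \<in> P n" using b(1) adic_eq_iff[of a b] coherentD(1) a b(2) by blast
    moreover have "a n = b n \<oplus> (a n \<ominus> b n)"
      using coherentD(1)[OF a, of n] coherentD(1)[OF b(2), of n] by algebra
    ultimately show "a n \<in> J <+> P n" using in_sum_ideals[OF b(3)] by metis
  qed
next
  interpret J: ideal J R by fact
  interpret C: module R "adic_completion R Q" by (rule adic_module)
  assume aJ: "\<forall>n. a n \<in> J <+> P n"
  obtain A where A: "A \<subseteq> carrier R" "finite A" "J = Idl A" using finetely_gen[OF J] by blast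
  have "\<forall>m. \<exists>e. J \<inter> P e \<subseteq> ideal_prod R J (P m)"
    using artin_rees_inter[OF J Q.is_ideal] by metis
  then obtain e where e: "\<And>m. J \<inter> P (e m) \<subseteq> ideal_prod R J (P m)" by metis
  \<comment> \<open>The bounds e come from Artin-Rees; summing them makes k monotone while
    \<open>k m\<close> stays at least as large as both e m and m.\<close>
  define k where "k m = (\<Sum>i\<le>m. e i) + m" for m
  have k: "e m \<le> k m" "m \<le> k m" "k m \<le> k (Suc m)" for m
    by (auto simp: k_def intro!: member_le_sum trans_le_add1)
  have "\<forall>m. \<exists>b\<in>J. a (k m) \<ominus> b \<in> P (k m)"
  proof
    fix m
    obtain b v where bv: "b \<in> J" "v \<in> P (k m)" "a (k m) = b \<oplus> v"
      using aJ unfolding set_add_def' by blast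
    have "a (k m) \<ominus> b = v"
      unfolding bv(3) using J.Icarr[OF bv(1)] P_facts(5)[OF bv(2)] by algebra
    then show "\<exists>b\<in>J. a (k m) \<ominus> b \<in> P (k m)" using bv by blast
  qed
  then obtain b where b: "\<And>m. b m \<in> J" "\<And>m. a (k m) \<ominus> b m \<in> P (k m)" by metis
  have bR: "b m \<in> carrier R" for m using J.Icarr[OF b(1)] .
  note aR = coherentD(1)[OF a]
  have diff: "b (Suc m) \<ominus> b m \<in> J \<inter> P (k m)" for m
  proof
    show "b (Suc m) \<ominus> b m \<in> J" unfolding a_minus_def using b(1) by simp
    have 1: "\<ominus> (a (k (Suc m)) \<ominus> b (Suc m)) \<in> P (k m)"
      using P_facts(3) P_antimono[OF k(3) b(2)] by blast
    have 2: "a (k (Suc m)) \<ominus> a (k m) \<in> P (k m)" by (rule coherent_le[OF a k(3)])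
    have "b (Suc m) \<ominus> b m = (\<ominus> (a (k (Suc m)) \<ominus> b (Suc m)) \<oplus> (a (k (Suc m)) \<ominus> a (k m))) \<oplus> (a (k m) \<ominus> b m)"
      using bR[of m] bR[of "Suc m"] aR[of "k m"] aR[of "k (Suc m)"] by algebra
    then show "b (Suc m) \<ominus> b m \<in> P (k m)" using P_facts(2)[OF P_facts(2)[OF 1 2] b(2)] by simp
  qed
  \<comment> \<open>The difference lies in J and in \<open>P (k m)\<close>, hence in J times
    \<open>P m\<close> by the choice of k, so the coefficients tend to zero adically.\<close>
  have "\<forall>m. \<exists>g\<in>A \<rightarrow> P m. b (Suc m) \<ominus> b m = (\<Oplus>x\<in>A. x \<otimes> g x)"
  proof
    fix m
    have "b (Suc m) \<ominus> b m \<in> ideal_prod R (Idl A) (P m)"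
      using diff[of m] e[of m] P_antimono[OF k(1), of _ m] unfolding A(3) by blast
    then show "\<exists>g\<in>A \<rightarrow> P m. b (Suc m) \<ominus> b m = (\<Oplus>x\<in>A. x \<otimes> g x)"
      by (rule ideal_prod_Idl[OF A(1,2) P_ideal])
  qed
  then obtain g where g: "\<And>m. g m \<in> A \<rightarrow> P m" "\<And>m. b (Suc m) \<ominus> b m = (\<Oplus>x\<in>A. x \<otimes> g m x)" by metis
  have "b 0 \<in> ideal_prod R (Idl A) (carrier R)"
    using ideal_prod.prod[of "b 0" J \<one> "carrier R" R] b(1)[of 0] bR[of 0] unfolding A(3) by simp
  then obtain h where h: "h \<in> A \<rightarrow> carrier R" "b 0 = (\<Oplus>x\<in>A. x \<otimes> h x)"
    using ideal_prod_Idl[OF A(1,2) oneideal] by blast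
  \<comment> \<open>Partial sums of the coefficients of the generator x. The increment g m x lies in
    \<open>P m\<close>, which is coherence.\<close>
  define f where "f x = rec_nat (h x) (\<lambda>m y. y \<oplus> g m x)" for x
  have f_0: "f x 0 = h x" and f_Suc: "f x (Suc m) = f x m \<oplus> g m x" for x m by (simp_all add: f_def)
  have gR: "g m x \<in> carrier R" if "x \<in> A" for m x using g(1)[of m] that P_facts(5) by blast
  have fR: "f x m \<in> carrier R" if "x \<in> A" for x m
    using that h(1) gR by (induct m) (auto simp: f_0 f_Suc)
  have AR: "x \<in> carrier R" if "x \<in> A" for x using A(1) that by blast
  have f: "coherent (f x)" if x: "x \<in> A" for x
    unfolding coherent_def
  proof (intro allI conjI fR[OF x])
    fix n
    have "f x (Suc n) \<ominus> f x n = g n x" unfolding f_Suc using fR[OF x, of n] gR[OF x, of n] by algebra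
    then show "f x (Suc n) \<ominus> f x n \<in> P n" using g(1)[of n] x by auto
  qed
  have b_sum: "b m = (\<Oplus>x\<in>A. x \<otimes> f x m)" for m
  proof (induct m)
    case 0
    show ?case using h(2) by (simp add: f_0)
  next
    case (Suc m)
    have "b (Suc m) = b m \<oplus> (b (Suc m) \<ominus> b m)" using bR[of m] bR[of "Suc m"] by algebra
    also have "\<dots> = (\<Oplus>x\<in>A. x \<otimes> f x m) \<oplus> (\<Oplus>x\<in>A. x \<otimes> g m x)" by (simp only: g(2) Suc[symmetric])
    also have "\<dots> = (\<Oplus>x\<in>A. x \<otimes> f x m \<oplus> x \<otimes> g m x)"
      using fR gR AR by (intro finsum_addf[symmetric]) auto
    also have "\<dots> = (\<Oplus>x\<in>A. x \<otimes> f x (Suc m))"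
      using fR gR AR by (intro finsum_cong') (auto simp: f_Suc r_distr)
    finally show ?case .
  qed
  have "(\<Oplus>\<^bsub>adic_completion R Q\<^esub>x\<in>A. adic (\<lambda>n. x \<otimes> f x n)) = adic b"
    using adic_finsum(2)[of A "\<lambda>x n. x \<otimes> f x n"] A(2) coherent_mult[OF AR f] by (simp add: b_sum[symmetric])
  moreover have "adic (\<lambda>n. x \<otimes> f x n) \<in> ideal_span R J (adic_completion R Q)" if x: "x \<in> A" for x
    unfolding adic_smult[OF AR[OF x] f[OF x], symmetric] A(3)
    using genideal_self[OF A(1)] x J.a_subset unfolding A(3)
    by (intro C.smult_in_ideal_span adic_in f) auto
  ultimately have "adic b \<in> ideal_span R J (adic_completion R Q)"
    using C.ideal_span_facts(7)[OF J, of A "\<lambda>x. adic (\<lambda>n. x \<otimes> f x n)"] by simp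
  moreover have "adic a = adic b"
  proof -
    \<comment> \<open>Modulo \<open>P m\<close> the term a (k m) agrees with a m by coherence, and
      it agrees with b m even modulo \<open>P (k m)\<close>.\<close>
    have "a m \<ominus> b m \<in> P m" for m
    proof -
      have "\<ominus> (a (k m) \<ominus> a m) \<oplus> (a (k m) \<ominus> b m) \<in> P m"
        using P_facts(2,3) coherent_le[OF a k(2)] P_antimono[OF k(2) b(2)] by blast
      moreover have "\<ominus> (a (k m) \<ominus> a m) \<oplus> (a (k m) \<ominus> b m) = a m \<ominus> b m"
        using aR[of m] aR[of "k m"] bR[of m] by algebra
      ultimately show ?thesis by simp
    qed
    then show ?thesis using adic_eq_iff[of a b] aR bR by blast
  qed
  ultimately show "adic a \<in> ideal_span R J (adic_completion R Q)" by simp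
qed

text \<open>Membership in an extended ideal is a condition at each finite level, so flatness reduces
  to comparing (J + Q^n : r) with (J : r) + Q^m, which is \<open>artin_rees_colon\<close>.\<close>

lemma adic_colon_flat: "colon_flat R (adic_completion R Q)"
  unfolding colon_flat_def
proof (intro allI impI)
  fix J r x assume J: "ideal J R" and r: "r \<in> carrier R" and x: "x \<in> carrier (adic_completion R Q)"
    and rx: "r \<odot>\<^bsub>adic_completion R Q\<^esub> x \<in> ideal_span R J (adic_completion R Q)"
  interpret J: ideal J R by (rule J)
  obtain a where a: "x = adic a" "coherent a" using x by (auto simp: adic_carrier)
  have ra: "r \<otimes> a n \<in> J <+> P n" for n
    using rx adic_ideal_span_iff[OF J coherent_mult[OF r a(2)]] unfolding a(1) adic_smult[OF r a(2)] by blast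
  have "a m \<in> colon R J r <+> P m" for m
  proof -
    obtain n where n: "colon R (J <+> P n) r \<subseteq> colon R J r <+> P m"
      using artin_rees_colon[OF J Q.is_ideal r] by blast
    \<comment> \<open>Level k is at least n, so that the colon inclusion applies to a k, and at
      least m, so that the result passes to a m.\<close>
    define k where "k = max n m"
    have "r \<otimes> a k \<in> J <+> P n"
      using ra[of k] P_antimono[of n k] unfolding set_add_def' k_def by fastforce
    then have "a k \<in> colon R J r <+> P m" using n coherentD(1)[OF a(2)] by (auto simp: colon_def)
    then obtain c v where cv: "c \<in> colon R J r" "v \<in> P m" "a k = c \<oplus> v" unfolding set_add_def' by blast
    have "a k \<ominus> a m \<in> P m" by (rule coherent_le[OF a(2)]) (simp add: k_def)
    then have "v \<oplus> \<ominus> (a k \<ominus> a m) \<in> P m" using P_facts(2,3) cv(2) by blast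
    moreover have "c \<in> carrier R" using cv(1) by (simp add: colon_def)
    then have "a m = c \<oplus> (v \<oplus> \<ominus> (a k \<ominus> a m))"
      unfolding cv(3) using coherentD(1)[OF a(2), of m] P_facts(5)[OF cv(2)] by algebra
    ultimately show ?thesis using in_sum_ideals[OF cv(1)] by metis
  qed
  then show "x \<in> ideal_span R (colon R J r) (adic_completion R Q)"
    unfolding a(1) using adic_ideal_span_iff[OF colon_ideal[OF J r] a(2)] by blast
qed

end

section \<open>The adelic cube\<close>

lemma (in cring) self_algebra_module: "module R (self_algebra R)"
proof -
  have "abelian_group (self_algebra R)"
  proof (rule abelian_groupI)
    fix x assume "x \<in> carrier (self_algebra R)"
    then show "\<exists>y\<in>carrier (self_algebra R). y \<oplus>\<^bsub>self_algebra R\<^esub> x = \<zero>\<^bsub>self_algebra R\<^esub>"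
      by (intro bexI[of _ "\<ominus> x"]) (auto simp: self_algebra_def l_neg)
  qed (auto simp: self_algebra_def a_ac)
  then show ?thesis
    by (intro moduleI is_cring) (auto simp: self_algebra_def l_distr r_distr m_assoc)
qed

lemma (in cring) self_algebra_ideal_span:
  assumes "ideal I R"
  shows "ideal_span R I (self_algebra R) = I"
proof
  interpret I: ideal I R by fact
  interpret S: module R "self_algebra R" by (rule self_algebra_module)
  show "ideal_span R I (self_algebra R) \<subseteq> I"
  proof
    fix x assume "x \<in> ideal_span R I (self_algebra R)"
    then show "x \<in> I"
      by (induct rule: ideal_span.induct) (auto simp: self_algebra_def I.I_r_closed)
  qed
  show "I \<subseteq> ideal_span R I (self_algebra R)"
  proof
    fix x assume x: "x \<in> I"
    then show "x \<in> ideal_span R I (self_algebra R)"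
      using S.smult_in_ideal_span[OF I.a_subset x, of \<one>] by (simp add: self_algebra_def I.Icarr)
  qed
qed

lemma (in cring) self_algebra_colon_flat: "colon_flat R (self_algebra R)"
  unfolding colon_flat_def
  by (auto simp: self_algebra_ideal_span colon_ideal) (auto simp: self_algebra_def colon_def)

text \<open>Strict inclusion of ideals: q comes later than the prime in u along a chain, although it
  is smaller in the order on primes. The value \<open>None\<close> imposes no condition.\<close>

definition lies_above :: "'a set option \<Rightarrow> 'a set \<Rightarrow> bool"
  where "lies_above u q \<longleftrightarrow> (case u of None \<Rightarrow> True | Some p \<Rightarrow> p \<subset> q)"

lemma primes_below_iff: "q \<in> primes_below R u d \<longleftrightarrow> primeideal q R \<and> prime_dim R q = d \<and> lies_above u q"
  by (simp add: primes_below_def lies_above_def)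

lemma lies_above_trans: "lies_above u p \<Longrightarrow> p \<subset> q \<Longrightarrow> lies_above u q"
  by (cases u) (simp_all add: lies_above_def)

lemma primes_below_subset: "lies_above u p \<Longrightarrow> primes_below R (Some p) d \<subseteq> primes_below R u d"
  using lies_above_trans[of u p] by (auto simp: primes_below_iff lies_above_def[of "Some p"])

definition prime_option :: "('a, 'b) ring_scheme \<Rightarrow> 'a set option \<Rightarrow> bool"
  where "prime_option R u \<longleftrightarrow> (case u of None \<Rightarrow> True | Some p \<Rightarrow> primeideal p R)"

lemma prime_option_simps [simp]: "prime_option R None" "prime_option R (Some p) \<longleftrightarrow> primeideal p R"
  by (simp_all add: prime_option_def)

lemma inj_Family: "inj_on Family A" and inj_Scalar: "inj_on Scalar B" and inj_Completed: "inj_on Completed C"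
  by (auto intro!: inj_onI)

section \<open>Module structure, flatness and maps of the nested products\<close>

context noetherian_cring
begin

lemma completion: "primeideal p R \<Longrightarrow> completion R p"
  using noetherian_cring_axioms by (intro completion.intro primeideal.axioms(1))

lemma adele_localization: "primeideal p R \<Longrightarrow> module R M \<Longrightarrow> adele_localization R M p"
  by (intro adele_localization.intro module_localization.intro)

abbreviation factor where "factor ds p \<equiv> localize R p (nested R (Some p) ds)"

lemma nested_module: "prime_option R u \<Longrightarrow> module R (nested R u ds)"
proof (induct ds arbitrary: u)
  case Nil
  show ?case
  proof (cases u)
    case None
    then show ?thesis by (simp add: image_algebra_module self_algebra_module inj_Scalar)
  next
    case (Some p)
    then show ?thesis
      using Nil completion.adic_module[OF completion, of p] by (simp add: image_algebra_module inj_Completed)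
  qed
next
  case (Cons d ds)
  have "module R (factor ds p)" if "p \<in> primes_below R u d" for p
    using that Cons(1)[of "Some p"] adele_localization.localize_module[OF adele_localization]
    by (auto simp: primes_below_iff)
  then show ?case
    by (simp add: image_algebra_module product_algebra_module is_cring inj_Family)
qed

lemma nested_localization: "primeideal p R \<Longrightarrow> adele_localization R (nested R (Some p) ds) p"
  by (intro adele_localization nested_module) auto

lemma factor_module: "primeideal p R \<Longrightarrow> module R (factor ds p)"
  by (rule adele_localization.localize_module[OF nested_localization])

lemma below_module: "p \<in> primes_below R u d \<Longrightarrow> module R (factor ds p)"
  by (rule factor_module) (simp add: primes_below_iff)

text \<open>Flatness holds at the bottom, for R and for the completions, and passes up the layers,
  since localization, products and transport of structure preserve it.\<close>

lemma nested_colon_flat: "prime_option R u \<Longrightarrow> colon_flat R (nested R u ds)"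
proof (induct ds arbitrary: u)
  case Nil
  show ?case
  proof (cases u)
    case None
    then show ?thesis
      by (simp add: image_algebra_colon_flat self_algebra_module self_algebra_colon_flat inj_Scalar)
  next
    case (Some p)
    then show ?thesis
      using Nil completion.adic_module[OF completion, of p] completion.adic_colon_flat[OF completion, of p]
      by (simp add: image_algebra_colon_flat inj_Completed)
  qed
next
  case (Cons d ds)
  have "colon_flat R (factor ds p)" if "p \<in> primes_below R u d" for p
    using that Cons(1)[of "Some p"] adele_localization.localize_colon_flat[OF nested_localization]
    by (auto simp: primes_below_iff)
  then have "colon_flat R (product_algebra (primes_below R u d) (factor ds))"
    by (intro product_colon_flat below_module)
  then show ?case
    by (simp add: image_algebra_colon_flat product_algebra_module is_cring below_module inj_Family)
qed

lemma Family_carrier: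
  "carrier (nested R u (d # ds)) = Family ` (\<Pi>\<^sub>E p\<in>primes_below R u d. carrier (factor ds p))"
  by simp

lemma Family_in: "x \<in> (\<Pi>\<^sub>E p\<in>primes_below R u d. carrier (factor ds p)) \<Longrightarrow> Family x \<in> carrier (nested R u (d # ds))"
  by simp

lemma Family_ops:
  assumes "x \<in> (\<Pi>\<^sub>E p\<in>primes_below R u d. carrier (factor ds p))" "y \<in> (\<Pi>\<^sub>E p\<in>primes_below R u d. carrier (factor ds p))"
  shows "Family x \<oplus>\<^bsub>nested R u (d # ds)\<^esub> Family y = Family (\<lambda>p\<in>primes_below R u d. x p \<oplus>\<^bsub>factor ds p\<^esub> y p)"
    and "a \<odot>\<^bsub>nested R u (d # ds)\<^esub> Family x = Family (\<lambda>p\<in>primes_below R u d. a \<odot>\<^bsub>factor ds p\<^esub> x p)"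
proof -
  have xy: "x \<in> carrier (product_algebra (primes_below R u d) (factor ds))"
      "y \<in> carrier (product_algebra (primes_below R u d) (factor ds))"
    using assms by simp_all
  show "Family x \<oplus>\<^bsub>nested R u (d # ds)\<^esub> Family y = Family (\<lambda>p\<in>primes_below R u d. x p \<oplus>\<^bsub>factor ds p\<^esub> y p)"
    unfolding nested.simps image_algebra_add[OF inj_Family xy] by simp
  show "a \<odot>\<^bsub>nested R u (d # ds)\<^esub> Family x = Family (\<lambda>p\<in>primes_below R u d. a \<odot>\<^bsub>factor ds p\<^esub> x p)"
    unfolding nested.simps image_algebra_smult[OF inj_Family xy(1)] by simp
qed

lemma Family_ideal_span:
  assumes "ideal J R" "x \<in> (\<Pi>\<^sub>E p\<in>primes_below R u d. carrier (factor ds p))"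
  shows "Family x \<in> ideal_span R J (nested R u (d # ds)) \<longleftrightarrow>
    (\<forall>p\<in>primes_below R u d. x p \<in> ideal_span R J (factor ds p))"
proof -
  have "module R (product_algebra (primes_below R u d) (factor ds))"
    by (intro product_algebra_module is_cring below_module)
  then have "ideal_span R J (nested R u (d # ds)) = Family ` ideal_span R J (product_algebra (primes_below R u d) (factor ds))"
    unfolding nested.simps by (rule image_algebra_ideal_span[OF _ inj_Family assms(1)])
  then show ?thesis
    using product_ideal_span[where S = "primes_below R u d" and M = "factor ds" and x = x, OF below_module assms(1)] assms(2)
    by auto
qed

lemma eval_hom:
  assumes "q \<in> primes_below R u d"
  shows "(\<lambda>x. family x q) \<in> module_hom R (nested R u (d # ds)) (factor ds q)"
  by (rule module_homI) (use assms in \<open>auto simp: Family_carrier Family_ops simp del: nested.simps\<close>)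

lemma Family_hom:
  assumes "\<And>q. q \<in> primes_below R u d \<Longrightarrow> f q \<in> module_hom R M (factor ds q)"
  shows "(\<lambda>x. Family (\<lambda>q\<in>primes_below R u d. f q x)) \<in> module_hom R M (nested R u (d # ds))"
proof (rule module_homI)
  have fx: "(\<lambda>q\<in>primes_below R u d. f q x) \<in> (\<Pi>\<^sub>E p\<in>primes_below R u d. carrier (factor ds p))" if "x \<in> carrier M" for x
    using module_hom_closed[OF assms] that by auto
  show "Family (\<lambda>q\<in>primes_below R u d. f q x) \<in> carrier (nested R u (d # ds))" if "x \<in> carrier M" for x
    by (rule Family_in[OF fx[OF that]])
  show "Family (\<lambda>q\<in>primes_below R u d. f q (x \<oplus>\<^bsub>M\<^esub> y)) = Family (\<lambda>q\<in>primes_below R u d. f q x) \<oplus>\<^bsub>nested R u (d # ds)\<^esub> Family (\<lambda>q\<in>primes_below R u d. f q y)"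
    if "x \<in> carrier M" "y \<in> carrier M" for x y
    unfolding Family_ops(1)[OF fx[OF that(1)] fx[OF that(2)]]
    using that by (auto simp: module_hom_add[OF assms] intro!: restrict_ext)
  show "Family (\<lambda>q\<in>primes_below R u d. f q (a \<odot>\<^bsub>M\<^esub> x)) = a \<odot>\<^bsub>nested R u (d # ds)\<^esub> Family (\<lambda>q\<in>primes_below R u d. f q x)"
    if "a \<in> carrier R" "x \<in> carrier M" for a x
    unfolding Family_ops(2)[OF fx[OF that(2)] fx[OF that(2)]]
    using that by (auto simp: module_hom_smult[OF assms] intro!: restrict_ext)
qed

lemma restriction_hom:
  assumes "lies_above u p"
  shows "(\<lambda>x. Family (restrict (family x) (primes_below R (Some p) d))) \<in> module_hom R (nested R u (d # ds)) (nested R (Some p) (d # ds))"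
  using primes_below_subset[OF assms] by (intro Family_hom eval_hom) auto

lemma coefficient_None:
  assumes "primeideal q R" "r \<in> carrier R"
  shows "coefficient_map R None q (Scalar r) = Completed (completion.adic R q (\<lambda>n. r))"
  using completion.adic_def[OF completion[OF assms(1)]] by simp

text \<open>Because p^n is contained in q^n, a sequence coherent for p is coherent for q. The
  coefficient map keeps the representing sequence, which makes its linearity and its composition law
  immediate.\<close>

lemma coefficient_Some:
  assumes p: "primeideal p R" and q: "primeideal q R" and pq: "p \<subset> q" and a: "completion.coherent R p a"
  shows "completion.coherent R q a"
    and "coefficient_map R (Some p) q (Completed (completion.adic R p a)) = Completed (completion.adic R q a)"
proof -
  interpret p: completion R p by (rule completion[OF p])
  interpret q: completion R q by (rule completion[OF q])
  have sub: "p.P n \<subseteq> q.P n" for n using pq by (intro ideal_power_mono) blast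
  show "q.coherent a" using a sub unfolding p.coherent_def q.coherent_def by blast
  have "q.P n <+> (p.P n +> a n) = q.P n +> a n" for n
    by (rule coset_project[OF q.P_ideal p.P_ideal sub p.coherentD(1)[OF a]])
  then show "coefficient_map R (Some p) q (Completed (p.adic a)) = Completed (q.adic a)"
    by (simp add: p.adic_def q.adic_def)
qed

lemma Scalar_ops:
  "carrier (nested R None []) = Scalar ` carrier R"
  "r \<in> carrier R \<Longrightarrow> s \<in> carrier R \<Longrightarrow> Scalar r \<oplus>\<^bsub>nested R None []\<^esub> Scalar s = Scalar (r \<oplus> s)"
  "r \<in> carrier R \<Longrightarrow> a \<odot>\<^bsub>nested R None []\<^esub> Scalar r = Scalar (a \<otimes> r)"
proof -
  note simps = image_algebra_add[OF inj_Scalar] image_algebra_smult[OF inj_Scalar]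
  show "carrier (nested R None []) = Scalar ` carrier R" by (simp add: self_algebra_def)
  show "r \<in> carrier R \<Longrightarrow> s \<in> carrier R \<Longrightarrow> Scalar r \<oplus>\<^bsub>nested R None []\<^esub> Scalar s = Scalar (r \<oplus> s)"
    using simps(1)[of r "self_algebra R" s] by (simp add: self_algebra_def)
  show "r \<in> carrier R \<Longrightarrow> a \<odot>\<^bsub>nested R None []\<^esub> Scalar r = Scalar (a \<otimes> r)"
    using simps(2)[of r "self_algebra R" a] by (simp add: self_algebra_def)
qed

lemma Completed_ops:
  assumes "primeideal p R"
  shows "carrier (nested R (Some p) []) = {Completed (completion.adic R p a) | a. completion.coherent R p a}"
    and "completion.coherent R p a \<Longrightarrow> completion.coherent R p b \<Longrightarrow>
      Completed (completion.adic R p a) \<oplus>\<^bsub>nested R (Some p) []\<^esub> Completed (completion.adic R p b) =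
      Completed (completion.adic R p (\<lambda>n. a n \<oplus> b n))"
    and "r \<in> carrier R \<Longrightarrow> completion.coherent R p a \<Longrightarrow>
      r \<odot>\<^bsub>nested R (Some p) []\<^esub> Completed (completion.adic R p a) = Completed (completion.adic R p (\<lambda>n. r \<otimes> a n))"
    and "ideal J R \<Longrightarrow> completion.coherent R p a \<Longrightarrow>
      Completed (completion.adic R p a) \<in> ideal_span R J (nested R (Some p) []) \<longleftrightarrow> (\<forall>n. a n \<in> J <+> ideal_power R p n)"
proof -
  interpret p: completion R p by (rule completion[OF assms])
  show "carrier (nested R (Some p) []) = {Completed (p.adic a) | a. p.coherent a}"
    using p.adic_carrier by auto
  show "p.coherent a \<Longrightarrow> p.coherent b \<Longrightarrow>
      Completed (p.adic a) \<oplus>\<^bsub>nested R (Some p) []\<^esub> Completed (p.adic b) = Completed (p.adic (\<lambda>n. a n \<oplus> b n))"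
    using image_algebra_add[OF inj_Completed p.adic_in p.adic_in, of a b] by (simp add: p.adic_add)
  show "r \<in> carrier R \<Longrightarrow> p.coherent a \<Longrightarrow>
      r \<odot>\<^bsub>nested R (Some p) []\<^esub> Completed (p.adic a) = Completed (p.adic (\<lambda>n. r \<otimes> a n))"
    using image_algebra_smult[OF inj_Completed p.adic_in, of a r] by (simp add: p.adic_smult)
  show "Completed (p.adic a) \<in> ideal_span R J (nested R (Some p) []) \<longleftrightarrow> (\<forall>n. a n \<in> J <+> p.P n)"
    if "ideal J R" "p.coherent a"
    using p.adic_ideal_span_iff[OF that] unfolding nested.simps image_algebra_ideal_span[OF p.adic_module inj_Completed that(1)]
    by auto
qed

lemma coefficient_hom:
  assumes "prime_option R u" "primeideal q R" "lies_above u q"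
  shows "coefficient_map R u q \<in> module_hom R (nested R u []) (nested R (Some q) [])"
proof (cases u)
  case None
  interpret q: completion R q by (rule completion[OF assms(2)])
  show ?thesis
    unfolding None
    by (rule module_homI)
      (auto simp: Scalar_ops Completed_ops[OF assms(2)] coefficient_None[OF assms(2)] q.coherent_const
        simp del: nested.simps coefficient_map.simps)
next
  case (Some p)
  then have p: "primeideal p R" and pq: "p \<subset> q" using assms by (auto simp: lies_above_def)
  interpret p: completion R p by (rule completion[OF p])
  note c = coefficient_Some[OF p assms(2) pq]
  show ?thesis
    unfolding Some
    by (rule module_homI)
      (auto simp: Completed_ops[OF assms(2)] Completed_ops[OF p] c p.coherent_add p.coherent_mult
        simp del: nested.simps coefficient_map.simps)
qed

lemma coefficient_comp:
  assumes u: "prime_option R u" and q: "primeideal q R" "lies_above u q" and q': "primeideal q' R" "q \<subset> q'"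
    and x: "x \<in> carrier (nested R u [])"
  shows "coefficient_map R (Some q) q' (coefficient_map R u q x) = coefficient_map R u q' x"
proof (cases u)
  case None
  then obtain r where r: "x = Scalar r" "r \<in> carrier R" using x Scalar_ops(1) by auto
  interpret q: completion R q by (rule completion[OF q(1)])
  show ?thesis
    unfolding None r(1) coefficient_None[OF q(1) r(2)] coefficient_None[OF q'(1) r(2)]
    by (rule coefficient_Some[OF q(1) q' q.coherent_const[OF r(2)]])
next
  case (Some p)
  then have p: "primeideal p R" and pq: "p \<subset> q" using u q by (auto simp: lies_above_def)
  obtain a where a: "x = Completed (completion.adic R p a)" "completion.coherent R p a"
    using x Completed_ops(1)[OF p] unfolding Some by auto
  note 1 = coefficient_Some[OF p q(1) pq a(2)]
  have "p \<subset> q'" using pq q'(2) by blast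
  then show ?thesis
    unfolding Some a(1) 1(2) coefficient_Some(2)[OF q(1) q' 1(1)]
    using coefficient_Some(2)[OF p q'(1) _ a(2)] by simp
qed

section \<open>Insertion maps and their commutation\<close>

lemma to_localize_nested_hom:
  "primeideal p R \<Longrightarrow> to_localize R p (nested R (Some p) ds) \<in> module_hom R (nested R (Some p) ds) (factor ds p)"
  by (rule adele_localization.to_localize_hom[OF nested_localization])

lemma insertion_hom:
  "prime_option R u \<Longrightarrow> insertion_map R u ds e \<in> module_hom R (nested R u ds) (nested R u (insert_desc e ds))"
proof (induct ds arbitrary: u)
  case Nil
  have "(\<lambda>x. to_localize R q (nested R (Some q) []) (coefficient_map R u q x)) \<in> module_hom R (nested R u []) (factor [] q)"
    if "q \<in> primes_below R u e" for q
    using that Nil by (intro module_hom_comp[OF coefficient_hom to_localize_nested_hom]) (auto simp: primes_below_iff)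
  then have "(\<lambda>x. Family (\<lambda>q\<in>primes_below R u e. to_localize R q (nested R (Some q) []) (coefficient_map R u q x)))
      \<in> module_hom R (nested R u []) (nested R u [e])"
    by (rule Family_hom)
  then show ?case by (simp del: nested.simps coefficient_map.simps)
next
  case (Cons d ds)
  show ?case
  proof (cases "e > d")
    case True
    have "(\<lambda>x. to_localize R p (nested R (Some p) (d # ds)) (Family (restrict (family x) (primes_below R (Some p) d))))
        \<in> module_hom R (nested R u (d # ds)) (factor (d # ds) p)" if "p \<in> primes_below R u e" for p
      using that by (intro module_hom_comp[OF restriction_hom to_localize_nested_hom]) (auto simp: primes_below_iff)
    then have "(\<lambda>x. Family (\<lambda>p\<in>primes_below R u e. to_localize R p (nested R (Some p) (d # ds))
          (Family (restrict (family x) (primes_below R (Some p) d)))))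
        \<in> module_hom R (nested R u (d # ds)) (nested R u (e # d # ds))"
      by (rule Family_hom)
    then show ?thesis using True by (simp del: nested.simps)
  next
    case False
    have "(\<lambda>x. localize_map R q (nested R (Some q) (insert_desc e ds)) (insertion_map R (Some q) ds e) (family x q))
        \<in> module_hom R (nested R u (d # ds)) (factor (insert_desc e ds) q)" if "q \<in> primes_below R u d" for q
      using that
      by (intro module_hom_comp[OF eval_hom localize_map_hom] nested_localization Cons(1)) (auto simp: primes_below_iff)
    then have "(\<lambda>x. Family (\<lambda>q\<in>primes_below R u d. localize_map R q (nested R (Some q) (insert_desc e ds))
          (insertion_map R (Some q) ds e) (family x q)))
        \<in> module_hom R (nested R u (d # ds)) (nested R u (d # insert_desc e ds))"
      by (rule Family_hom)
    then show ?thesis using False by (simp del: nested.simps)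
  qed
qed

lemma localize_map_to_localize:
  assumes p: "primeideal p R" and f: "f \<in> module_hom R (nested R (Some p) ds) (nested R (Some p) es)"
    and x: "x \<in> carrier (nested R (Some p) ds)"
  shows "localize_map R p (nested R (Some p) es) f (to_localize R p (nested R (Some p) ds) x) =
    to_localize R p (nested R (Some p) es) (f x)"
proof -
  interpret p: primeideal p R by (rule p)
  note M = nested_localization[OF p]
  show ?thesis
    unfolding adele_localization.to_localize_eq[OF M]
    using p.one_compl by (intro localize_map_fr[OF M M f x])
qed

lemma localize_map_cong:
  assumes p: "primeideal p R" and x: "x \<in> carrier (factor ds p)"
    and eq: "\<And>m. m \<in> carrier (nested R (Some p) ds) \<Longrightarrow> f m = g m"
  shows "localize_map R p N f x = localize_map R p N g x"
proof -
  interpret M: adele_localization R "nested R (Some p) ds" p by (rule nested_localization[OF p])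
  obtain m s where "x = M.fr m s" "m \<in> carrier (nested R (Some p) ds)" "s \<in> carrier R - p"
    using x by (auto simp: M.localize_carrier)
  then show ?thesis using M.fr_repr(1) eq by (simp add: localize_map_def)
qed

lemma localize_map_comp:
  assumes p: "primeideal p R" and x: "x \<in> carrier (factor ds p)"
    and f: "f \<in> module_hom R (nested R (Some p) ds) (nested R (Some p) es)"
    and g: "g \<in> module_hom R (nested R (Some p) es) (nested R (Some p) gs)"
  shows "localize_map R p (nested R (Some p) gs) g (localize_map R p (nested R (Some p) es) f x) =
    localize_map R p (nested R (Some p) gs) (\<lambda>m. g (f m)) x"
proof -
  note L = nested_localization[OF p]
  interpret M: adele_localization R "nested R (Some p) ds" p by (rule L)
  obtain m s where m: "x = M.fr m s" "m \<in> carrier (nested R (Some p) ds)" "s \<in> carrier R - p"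
    using x by (auto simp: M.localize_carrier)
  show ?thesis
    unfolding m(1) localize_map_fr[OF L L f m(2,3)] localize_map_fr[OF L L g module_hom_closed[OF f m(2)] m(3)]
      localize_map_fr[OF L L module_hom_comp[OF f g] m(2,3)] ..
qed

text \<open>The induction descends through the nested products until one of e and f has found its
  place. From there the claim is naturality of the map into the localization, combined with
  transitivity of the projections or of the coefficient maps.\<close>

lemma insertion_commute_less:
  assumes "prime_option R u" "x \<in> carrier (nested R u ds)" "f < e" "e \<notin> set ds" "f \<notin> set ds"
  shows "insertion_map R u (insert_desc e ds) f (insertion_map R u ds e x) =
    insertion_map R u (insert_desc f ds) e (insertion_map R u ds f x)"
  using assms
proof (induct ds arbitrary: u x)
  case Nil
  \<comment> \<open>Inserting e first passes through the completion at q, inserting f first goes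
    directly to the completion at the larger ideal; \<open>coefficient_comp\<close> identifies the
    two routes.\<close>
  have "localize_map R q (nested R (Some q) [f]) (insertion_map R (Some q) [] f)
        (to_localize R q (nested R (Some q) []) (coefficient_map R u q x)) =
      to_localize R q (nested R (Some q) [f]) (Family (restrict
        (\<lambda>q'\<in>primes_below R u f. to_localize R q' (nested R (Some q') []) (coefficient_map R u q' x))
        (primes_below R (Some q) f)))"
    if q: "q \<in> primes_below R u e" for q
  proof -
    have q': "primeideal q R" "lies_above u q" using q by (auto simp: primes_below_iff)
    note sub = primes_below_subset[OF q'(2)]
    have "coefficient_map R u q x \<in> carrier (nested R (Some q) [])"
      using Nil(1,2) q' by (intro module_hom_closed[OF coefficient_hom])
    then have "localize_map R q (nested R (Some q) [f]) (insertion_map R (Some q) [] f)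
        (to_localize R q (nested R (Some q) []) (coefficient_map R u q x)) =
      to_localize R q (nested R (Some q) [f]) (insertion_map R (Some q) [] f (coefficient_map R u q x))"
      using q' insertion_hom[of "Some q" "[]" f] by (intro localize_map_to_localize) auto
    moreover have "insertion_map R (Some q) [] f (coefficient_map R u q x) = Family (restrict
        (\<lambda>q'\<in>primes_below R u f. to_localize R q' (nested R (Some q') []) (coefficient_map R u q' x))
        (primes_below R (Some q) f))"
      using Nil(1,2) q'
      by (auto simp: coefficient_comp Int_absorb1[OF sub] primes_below_iff[of _ R "Some q"] lies_above_def[of "Some q"] subset_iff
        simp del: coefficient_map.simps nested.simps intro!: restrict_ext)
    ultimately show ?thesis by simp
  qed
  then show ?case using Nil(3) by (auto simp del: coefficient_map.simps nested.simps intro!: restrict_ext)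
next
  case (Cons d ds)
  from Cons(3) obtain x' where x': "x = Family x'" "x' \<in> (\<Pi>\<^sub>E p\<in>primes_below R u d. carrier (factor ds p))"
    unfolding Family_carrier by blast
  have rest: "Family (restrict x' (primes_below R (Some p) d)) \<in> carrier (nested R (Some p) (d # ds))"
    if "lies_above u p" for p
    using module_hom_closed[OF restriction_hom[OF that] Cons(3)] unfolding x' by simp
  \<comment> \<open>The new layers lie both outside the layer of d, one on either side of it, or
    both inside. In the first two cases projections compose or commute with a factorwise map; in the
    last the induction hypothesis is used inside each localization.\<close>
  consider "f > d" | "e > d" "f < d" | "e < d"
    using Cons(4-6) by fastforce
  then show ?case
  proof cases
    case 1
    have "localize_map R p (nested R (Some p) (f # d # ds)) (insertion_map R (Some p) (d # ds) f)
          (to_localize R p (nested R (Some p) (d # ds)) (Family (restrict x' (primes_below R (Some p) d)))) =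
        to_localize R p (nested R (Some p) (f # d # ds)) (Family (restrict
          (\<lambda>q\<in>primes_below R u f. to_localize R q (nested R (Some q) (d # ds)) (Family (restrict x' (primes_below R (Some q) d))))
          (primes_below R (Some p) f)))"
      if p: "p \<in> primes_below R u e" for p
    proof -
      have p': "primeideal p R" "lies_above u p" using p by (auto simp: primes_below_iff)
      have "localize_map R p (nested R (Some p) (f # d # ds)) (insertion_map R (Some p) (d # ds) f)
          (to_localize R p (nested R (Some p) (d # ds)) (Family (restrict x' (primes_below R (Some p) d)))) =
        to_localize R p (nested R (Some p) (f # d # ds))
          (insertion_map R (Some p) (d # ds) f (Family (restrict x' (primes_below R (Some p) d))))"
        using p' 1 insertion_hom[of "Some p" "d # ds" f] rest[OF p'(2)]
        by (intro localize_map_to_localize) (auto simp del: nested.simps)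
      moreover have "insertion_map R (Some p) (d # ds) f (Family (restrict x' (primes_below R (Some p) d))) =
          Family (restrict
          (\<lambda>q\<in>primes_below R u f. to_localize R q (nested R (Some q) (d # ds)) (Family (restrict x' (primes_below R (Some q) d))))
          (primes_below R (Some p) f))"
      proof -
        have "to_localize R q (nested R (Some q) (d # ds))
            (Family (restrict (restrict x' (primes_below R (Some p) d)) (primes_below R (Some q) d))) =
          to_localize R q (nested R (Some q) (d # ds)) (Family (restrict x' (primes_below R (Some q) d)))"
          if "q \<in> primes_below R (Some p) f" for q
          using that primes_below_subset[of "Some p" q R d]
          by (simp add: primes_below_iff Int_absorb1 restrict_restrict del: nested.simps)
        then show ?thesis
          using 1 by (auto simp: Int_absorb1[OF primes_below_subset[OF p'(2)]] simp del: nested.simps intro!: restrict_ext)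
      qed
      ultimately show ?thesis by simp
    qed
    then show ?thesis
      using 1 Cons(4) by (auto simp: x' simp del: nested.simps insertion_map.simps(2) intro!: restrict_ext)
        (auto simp del: nested.simps intro!: restrict_ext)
  next
    case 2
    have "localize_map R p (nested R (Some p) (d # insert_desc f ds)) (insertion_map R (Some p) (d # ds) f)
          (to_localize R p (nested R (Some p) (d # ds)) (Family (restrict x' (primes_below R (Some p) d)))) =
        to_localize R p (nested R (Some p) (d # insert_desc f ds)) (Family (restrict
          (\<lambda>q\<in>primes_below R u d. localize_map R q (nested R (Some q) (insert_desc f ds)) (insertion_map R (Some q) ds f) (x' q))
          (primes_below R (Some p) d)))"
      if p: "p \<in> primes_below R u e" for p
    proof -
      have p': "primeideal p R" "lies_above u p" using p by (auto simp: primes_below_iff)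
      have "localize_map R p (nested R (Some p) (d # insert_desc f ds)) (insertion_map R (Some p) (d # ds) f)
          (to_localize R p (nested R (Some p) (d # ds)) (Family (restrict x' (primes_below R (Some p) d)))) =
        to_localize R p (nested R (Some p) (d # insert_desc f ds))
          (insertion_map R (Some p) (d # ds) f (Family (restrict x' (primes_below R (Some p) d))))"
        using p' 2 insertion_hom[of "Some p" "d # ds" f] rest[OF p'(2)]
        by (intro localize_map_to_localize) (auto simp del: nested.simps)
      moreover have "insertion_map R (Some p) (d # ds) f (Family (restrict x' (primes_below R (Some p) d))) =
          Family (restrict
          (\<lambda>q\<in>primes_below R u d. localize_map R q (nested R (Some q) (insert_desc f ds)) (insertion_map R (Some q) ds f) (x' q))
          (primes_below R (Some p) d))"
        using 2 by (auto simp: Int_absorb1[OF primes_below_subset[OF p'(2)]] subsetD[OF primes_below_subset[OF p'(2)]]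
          simp del: nested.simps intro!: restrict_ext)
      ultimately show ?thesis by simp
    qed
    then show ?thesis using 2 by (auto simp: x' simp del: nested.simps intro!: restrict_ext)
  next
    case 3
    have "localize_map R q (nested R (Some q) (insert_desc f (insert_desc e ds))) (insertion_map R (Some q) (insert_desc e ds) f)
          (localize_map R q (nested R (Some q) (insert_desc e ds)) (insertion_map R (Some q) ds e) (x' q)) =
        localize_map R q (nested R (Some q) (insert_desc e (insert_desc f ds))) (insertion_map R (Some q) (insert_desc f ds) e)
          (localize_map R q (nested R (Some q) (insert_desc f ds)) (insertion_map R (Some q) ds f) (x' q))"
      if q: "q \<in> primes_below R u d" for q
    proof -
      have q': "primeideal q R" using q by (auto simp: primes_below_iff)
      then have qo: "prime_option R (Some q)" by simp
      have xq: "x' q \<in> carrier (factor ds q)" using x'(2) q by (rule PiE_mem)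
      have comm: "insert_desc f (insert_desc e ds) = insert_desc e (insert_desc f ds)"
        using Cons(4) by (induct ds) auto
      show ?thesis
        unfolding localize_map_comp[OF q' xq insertion_hom[OF qo] insertion_hom[OF qo]]
        unfolding comm
        by (rule localize_map_cong[OF q' xq]) (use Cons(1)[OF qo] Cons(4-6) in auto)
    qed
    then show ?thesis using 3 Cons(4) by (auto simp: x' simp del: nested.simps intro!: restrict_ext)
  qed
qed

lemma insertion_commute:
  assumes "prime_option R u" "x \<in> carrier (nested R u ds)" "e \<noteq> f" "e \<notin> set ds" "f \<notin> set ds"
  shows "insertion_map R u (insert_desc e ds) f (insertion_map R u ds e x) =
    insertion_map R u (insert_desc f ds) e (insertion_map R u ds f x)"
  using insertion_commute_less[OF assms(1,2)] assms(3-5) by (metis nat_neq_iff)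

end

section \<open>Functoriality of the cube and contraction at a prime\<close>

context noetherian_cring
begin

lemma set_insert_desc: "set (insert_desc e ds) = insert e (set ds)"
  by (induct ds) auto

lemma insert_desc_commute: "e \<noteq> f \<Longrightarrow> insert_desc f (insert_desc e ds) = insert_desc e (insert_desc f ds)"
  by (induct ds) auto

lemma insertions_hom:
  "insertions_map R ds es \<in> module_hom R (nested R None ds) (nested R None (fold insert_desc es ds))"
proof (induct es arbitrary: ds)
  case Nil
  then show ?case by (auto intro: module_homI simp del: nested.simps)
next
  case (Cons e es)
  have "insertions_map R ds (e # es) = (\<lambda>x. insertions_map R (insert_desc e ds) es (insertion_map R None ds e x))"
    by (rule ext) simp
  then show ?case
    using module_hom_comp[OF insertion_hom[of None ds e] Cons[of "insert_desc e ds"]] by (simp del: nested.simps)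
qed

lemma insertions_append:
  "insertions_map R ds (es @ es') x = insertions_map R (fold insert_desc es ds) es' (insertions_map R ds es x)"
  by (induct es arbitrary: ds x) auto

lemma insertions_move:
  assumes "x \<in> carrier (nested R None ds)" "e \<notin> set es" "e \<notin> set ds" "set es \<inter> set ds = {}" "distinct es"
  shows "insertions_map R ds (es @ e # es') x = insertions_map R ds (e # es @ es') x"
  using assms
proof (induct es arbitrary: ds x)
  case (Cons f es)
  have "insertion_map R None ds f x \<in> carrier (nested R None (insert_desc f ds))"
    by (rule module_hom_closed[OF insertion_hom[OF prime_option_simps(1)] Cons(2)])
  then have "insertions_map R (insert_desc f ds) (es @ e # es') (insertion_map R None ds f x) =
      insertions_map R (insert_desc f ds) (e # es @ es') (insertion_map R None ds f x)"
    using Cons(3-6) by (intro Cons(1)) (auto simp: set_insert_desc)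
  moreover have "insertion_map R None (insert_desc f ds) e (insertion_map R None ds f x) =
      insertion_map R None (insert_desc e ds) f (insertion_map R None ds e x)"
    using Cons(2-6) by (intro insertion_commute) auto
  ultimately show ?case
    using Cons(3) insert_desc_commute[of e f ds] by simp
qed simp

text \<open>A direct map of the cube inserts the missing dimensions in increasing order, while a
  composite inserts them in two blocks. Functoriality needs the order to be immaterial; the head of
  one list is moved to the front of the other, one commutation at a time.\<close>

lemma insertions_perm:
  assumes "x \<in> carrier (nested R None ds)" "set es \<inter> set ds = {}" "distinct es" "mset es = mset es'"
  shows "insertions_map R ds es x = insertions_map R ds es' x"
  using assms
proof (induct es arbitrary: ds x es')
  case (Cons e es)
  have "e \<in> set es'" using mset_eq_setD[OF Cons(5)] by auto
  then obtain a b where es': "es' = a @ e # b" by (auto simp: in_set_conv_decomp)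
  have ms: "mset es = mset (a @ b)" using Cons(5) by (simp add: es')
  have "distinct es'" using Cons(4,5) by (metis mset_eq_imp_distinct_iff)
  moreover have "set es' = set (e # es)" using mset_eq_setD[OF Cons(5)] by simp
  ultimately have "insertions_map R ds es' x = insertions_map R ds (e # a @ b) x"
    unfolding es' using Cons(2,3) by (intro insertions_move) auto
  moreover have "insertions_map R (insert_desc e ds) es (insertion_map R None ds e x) =
      insertions_map R (insert_desc e ds) (a @ b) (insertion_map R None ds e x)"
    using Cons(3,4)
    by (intro Cons(1) ms module_hom_closed[OF insertion_hom[OF prime_option_simps(1)] Cons(2)])
      (auto simp: set_insert_desc)
  ultimately show ?case by simp
qed simp

lemma descending_set: "finite D \<Longrightarrow> set (descending D) = D"
  and descending_sorted: "sorted_wrt (>) (descending D)"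
  by (simp_all add: descending_def sorted_wrt_rev)

lemma insert_desc_sorted: "sorted_wrt (>) ds \<Longrightarrow> e \<notin> set ds \<Longrightarrow> sorted_wrt (>) (insert_desc e ds)"
  by (induct ds) (auto simp: set_insert_desc)

lemma descending_insert:
  assumes "finite D" "e \<notin> D"
  shows "insert_desc e (descending D) = descending (insert e D)"
proof -
  have "sorted_wrt (<) (rev (insert_desc e (descending D)))"
    unfolding sorted_wrt_rev using assms descending_set[OF assms(1)]
    by (intro insert_desc_sorted descending_sorted) auto
  moreover have "sorted_wrt (<) (rev (descending (insert e D)))"
    unfolding sorted_wrt_rev by (rule descending_sorted)
  moreover have "set (rev (insert_desc e (descending D))) = set (rev (descending (insert e D)))"
    using assms(1) by (simp add: set_insert_desc descending_set)
  ultimately have "rev (insert_desc e (descending D)) = rev (descending (insert e D))"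
    by (intro strict_sorted_equal) auto
  then show ?thesis by simp
qed

lemma descending_fold:
  "finite D \<Longrightarrow> distinct es \<Longrightarrow> set es \<inter> D = {} \<Longrightarrow> fold insert_desc es (descending D) = descending (set es \<union> D)"
proof (induct es arbitrary: D)
  case (Cons e es)
  then show ?case using Cons(1)[of "insert e D"] by (simp add: descending_insert)
qed simp

lemma descending_fold_Diff:
  assumes "finite D'" "D \<subseteq> D'"
  shows "fold insert_desc (sorted_list_of_set (D' - D)) (descending D) = descending D'"
proof -
  have "finite D" "finite (D' - D)" "(D' - D) \<inter> D = {}" "(D' - D) \<union> D = D'"
    using assms finite_subset by auto
  then show ?thesis using descending_fold[of D "sorted_list_of_set (D' - D)"] by simp
qed

lemma adelic_diagram:
  assumes "finite E"
  shows "module_diagram R (Pow E) (adelic_cube R) (adelic_cube_map R)"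
  unfolding module_diagram_def
proof (intro conjI ballI impI)
  have fin: "finite D" if "D \<in> Pow E" for D using that assms finite_subset by blast
  show "module R (adelic_cube R D)" for D unfolding adelic_cube_def by (rule nested_module) simp
  show hom: "adelic_cube_map R D D' \<in> module_hom R (adelic_cube R D) (adelic_cube R D')"
    if "D \<in> Pow E" "D' \<in> Pow E" "D \<le> D'" for D D'
    unfolding adelic_cube_def adelic_cube_map_def
    using insertions_hom[of "descending D" "sorted_list_of_set (D' - D)"] descending_fold_Diff[OF fin[OF that(2)] that(3)]
    by simp
  show "adelic_cube_map R D D x = x" for D x by (simp add: adelic_cube_map_def)
  fix D D' D'' x assume D: "D \<in> Pow E" "D' \<in> Pow E" "D'' \<in> Pow E" "D \<le> D'" "D' \<le> D''" and x: "x \<in> carrier (adelic_cube R D)"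
  let ?a = "sorted_list_of_set (D' - D)" and ?b = "sorted_list_of_set (D'' - D')" and ?c = "sorted_list_of_set (D'' - D)"
  have fins: "finite (D' - D)" "finite (D'' - D')" "finite (D'' - D)" using fin D by auto
  have sets: "set ?a = D' - D" "set ?b = D'' - D'" "set ?c = D'' - D" using fins by simp_all
  have dist: "distinct (?a @ ?b)" "distinct ?c" using sets by auto
  have "set (?a @ ?b) = set ?c" unfolding set_append sets using D(4,5) by blast
  then have ms: "mset ?c = mset (?a @ ?b)" using dist set_eq_iff_mset_eq_distinct by metis
  have "adelic_cube_map R D' D'' (adelic_cube_map R D D' x) = insertions_map R (descending D) (?a @ ?b) x"
    unfolding adelic_cube_map_def insertions_append descending_fold_Diff[OF fin[OF D(2)] D(4)] ..
  also have "\<dots> = insertions_map R (descending D) ?c x"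
    using x sets(3) dist(2) ms fin[OF D(1)]
    by (intro insertions_perm[symmetric]) (auto simp: adelic_cube_def descending_set)
  finally show "adelic_cube_map R D' D'' (adelic_cube_map R D D' x) = adelic_cube_map R D D'' x"
    by (simp add: adelic_cube_map_def)
qed

text \<open>\<open>prime_dim\<close> is a definite description, so existence and uniqueness have to
  be supplied. The bound on lengths gives a longest chain; it is maximal because a chain has as many
  members as entries, and catenarity forces all maximal chains to have its length.\<close>

lemma prime_dim_chain:
  assumes cat: "catenary R" and p: "primeideal p R"
  shows "\<exists>c\<in>prime_chains R p. length c = Suc (prime_dim R p) \<and> (\<forall>c'\<in>prime_chains R p. length c' \<le> length c)"
proof -
  obtain b where b: "\<And>c. c \<in> prime_chains R p \<Longrightarrow> length c \<le> b"
    and eq: "\<And>c c'. c \<in> maximal_prime_chains R p \<Longrightarrow> c' \<in> maximal_prime_chains R p \<Longrightarrow> length c = length c'"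
    using cat p unfolding catenary_def by blast
  have "[p] \<in> prime_chains R p" using p by (simp add: prime_chains_def)
  moreover have "\<forall>c. c \<in> prime_chains R p \<longrightarrow> length c < Suc b" using b by (simp add: less_Suc_eq_le)
  ultimately obtain c where c: "c \<in> prime_chains R p" and max: "\<And>c'. c' \<in> prime_chains R p \<Longrightarrow> length c' \<le> length c"
    using ex_has_greatest_nat[of "\<lambda>c. c \<in> prime_chains R p" "[p]" length "Suc b"] by blast
  have len: "card (set c') = length c'" if "c' \<in> prime_chains R p" for c'
  proof -
    have "sorted_wrt (\<subset>) xs \<Longrightarrow> distinct xs" for xs :: "'a set list" by (induct xs) auto
    then show ?thesis using that by (simp add: prime_chains_def distinct_card)
  qed
  have "\<not> set c \<subset> set c'" if "c' \<in> prime_chains R p" for c'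
    using psubset_card_mono[of "set c'" "set c"] len[OF that] len[OF c] max[OF that] by auto
  then have cm: "c \<in> maximal_prime_chains R p" using c by (simp add: maximal_prime_chains_def)
  have "c \<noteq> []" using c by (simp add: prime_chains_def)
  then obtain s where s: "length c = Suc s" by (cases c) auto
  have "prime_dim R p = s"
    unfolding prime_dim_def
  proof (rule the_equality)
    show "\<exists>c\<in>maximal_prime_chains R p. length c = Suc s" using cm s by blast
    fix t assume "\<exists>c\<in>maximal_prime_chains R p. length c = Suc t"
    then obtain c' where "c' \<in> maximal_prime_chains R p" "length c' = Suc t" by blast
    then show "t = s" using eq[OF cm, of c'] s by simp
  qed
  then show ?thesis using c s max by blast
qed

text \<open>Prepending p to a chain realizing the dimension of q gives a longer chain starting at
  p.\<close>

lemma prime_dim_less: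
  assumes cat: "catenary R" and p: "primeideal p R" and q: "primeideal q R" and pq: "p \<subset> q"
  shows "prime_dim R q < prime_dim R p"
proof -
  obtain c where c: "c \<in> prime_chains R q" "length c = Suc (prime_dim R q)"
    using prime_dim_chain[OF cat q] by blast
  have "\<forall>x\<in>set c. p \<subset> x" using c(1) pq by (cases c) (auto simp: prime_chains_def)
  then have "p # c \<in> prime_chains R p" using c(1) p by (simp add: prime_chains_def)
  then show ?thesis using prime_dim_chain[OF cat p] c(2) by fastforce
qed

text \<open>At a prime q not containing p, some element of p becomes a unit, so the factor equals p
  times itself. Hence only components at primes containing p need checking.\<close>

lemma ideal_span_of_components:
  assumes p: "primeideal p R" and w: "w \<in> carrier (nested R None (d # ds))"
    and comp: "\<And>q. q \<in> primes_below R None d \<Longrightarrow> p \<subseteq> q \<Longrightarrow> family w q \<in> ideal_span R p (factor ds q)"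
  shows "w \<in> ideal_span R p (nested R None (d # ds))"
proof -
  interpret p: primeideal p R by (rule p)
  obtain x where x: "w = Family x" "x \<in> (\<Pi>\<^sub>E p\<in>primes_below R None d. carrier (factor ds p))"
    using w unfolding Family_carrier by blast
  have "x q \<in> ideal_span R p (factor ds q)" if q: "q \<in> primes_below R None d" for q
  proof (cases "p \<subseteq> q")
    case True
    then show ?thesis using comp[OF q] x(1) by simp
  next
    case False
    then obtain a where a: "a \<in> p" "a \<notin> q" by blast
    have "primeideal q R" using q by (simp add: primes_below_iff)
    then show ?thesis
      using adele_localization.localize_ideal_span_full[OF nested_localization p.is_ideal a] PiE_mem[OF x(2) q] by blast
  qed
  then show ?thesis unfolding x(1) Family_ideal_span[OF p.is_ideal x(2)] by blast
qed

text \<open>Modulo \<open>p\<close> and localized at \<open>p\<close>, a product over the primes of dimension \<open>dim p\<close> is reduced to its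
  factor at \<open>p\<close>, so that only the comparison map \<open>c p\<close> matters.\<close>

lemma contraction_at_prime:
  assumes cat: "catenary R" and p: "primeideal p R" and d: "prime_dim R p = d"
    and map: "\<And>x. insertion_map R None ds d x =
      Family (\<lambda>q\<in>primes_below R None d. to_localize R q (nested R (Some q) ds) (c q x))"
    and ins: "insert_desc d ds = d # ds"
    and c: "c p \<in> module_hom R (nested R None ds) (nested R (Some p) ds)"
    and inj: "\<And>m t. m \<in> carrier (nested R None ds) \<Longrightarrow> t \<in> carrier R - p \<Longrightarrow>
      t \<odot>\<^bsub>nested R (Some p) ds\<^esub> c p m \<in> ideal_span R p (nested R (Some p) ds) \<Longrightarrow> m \<in> negligible R p (nested R None ds)"
    and surj: "\<And>n. n \<in> carrier (nested R (Some p) ds) \<Longrightarrow> \<exists>x\<in>carrier (nested R None ds).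
      n \<ominus>\<^bsub>nested R (Some p) ds\<^esub> c p x \<in> ideal_span R p (nested R (Some p) ds)"
  shows "m \<in> carrier (nested R None ds) \<Longrightarrow> insertion_map R None ds d m \<in> negligible R p (nested R None (insert_desc d ds)) \<Longrightarrow>
      m \<in> negligible R p (nested R None ds)"
    and "y \<in> carrier (nested R None (insert_desc d ds)) \<Longrightarrow>
      \<exists>s\<in>carrier R - p. \<exists>m\<in>carrier (nested R None ds). mod_cong (nested R None (insert_desc d ds))
        (negligible R p (nested R None (insert_desc d ds)))
        (s \<odot>\<^bsub>nested R None (insert_desc d ds)\<^esub> y) (insertion_map R None ds d m)"
proof -
  interpret p: primeideal p R by (rule p)
  let ?X = "nested R None ds" and ?N = "nested R (Some p) ds" and ?Y = "nested R None (d # ds)"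
  interpret X: module R ?X by (rule nested_module) simp
  interpret Y: module R ?Y by (rule nested_module) simp
  interpret N: adele_localization R ?N p by (rule nested_localization[OF p])
  interpret L: module R "factor ds p" by (rule N.localize_module)
  have pd: "p \<in> primes_below R None d" using p d by (simp add: primes_below_iff lies_above_def)
  note ev = eval_hom[OF pd, of ds]
  have phi: "insertion_map R None ds d \<in> module_hom R ?X ?Y"
    using insertion_hom[of None ds d] by (simp add: ins del: nested.simps)
  have phi_p: "family (insertion_map R None ds d x) p = N.fr (c p x) \<one>" for x
    using pd by (simp add: map N.to_localize_eq del: nested.simps)
  \<comment> \<open>A prime of dimension d that contains p is p itself, since a strict inclusion
    would lower the dimension.\<close>
  have only_p: "w \<in> ideal_span R p ?Y" if w: "w \<in> carrier ?Y" and wp: "family w p \<in> ideal_span R p (factor ds p)" for w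
  proof (rule ideal_span_of_components[OF p w])
    fix q assume q: "q \<in> primes_below R None d" "p \<subseteq> q"
    then have "p = q" using prime_dim_less[OF cat p, of q] d by (auto simp: primes_below_iff)
    then show "family w q \<in> ideal_span R p (factor ds q)" using wp by simp
  qed
  show "m \<in> negligible R p ?X"
    if m: "m \<in> carrier ?X" and neg: "insertion_map R None ds d m \<in> negligible R p (nested R None (insert_desc d ds))"
  proof -
    obtain s where s: "s \<in> carrier R - p" "s \<odot>\<^bsub>?Y\<^esub> insertion_map R None ds d m \<in> ideal_span R p ?Y"
      using neg unfolding negligible_def ins by blast
    have sR: "s \<in> carrier R" using s(1) by simp
    have cm: "c p m \<in> carrier ?N" by (rule module_hom_closed[OF c m])
    have "family (s \<odot>\<^bsub>?Y\<^esub> insertion_map R None ds d m) p \<in> ideal_span R p (factor ds p)"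
      by (rule ideal_span_hom[OF ev Y.module_axioms L.module_axioms p.a_subset s(2)])
    moreover have "family (s \<odot>\<^bsub>?Y\<^esub> insertion_map R None ds d m) p = N.fr (s \<odot>\<^bsub>?N\<^esub> c p m) \<one>"
      unfolding module_hom_smult[OF ev sR module_hom_closed[OF phi m]] phi_p
      using N.fr_smult[OF sR cm p.one_compl] .
    ultimately obtain u where u: "u \<in> carrier R - p" "u \<odot>\<^bsub>?N\<^esub> (s \<odot>\<^bsub>?N\<^esub> c p m) \<in> ideal_span R p ?N"
      using N.fr_in_ideal_span_iff[OF p.is_ideal N.smult_closed[OF sR cm] p.one_compl] by auto
    have "u \<odot>\<^bsub>?N\<^esub> (s \<odot>\<^bsub>?N\<^esub> c p m) = (u \<otimes> s) \<odot>\<^bsub>?N\<^esub> c p m"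
      using u(1) sR by (intro N.smult_assoc1[symmetric] cm) auto
    then show ?thesis using inj[OF m p.mult_compl[OF u(1) s(1)]] u(2) by simp
  qed
  show "\<exists>s\<in>carrier R - p. \<exists>m\<in>carrier ?X. mod_cong (nested R None (insert_desc d ds))
        (negligible R p (nested R None (insert_desc d ds)))
        (s \<odot>\<^bsub>nested R None (insert_desc d ds)\<^esub> y) (insertion_map R None ds d m)"
    if y: "y \<in> carrier (nested R None (insert_desc d ds))"
  proof -
    have yY: "y \<in> carrier ?Y" using y unfolding ins .
    obtain n s where n: "family y p = N.fr n s" "n \<in> carrier ?N" "s \<in> carrier R - p"
      using module_hom_closed[OF ev yY] by (auto simp: N.localize_carrier)
    have sR: "s \<in> carrier R" using n(3) by simp
    obtain x where x: "x \<in> carrier ?X" "n \<ominus>\<^bsub>?N\<^esub> c p x \<in> ideal_span R p ?N" using surj[OF n(2)] by blast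
    let ?w = "s \<odot>\<^bsub>?Y\<^esub> y \<ominus>\<^bsub>?Y\<^esub> insertion_map R None ds d x"
    note phx = module_hom_closed[OF phi x(1)] and sy = Y.smult_closed[OF sR yY]
    have w: "?w \<in> carrier ?Y" using phx sy unfolding a_minus_def by (intro Y.M.a_closed Y.M.a_inv_closed)
    have cx: "c p x \<in> carrier ?N" by (rule module_hom_closed[OF c x(1)])
    \<comment> \<open>Multiplication by s clears the denominator of the component at p, so that it
      can be compared with the image of \<open>c p x\<close>, whose denominator is one.\<close>
    have "N.fr (s \<odot>\<^bsub>?N\<^esub> n) s = N.fr (s \<odot>\<^bsub>?N\<^esub> n) (s \<otimes> \<one>)" using sR by simp
    also have "\<dots> = N.fr n \<one>" by (rule N.fr_cancel[OF n(2) p.one_compl n(3)])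
    finally have fr1: "N.fr (s \<odot>\<^bsub>?N\<^esub> n) s = N.fr n \<one>" .
    have "family ?w p = s \<odot>\<^bsub>factor ds p\<^esub> N.fr n s \<ominus>\<^bsub>factor ds p\<^esub> N.fr (c p x) \<one>"
      unfolding module_hom_minus[OF Y.module_axioms L.module_axioms ev sy phx]
        module_hom_smult[OF ev sR yY] phi_p n(1) ..
    also have "\<dots> = N.fr n \<one> \<ominus>\<^bsub>factor ds p\<^esub> N.fr (c p x) \<one>"
      unfolding N.fr_smult[OF sR n(2,3)] fr1 ..
    also have "\<dots> = to_localize R p ?N (n \<ominus>\<^bsub>?N\<^esub> c p x)"
      unfolding N.to_localize_eq[symmetric]
      by (rule module_hom_minus[OF N.module_axioms L.module_axioms N.to_localize_hom n(2) cx, symmetric])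
    also have "\<dots> \<in> ideal_span R p (factor ds p)"
      by (rule ideal_span_hom[OF N.to_localize_hom N.module_axioms L.module_axioms p.a_subset x(2)])
    finally have "?w \<in> ideal_span R p ?Y" by (rule only_p[OF w])
    then have "?w \<in> negligible R p ?Y" by (rule Y.ideal_span_negligible[OF p])
    then show ?thesis using n(3) x(1) unfolding ins mod_cong_def by blast
  qed
qed

text \<open>The position of d decides the argument. If ds is empty, the comparison map goes from R
  to its completion at p. If d exceeds the head of ds, it is the projection onto the factors at
  primes strictly containing p. If d is smaller than the head, the outermost product runs over
  primes of dimension larger than that of p, none of which contains p, and both sides are negligible
  altogether.\<close>

lemma insertion_contractible:
  assumes cat: "catenary R" and p: "primeideal p R" and d: "prime_dim R p = d" and ds: "d \<notin> set ds"
  shows "m \<in> carrier (nested R None ds) \<Longrightarrow> insertion_map R None ds d m \<in> negligible R p (nested R None (insert_desc d ds)) \<Longrightarrow>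
      m \<in> negligible R p (nested R None ds)" (is "?m \<Longrightarrow> ?neg \<Longrightarrow> ?inj")
    and "y \<in> carrier (nested R None (insert_desc d ds)) \<Longrightarrow>
      \<exists>s\<in>carrier R - p. \<exists>m\<in>carrier (nested R None ds). mod_cong (nested R None (insert_desc d ds))
        (negligible R p (nested R None (insert_desc d ds)))
        (s \<odot>\<^bsub>nested R None (insert_desc d ds)\<^esub> y) (insertion_map R None ds d m)" (is "?y \<Longrightarrow> ?surj")
proof -
  interpret p: primeideal p R by (rule p)
  have "(?m \<longrightarrow> ?neg \<longrightarrow> ?inj) \<and> (?y \<longrightarrow> ?surj)"
  proof (cases ds)
    case Nil
    interpret C: completion R p by (rule completion[OF p])
    interpret N: module R "nested R (Some p) []" by (rule nested_module) (simp add: p)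
    interpret X: module R "nested R None []" by (rule nested_module) simp
    have P1: "C.P 1 = p" by (rule ideal_power_1[OF p.is_ideal])
    have pp: "u \<in> p" if "u \<in> p <+> C.P 1" for u
      using that unfolding P1 set_add_def' by auto
    have inj: "m \<in> negligible R p (nested R None [])"
      if m: "m \<in> carrier (nested R None [])" and t: "t \<in> carrier R - p"
        and tm: "t \<odot>\<^bsub>nested R (Some p) []\<^esub> coefficient_map R None p m \<in> ideal_span R p (nested R (Some p) [])" for m t
    proof -
      obtain r where r: "m = Scalar r" "r \<in> carrier R" using m Scalar_ops(1) by auto
      have tR: "t \<in> carrier R" using t by simp
      have "Completed (C.adic (\<lambda>n. t \<otimes> r)) \<in> ideal_span R p (nested R (Some p) [])"
        using tm unfolding r(1) coefficient_None[OF p r(2)] Completed_ops(3)[OF p tR C.coherent_const[OF r(2)]] .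
      then have "t \<otimes> r \<in> p <+> C.P n" for n
        using Completed_ops(4)[OF p p.is_ideal C.coherent_const[of "t \<otimes> r"]] tR r(2) by blast
      \<comment> \<open>Level 1 suffices, because p + p^1 = p; primeness then removes t.\<close>
      then have "t \<otimes> r \<in> p" using pp by blast
      then have "r \<in> p" using p.I_prime[OF tR r(2)] t by blast
      moreover have "ideal_span R p (nested R None []) = Scalar ` p"
        using image_algebra_ideal_span[OF self_algebra_module inj_Scalar p.is_ideal] self_algebra_ideal_span[OF p.is_ideal] by simp
      ultimately show ?thesis unfolding r(1) by (intro X.ideal_span_negligible[OF p]) simp
    qed
    have surj: "\<exists>x\<in>carrier (nested R None []). n \<ominus>\<^bsub>nested R (Some p) []\<^esub> coefficient_map R None p x \<in> ideal_span R p (nested R (Some p) [])"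
      if n: "n \<in> carrier (nested R (Some p) [])" for n
    proof -
      obtain a where a: "n = Completed (C.adic a)" "C.coherent a" using n Completed_ops(1)[OF p] by auto
      \<comment> \<open>The term a 1 is the residue of the completed element modulo p. Every later
        term is congruent to it modulo p, and level 0 imposes no condition because p^0 = R.\<close>
      define r where "r = a 1"
      have r: "r \<in> carrier R" unfolding r_def by (rule C.coherentD(1)[OF a(2)])
      note cr = C.coherent_const[OF r]
      have mr: "C.coherent (\<lambda>n. \<ominus> \<one> \<otimes> r)" by (rule C.coherent_mult[OF _ cr]) simp
      have crN: "Completed (C.adic (\<lambda>n. r)) \<in> carrier (nested R (Some p) [])" using Completed_ops(1)[OF p] cr by blast
      have "n \<ominus>\<^bsub>nested R (Some p) []\<^esub> coefficient_map R None p (Scalar r) = Completed (C.adic (\<lambda>n. a n \<oplus> \<ominus> \<one> \<otimes> r))"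
        unfolding coefficient_None[OF p r] N.minus_eq_smult[OF n crN]
        unfolding a(1) Completed_ops(3)[OF p a_inv_closed[OF one_closed] cr] Completed_ops(2)[OF p a(2) mr] ..
      moreover have "a n \<oplus> \<ominus> \<one> \<otimes> r \<in> p <+> C.P n" for n
      proof (cases n)
        case 0
        have "a n \<oplus> \<ominus> \<one> \<otimes> r \<in> C.P n"
          using C.coherentD(1)[OF a(2), of n] r unfolding 0 ideal_power_0 by simp
        then have "\<zero> \<oplus> (a n \<oplus> \<ominus> \<one> \<otimes> r) \<in> p <+> C.P n" by (rule C.in_sum_ideals[OF p.zero_closed])
        then show ?thesis using C.coherentD(1)[OF a(2), of n] r by simp
      next
        case (Suc k)
        have "a n \<ominus> r \<in> C.P 1" unfolding r_def using Suc by (intro C.coherent_le[OF a(2)]) simp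
        then have "(a n \<ominus> r) \<oplus> \<zero> \<in> p <+> C.P n" unfolding P1 by (rule C.in_sum_ideals[OF _ C.P_facts(1)])
        moreover have "(a n \<ominus> r) \<oplus> \<zero> = a n \<oplus> \<ominus> \<one> \<otimes> r" using C.coherentD(1)[OF a(2), of n] r by algebra
        ultimately show ?thesis by simp
      qed
      ultimately have "n \<ominus>\<^bsub>nested R (Some p) []\<^esub> coefficient_map R None p (Scalar r) \<in> ideal_span R p (nested R (Some p) [])"
        using Completed_ops(4)[OF p p.is_ideal C.coherent_add[OF a(2) mr]] by simp
      then show ?thesis using r Scalar_ops(1) by blast
    qed
    have map: "insertion_map R None [] d x =
        Family (\<lambda>q\<in>primes_below R None d. to_localize R q (nested R (Some q) []) (coefficient_map R None q x))" for x
      by (rule insertion_map.simps)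
    have hom: "coefficient_map R None p \<in> module_hom R (nested R None []) (nested R (Some p) [])"
      by (rule coefficient_hom) (simp_all add: p lies_above_def)
    note * = contraction_at_prime[OF cat p d map _ hom inj surj]
    show ?thesis unfolding Nil using * by simp
  next
    case (Cons d0 ds')
    show ?thesis
    proof (cases "d0 < d")
      case True
      \<comment> \<open>The inclusion of p in q is strict because the dimensions d and d0 differ;
        thus the components that matter modulo p are exactly those kept by the projection.\<close>
      have pbelow: "q \<in> primes_below R (Some p) d0" if q: "q \<in> primes_below R None d0" "p \<subseteq> q" for q
        using q True d by (auto simp: primes_below_iff lies_above_def)
      define c where "c q x = Family (restrict (family x) (primes_below R (Some q) d0))" for q x
      note hom = restriction_hom[of None p d0 ds', folded c_def]
      have inj: "m \<in> negligible R p (nested R None (d0 # ds'))"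
        if m: "m \<in> carrier (nested R None (d0 # ds'))" and t: "t \<in> carrier R - p"
          and tm: "t \<odot>\<^bsub>nested R (Some p) (d0 # ds')\<^esub> c p m \<in> ideal_span R p (nested R (Some p) (d0 # ds'))" for m t
      proof -
        interpret X: module R "nested R None (d0 # ds')" by (rule nested_module) simp
        interpret N: module R "nested R (Some p) (d0 # ds')" by (rule nested_module) (simp add: p)
        have tR: "t \<in> carrier R" using t by simp
        have tmX: "t \<odot>\<^bsub>nested R None (d0 # ds')\<^esub> m \<in> carrier (nested R None (d0 # ds'))"
          by (rule X.smult_closed[OF tR m])
        have ctm: "c p (t \<odot>\<^bsub>nested R None (d0 # ds')\<^esub> m) \<in> ideal_span R p (nested R (Some p) (d0 # ds'))"
          using tm module_hom_smult[OF hom tR m] by (simp add: lies_above_def del: nested.simps)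
        have "t \<odot>\<^bsub>nested R None (d0 # ds')\<^esub> m \<in> ideal_span R p (nested R None (d0 # ds'))"
        proof (rule ideal_span_of_components[OF p tmX])
          fix q assume q: "q \<in> primes_below R None d0" "p \<subseteq> q"
          note qp = pbelow[OF q]
          have "family (c p (t \<odot>\<^bsub>nested R None (d0 # ds')\<^esub> m)) q \<in> ideal_span R p (factor ds' q)"
            by (rule ideal_span_hom[OF eval_hom[OF qp] N.module_axioms below_module[OF qp] p.a_subset ctm])
          then show "family (t \<odot>\<^bsub>nested R None (d0 # ds')\<^esub> m) q \<in> ideal_span R p (factor ds' q)"
            using qp by (simp add: c_def del: nested.simps)
        qed
        then show ?thesis unfolding negligible_def using t m by blast
      qed
      have surj: "\<exists>x\<in>carrier (nested R None (d0 # ds')). n \<ominus>\<^bsub>nested R (Some p) (d0 # ds')\<^esub> c p x \<in> ideal_span R p (nested R (Some p) (d0 # ds'))"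
        if n: "n \<in> carrier (nested R (Some p) (d0 # ds'))" for n
      proof -
        interpret N: module R "nested R (Some p) (d0 # ds')" by (rule nested_module) (simp add: p)
        obtain n' where n': "n = Family n'" "n' \<in> (\<Pi>\<^sub>E q\<in>primes_below R (Some p) d0. carrier (factor ds' q))"
          using n unfolding Family_carrier by blast
        \<comment> \<open>Extension by zero splits the projection, so surjectivity holds on the
          nose.\<close>
        define x where "x = (\<lambda>q\<in>primes_below R None d0. if q \<in> primes_below R (Some p) d0 then n' q else \<zero>\<^bsub>factor ds' q\<^esub>)"
        have z: "\<zero>\<^bsub>factor ds' q\<^esub> \<in> carrier (factor ds' q)" if "q \<in> primes_below R None d0" for q
          using module.axioms(2)[OF below_module[OF that]] abelian_group.axioms(1) abelian_monoid.zero_closed by blast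
        have x: "Family x \<in> carrier (nested R None (d0 # ds'))"
          using n'(2) z by (intro Family_in) (auto simp: x_def)
        have "primes_below R (Some p) d0 \<subseteq> primes_below R None d0" by (auto simp: primes_below_iff lies_above_def)
        then have "restrict x (primes_below R (Some p) d0) = n'"
          using n'(2) by (intro extensionalityI[of _ "primes_below R (Some p) d0"]) (auto simp: x_def PiE_iff)
        then have "c p (Family x) = n" by (simp add: c_def n'(1))
        then have "n \<ominus>\<^bsub>nested R (Some p) (d0 # ds')\<^esub> c p (Family x) = \<zero>\<^bsub>nested R (Some p) (d0 # ds')\<^esub>"
          using n unfolding a_minus_def by (simp only: N.M.r_neg)
        then have "n \<ominus>\<^bsub>nested R (Some p) (d0 # ds')\<^esub> c p (Family x) \<in> ideal_span R p (nested R (Some p) (d0 # ds'))"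
          by (simp only: ideal_span.zero)
        then show ?thesis using x by blast
      qed
      have map: "insertion_map R None (d0 # ds') d x =
          Family (\<lambda>q\<in>primes_below R None d. to_localize R q (nested R (Some q) (d0 # ds')) (c q x))" for x
        using True by (simp add: c_def del: nested.simps)
      have hom': "c p \<in> module_hom R (nested R None (d0 # ds')) (nested R (Some p) (d0 # ds'))"
        using hom by (simp add: lies_above_def del: nested.simps)
      note * = contraction_at_prime[OF cat p d map _ hom' inj surj]
      show ?thesis unfolding Cons using * True by (simp del: nested.simps insertion_map.simps)
    next
      case False
      with ds Cons have less: "d < d0" by auto
      \<comment> \<open>A prime of dimension d0 > d cannot contain p, so every component lies in p
        times its factor.\<close>
      have full: "x \<in> negligible R p (nested R None (d0 # es))" if x: "x \<in> carrier (nested R None (d0 # es))" for x es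
      proof -
        interpret X: module R "nested R None (d0 # es)" by (rule nested_module) simp
        have "\<not> p \<subseteq> q" if "q \<in> primes_below R None d0" for q
          using that less d prime_dim_less[OF cat p, of q] by (cases "p = q") (auto simp: primes_below_iff)
        then show ?thesis by (intro X.ideal_span_negligible[OF p] ideal_span_of_components[OF p x]) blast
      qed
      have ins: "insert_desc d ds = d0 # insert_desc d ds'" using less Cons by simp
      interpret X: module R "nested R None ds" by (rule nested_module) simp
      interpret Y: module R "nested R None (insert_desc d ds)" by (rule nested_module) simp
      \<comment> \<open>With the whole target negligible, the preimage zero and the denominator one
        do.\<close>
      have ?surj if y: ?y
      proof -
        have "insertion_map R None ds d \<zero>\<^bsub>nested R None ds\<^esub> \<in> carrier (nested R None (insert_desc d ds))"
          using insertion_hom[of None ds d] by (intro module_hom_closed[OF _ X.M.zero_closed]) simp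
        then have "\<one> \<odot>\<^bsub>nested R None (insert_desc d ds)\<^esub> y \<ominus>\<^bsub>nested R None (insert_desc d ds)\<^esub>
            insertion_map R None ds d \<zero>\<^bsub>nested R None ds\<^esub> \<in> carrier (nested R None (insert_desc d ds))"
          using y unfolding a_minus_def by (intro Y.M.a_closed Y.M.a_inv_closed Y.smult_closed one_closed)
        then have "mod_cong (nested R None (insert_desc d ds)) (negligible R p (nested R None (insert_desc d ds)))
            (\<one> \<odot>\<^bsub>nested R None (insert_desc d ds)\<^esub> y) (insertion_map R None ds d \<zero>\<^bsub>nested R None ds\<^esub>)"
          unfolding mod_cong_def ins by (rule full)
        then show ?thesis using p.one_compl X.M.zero_closed by blast
      qed
      moreover have ?inj if ?m using full that unfolding Cons by blast
      ultimately show ?thesis by blast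
    qed
  qed
  then show "?m \<Longrightarrow> ?neg \<Longrightarrow> ?inj" "?y \<Longrightarrow> ?surj" by blast+
qed

end

section \<open>Contraction of the adelic cube at each prime, in the direction of its
  dimension\<close>

theorem theorem11p2:
  fixes R :: "('a, 'b) ring_scheme" and r :: nat
  assumes "cring R" and "noetherian_ring R" and "catenary R" and "has_dimension R r"
  shows "homotopy_pullback R {0..r} (adelic_cube R) (adelic_cube_map R)"
proof -
  interpret noetherian_cring R using assms(1,2) by (rule noetherian_cring.intro)
  interpret flat_cube_diagram R "{0..r}" "adelic_cube R" "adelic_cube_map R"
    using adelic_diagram[of "{0..r}"] nested_colon_flat
    by unfold_locales (simp_all add: adelic_cube_def)
  show ?thesis
  proof (rule homotopy_pullback_of_directions)
    fix p assume p: "primeideal p R"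
    \<comment> \<open>The direction of contraction at p; it is an index of the cube because no prime
      has dimension above r.\<close>
    define d where "d = prime_dim R p"
    have dr: "d \<in> {0..r}" using assms(4) p by (simp add: has_dimension_def d_def)
    \<comment> \<open>The two vertices differ by the single dimension d, so the transition map of
      the cube is one insertion.\<close>
    have map: "adelic_cube_map R D (insert d D) = insertion_map R None (descending D) d"
      and cube: "adelic_cube R (insert d D) = nested R None (insert_desc d (descending D))"
      and nin: "d \<notin> set (descending D)"
      if "D \<subseteq> {0..r} - {d}" for D
    proof -
      have D: "finite D" "d \<notin> D" using that finite_subset[of D "{0..r}"] by auto
      then have "insert d D - D = {d}" by blast
      then show "adelic_cube_map R D (insert d D) = insertion_map R None (descending D) d"
        by (simp add: adelic_cube_map_def fun_eq_iff)
      show "adelic_cube R (insert d D) = nested R None (insert_desc d (descending D))"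
        using D by (simp add: adelic_cube_def descending_insert)
      show "d \<notin> set (descending D)" using D by (simp add: descending_set)
    qed
    note contr = insertion_contractible[OF assms(3) p d_def[symmetric] nin]
    have "contractible_direction R {0..r} (adelic_cube R) (adelic_cube_map R) p d"
    proof (intro contractible_direction.intro contractible_direction_axioms.intro cube_diagram_axioms p dr)
      fix D m assume D: "D \<subseteq> {0..r} - {d}"
      show "m \<in> carrier (adelic_cube R D) \<Longrightarrow> adelic_cube_map R D (insert d D) m \<in> negligible R p (adelic_cube R (insert d D)) \<Longrightarrow>
          m \<in> negligible R p (adelic_cube R D)"
        unfolding map[OF D] cube[OF D] unfolding adelic_cube_def by (rule contr(1)[OF D])
      fix y assume y: "y \<in> carrier (adelic_cube R (insert d D))"
      show "\<exists>s\<in>carrier R - p. \<exists>m\<in>carrier (adelic_cube R D).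
          mod_cong (adelic_cube R (insert d D)) (negligible R p (adelic_cube R (insert d D)))
            (s \<odot>\<^bsub>adelic_cube R (insert d D)\<^esub> y) (adelic_cube_map R D (insert d D) m)"
        using y unfolding map[OF D] cube[OF D] unfolding adelic_cube_def by (rule contr(2)[OF D])
    qed
    then show "\<exists>d. contractible_direction R {0..r} (adelic_cube R) (adelic_cube_map R) p d" by blast
  qed
qed

end
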